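(* For the probing version of $K$-median clustering with centers restricted to a fixed set $F_0\subseteq\mathcal{P}$: (a) property (P2) holds with $\rho=5$; (b) there is a polynomial-time algorithm that outputs a set $T$ of nodes with $\sum_{i\in T}c_i\le 5C$ whose outlier objective is at most $5\,\mathcal{G}^*(C)$; (c) for any $\epsilon>0$ there is a polynomial-time $(3+\epsilon)$-approximation for the posterior problem $\min_o\mathbb{E}_{\mathbf{v}_{\bar S}}[h(o;\mathbf{v}_S,\mathbf{v}_{\bar S})]$. Consequently, the non-adaptive strategy that probes $T$ from (b) and then solves the posterior problem by (c) has probing cost at most $5C$ and expected clustering cost at most $O(1)\cdot OPT_h$.
   Context: $(\mathcal{P},l)$ is a finite metric space. There are $n$ input nodes; the location of node $i$ is an independent random variable $X_i$ over $\mathcal{P}$ with an explicitly given discrete distribution; probing node $i$ costs $c_i\ge0$ and reveals its location; $C\ge\max_i c_i$ is the budget; $K$ is a positive integer and $F_0\subseteq\mathcal{P}$ the set of allowed centers. For a set $A$ of nodes, a solution $o\in\mathcal{O}_A$ is a set $F\subseteq F_0$ of $K$ centers with an assignment of nodes to centers, and $h_A(F;\mathbf{v}_A)=\sum_{i\in A}\min_{w\in F}l(\mathbf{v}_i,w)$; $h=h_{[n]}$. After probing $S$ with outcome $\mathbf{v}_S$, centers and assignment are fixed before unprobed locations are realized, so the posterior value is $\min_o\mathbb{E}_{\mathbf{v}_{\bar S}}[h(o;\mathbf{v}_S,\mathbf{v}_{\bar S})]=\min_{F}\big[\sum_{i\in S}\min_{w\in F}l(\mathbf{v}_i,w)+\sum_{i\notin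 S}\min_{w\in F}\mathbb{E}[l(X_i,w)]\big]$. An adaptive policy is a decision tree of probes whose value is the expected posterior value at its leaves; $OPT_h$ is the minimum over adaptive policies with probing cost at most $C$ on every path. (P2) with constant $\rho$: for all $A$ and $\mathbf{v}_A$, $\min_{o}\mathbb{E}[h(o;\mathbf{v}_A,\mathbf{v}_{\bar A})]\le\rho\big(\min_{o\in\mathcal{O}_A}h_A(o;\mathbf{v}_A)+\min_{o\in\mathcal{O}_{\bar A}}\mathbb{E}[h_{\bar A}(o;\mathbf{v}_{\bar A})]+\mathbb{E}[\min_o h(o;\mathbf{v}_A,\mathbf{v}_{\bar A})]\big)$. Outlier problem: $\mathcal{G}^*(C)$ is the minimum over node sets $T$ with $\sum_{i\in T}c_i\le C$ of the outlier objective $\min_F\sum_{i\notin T}\min_{w\in F}\mathbb{E}[l(X_i,w)]$. *)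

theory Defs
  imports
    "HOL-Probability.Probability"
    "HOL-Computational_Algebra.Polynomial"
    "HOL-Library.Log_Nat"
begin

section \<open>Probing version of K-median\<close>

text \<open>
  The input nodes are \<open>0, \<dots>, n - 1\<close>. Only the laws of the locations \<open>X\<^sub>i\<close> are part of an
  instance; independence enters through the product measure \<^const>\<open>Pi_pmf\<close>.
\<close>

record 'a kmedian =
  points :: "'a set"
  dist_of :: "'a \<Rightarrow> 'a \<Rightarrow> real"
  num_nodes :: nat
  law :: "nat \<Rightarrow> 'a pmf"
  probe_cost :: "nat \<Rightarrow> real"
  budget :: real
  num_centers :: nat
  allowed_centers :: "'a set"

abbreviation nodes :: "'a kmedian \<Rightarrow> nat set" where
  "nodes I \<equiv> {..<num_nodes I}"

text \<open>The condition \<open>K \<le> |F\<^sub>0|\<close> says that there is a solution at all.\<close>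

definition valid_instance :: "'a kmedian \<Rightarrow> bool" where
  "valid_instance I \<longleftrightarrow>
     finite (points I) \<and> Metric_space (points I) (dist_of I) \<and>
     0 < num_nodes I \<and>
     (\<forall>i\<in>nodes I. set_pmf (law I i) \<subseteq> points I) \<and>
     (\<forall>i\<in>nodes I. 0 \<le> probe_cost I i \<and> probe_cost I i \<le> budget I) \<and>
     0 < num_centers I \<and>
     allowed_centers I \<subseteq> points I \<and> num_centers I \<le> card (allowed_centers I)"

definition total_cost :: "'a kmedian \<Rightarrow> nat set \<Rightarrow> real" where
  "total_cost I T = (\<Sum>i\<in>T. probe_cost I i)"

text \<open>The joint law of \<open>(X\<^sub>i)\<close>, \<open>i \<in> A\<close>; coordinates outside \<open>A\<close> are \<^const>\<open>undefined\<close>.\<close>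

definition joint :: "'a kmedian \<Rightarrow> nat set \<Rightarrow> (nat \<Rightarrow> 'a) pmf" where
  "joint I A = Pi_pmf A undefined (law I)"

definition solutions :: "'a kmedian \<Rightarrow> nat set \<Rightarrow> ('a set \<times> (nat \<Rightarrow> 'a)) set" where
  "solutions I A = {(F, \<sigma>). F \<subseteq> allowed_centers I \<and> card F = num_centers I \<and> \<sigma> \<in> A \<rightarrow>\<^sub>E F}"

definition h :: "'a kmedian \<Rightarrow> nat set \<Rightarrow> 'a set \<times> (nat \<Rightarrow> 'a) \<Rightarrow> (nat \<Rightarrow> 'a) \<Rightarrow> real" where
  "h I A s v = (\<Sum>i\<in>A. dist_of I (v i) (snd s i))"

text \<open>\<open>override_on u v A\<close> is the vector \<open>(v\<^sub>A, u\<^sub>B)\<close> where \<open>B\<close> is the complement of \<open>A\<close>.\<close>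

definition posterior_cost ::
  "'a kmedian \<Rightarrow> nat set \<Rightarrow> (nat \<Rightarrow> 'a) \<Rightarrow> 'a set \<times> (nat \<Rightarrow> 'a) \<Rightarrow> real" where
  "posterior_cost I S v s =
     measure_pmf.expectation (joint I (nodes I - S)) (\<lambda>u. h I (nodes I) s (override_on u v S))"

definition posterior_value :: "'a kmedian \<Rightarrow> nat set \<Rightarrow> (nat \<Rightarrow> 'a) \<Rightarrow> real" where
  "posterior_value I S v = Min (posterior_cost I S v ` solutions I (nodes I))"

definition P2 :: "real \<Rightarrow> 'a kmedian \<Rightarrow> bool" where
  "P2 \<rho> I \<longleftrightarrow>
     (\<forall>A v. A \<subseteq> nodes I \<and> (\<forall>i\<in>A. v i \<in> points I) \<longrightarrow>
        posterior_value I A v \<le>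
          \<rho> * (Min ((\<lambda>s. h I A s v) ` solutions I A)
             + Min ((\<lambda>s. measure_pmf.expectation (joint I (nodes I - A)) (h I (nodes I - A) s))
                      ` solutions I (nodes I - A))
             + measure_pmf.expectation (joint I (nodes I - A))
                 (\<lambda>u. Min ((\<lambda>s. h I (nodes I) s (override_on u v A)) ` solutions I (nodes I)))))"

definition outlier_objective :: "'a kmedian \<Rightarrow> nat set \<Rightarrow> real" where
  "outlier_objective I T =
     Min ((\<lambda>F. \<Sum>i\<in>nodes I - T.
                 Min ((\<lambda>w. measure_pmf.expectation (law I i) (\<lambda>x. dist_of I x w)) ` F))
          ` {F. F \<subseteq> allowed_centers I \<and> card F = num_centers I})"

definition outlier_opt :: "'a kmedian \<Rightarrow> real" where
  "outlier_opt I =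
     Min (outlier_objective I ` {T. T \<subseteq> nodes I \<and> total_cost I T \<le> budget I})"


subsection \<open>Adaptive policies\<close>

datatype 'a policy = Stop | Probe nat "'a \<Rightarrow> 'a policy"

text \<open>In the two functions below \<open>S\<close> is the set of nodes probed so far and \<open>v\<close> their outcome.\<close>

primrec feasible_from :: "'a kmedian \<Rightarrow> 'a policy \<Rightarrow> nat set \<Rightarrow> bool" where
  "feasible_from I Stop S \<longleftrightarrow> total_cost I S \<le> budget I"
| "feasible_from I (Probe i next) S \<longleftrightarrow>
     i \<in> nodes I \<and> i \<notin> S \<and> (\<forall>x\<in>set_pmf (law I i). feasible_from I (next x) (insert i S))"

primrec policy_value_from ::
  "'a kmedian \<Rightarrow> 'a policy \<Rightarrow> nat set \<Rightarrow> (nat \<Rightarrow> 'a) \<Rightarrow> real" where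
  "policy_value_from I Stop S v = posterior_value I S v"
| "policy_value_from I (Probe i next) S v =
     measure_pmf.expectation (law I i)
       (\<lambda>x. policy_value_from I (next x) (insert i S) (v(i := x)))"

text \<open>
  The infimum is a minimum: branches on outcomes of probability zero do not influence the value,
  so there are only finitely many values.
\<close>

definition OPT :: "'a kmedian \<Rightarrow> real" where
  "OPT I = (INF \<pi>\<in>{\<pi>. feasible_from I \<pi> {}}. policy_value_from I \<pi> {} (\<lambda>_. undefined))"

text \<open>
  Expected cost of the non-adaptive strategy that probes \<open>T\<close> and then, on outcome \<open>v\<^sub>T\<close>, commits
  to the solution \<open>sol v\<^sub>T\<close>.
\<close>

definition strategy_cost ::
  "'a kmedian \<Rightarrow> nat set \<Rightarrow> ((nat \<Rightarrow> 'a) \<Rightarrow> 'a set \<times> (nat \<Rightarrow> 'a)) \<Rightarrow> real" where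
  "strategy_cost I T sol =
     measure_pmf.expectation (joint I (nodes I))
       (\<lambda>v. h I (nodes I) (sol (restrict v T)) v)"


section \<open>Polynomial-time computation\<close>

text \<open>
  The machine model is a first-order functional language over integers and pairs (and hence lists)
  with general recursion and logarithmic cost: every evaluation step is charged the bit size of
  the value it produces. All primitives are computable by a Turing machine in time polynomial
  in the bit size of their arguments, and evaluating these arguments has been charged at least that
  size, so polynomial time in this model is polynomial time on Turing machines.
\<close>

datatype val = Num int | Pair val val

fun bits :: "val \<Rightarrow> nat" where
  "bits (Num k) = 2 + floorlog 2 (nat \<bar>k\<bar>)"
| "bits (Pair a b) = 1 + bits a + bits b"

fun as_int :: "val \<Rightarrow> int" where
  "as_int (Num k) = k"
| "as_int (Pair a b) = 0"

fun car :: "val \<Rightarrow> val" where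
  "car (Num k) = Num 0"
| "car (Pair a b) = a"

fun cdr :: "val \<Rightarrow> val" where
  "cdr (Num k) = Num 0"
| "cdr (Pair a b) = b"

datatype prim1 = Car | Cdr | IsPair

datatype prim2 = Cons_Pair | Add | Sub | Mul | Div | Less

fun apply1 :: "prim1 \<Rightarrow> val \<Rightarrow> val" where
  "apply1 Car a = car a"
| "apply1 Cdr a = cdr a"
| "apply1 IsPair a = Num (case a of Num _ \<Rightarrow> 0 | Pair _ _ \<Rightarrow> 1)"

fun apply2 :: "prim2 \<Rightarrow> val \<Rightarrow> val \<Rightarrow> val" where
  "apply2 Cons_Pair a b = Pair a b"
| "apply2 Add a b = Num (as_int a + as_int b)"
| "apply2 Sub a b = Num (as_int a - as_int b)"
| "apply2 Mul a b = Num (as_int a * as_int b)"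
| "apply2 Div a b = Num (as_int a div as_int b)"
| "apply2 Less a b = Num (if as_int a < as_int b then 1 else 0)"

text \<open>
  \<open>Var i\<close> is a de Bruijn index into the environment. A program is the list of the bodies of its
  functions; \<open>Call f es\<close> runs the \<open>f\<close>-th body in the environment of the evaluated arguments.
\<close>

datatype expr =
    Var nat
  | Const val
  | Op1 prim1 expr
  | Op2 prim2 expr expr
  | If expr expr expr
  | Let expr expr
  | Call nat "expr list"

type_synonym program = "expr list"

text \<open>\<open>eval P env e x t\<close>: in environment \<open>env\<close>, \<open>e\<close> evaluates to \<open>x\<close> in time \<open>t\<close>.\<close>

inductive eval :: "program \<Rightarrow> val list \<Rightarrow> expr \<Rightarrow> val \<Rightarrow> nat \<Rightarrow> bool"
  and evals :: "program \<Rightarrow> val list \<Rightarrow> expr list \<Rightarrow> val list \<Rightarrow> nat \<Rightarrow> bool"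
  for P :: program where
  Var: "i < length env \<Longrightarrow> eval P env (Var i) (env ! i) (1 + bits (env ! i))"
| Const: "eval P env (Const x) x (1 + bits x)"
| Op1: "eval P env e a t \<Longrightarrow> x = apply1 f a \<Longrightarrow> eval P env (Op1 f e) x (1 + bits x + t)"
| Op2: "eval P env e1 a t1 \<Longrightarrow> eval P env e2 b t2 \<Longrightarrow> x = apply2 f a b \<Longrightarrow>
        eval P env (Op2 f e1 e2) x (1 + bits x + t1 + t2)"
| If_true: "eval P env c a t1 \<Longrightarrow> as_int a \<noteq> 0 \<Longrightarrow> eval P env e1 x t2 \<Longrightarrow>
        eval P env (If c e1 e2) x (1 + bits x + t1 + t2)"
| If_false: "eval P env c a t1 \<Longrightarrow> as_int a = 0 \<Longrightarrow> eval P env e2 x t2 \<Longrightarrow>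
        eval P env (If c e1 e2) x (1 + bits x + t1 + t2)"
| Let: "eval P env e1 a t1 \<Longrightarrow> eval P (a # env) e2 x t2 \<Longrightarrow>
        eval P env (Let e1 e2) x (1 + bits x + t1 + t2)"
| Call: "evals P env es as t1 \<Longrightarrow> f < length P \<Longrightarrow> eval P as (P ! f) x t2 \<Longrightarrow>
        eval P env (Call f es) x (1 + bits x + t1 + t2)"
| Nil: "evals P env [] [] 1"
| Cons: "eval P env e x t1 \<Longrightarrow> evals P env es xs t2 \<Longrightarrow>
        evals P env (e # es) (x # xs) (1 + t1 + t2)"

definition computes_in :: "program \<Rightarrow> val \<Rightarrow> val \<Rightarrow> nat \<Rightarrow> bool" where
  "computes_in P x y t \<longleftrightarrow> eval P [x] (Call 0 [Var 0]) y t"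

lemma eval_deterministic:
  "eval P env e x t \<Longrightarrow> eval P env e x' t' \<Longrightarrow> x' = x \<and> t' = t"
  "evals P env es xs t \<Longrightarrow> evals P env es xs' t' \<Longrightarrow> xs' = xs \<and> t' = t"
proof (induction arbitrary: x' t' and xs' t' rule: eval_evals.inducts)
  case (Var i env)
  then show ?case by (auto elim: eval.cases)
next
  case (Const env x)
  then show ?case by (auto elim: eval.cases)
next
  case (Op1 env e a t x f)
  from Op1.prems show ?case by (cases rule: eval.cases) (use Op1 in blast)
next
  case (Op2 env e1 a t1 e2 b t2 x f)
  from Op2.prems show ?case by (cases rule: eval.cases) (use Op2 in blast)
next
  case (If_true env c a t1 e1 x t2 e2)
  from If_true.prems show ?case by (cases rule: eval.cases) (use If_true in blast)+
next
  case (If_false env c a t1 e2 x t2 e1)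
  from If_false.prems show ?case by (cases rule: eval.cases) (use If_false in blast)+
next
  case (Let env e1 a t1 e2 x t2)
  from Let.prems show ?case by (cases rule: eval.cases) (use Let in blast)
next
  case (Call env es as t1 f x t2)
  from Call.prems show ?case by (cases rule: eval.cases) (use Call in blast)
next
  case (Nil env)
  then show ?case by (auto elim: evals.cases)
next
  case (Cons env e x t1 es xs t2)
  from Cons.prems show ?case by (cases rule: evals.cases) (use Cons in blast)
qed

definition result :: "program \<Rightarrow> val \<Rightarrow> val" where
  "result P x = (THE y. \<exists>t. computes_in P x y t)"

lemma result_eq: "computes_in P x y t \<Longrightarrow> result P x = y"
  unfolding result_def computes_in_def using eval_deterministic(1) by blast

definition polynomial_time_on :: "val set \<Rightarrow> program \<Rightarrow> bool" where
  "polynomial_time_on X P \<longleftrightarrow>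
     (\<exists>q :: nat poly. \<forall>x\<in>X. \<exists>y t. computes_in P x y t \<and> t \<le> poly q (bits x))"


subsection \<open>Encoding of instances and solutions\<close>

text \<open>
  Algorithms receive instances with rational data (in binary) whose points are \<open>0, \<dots>, m - 1\<close>.
\<close>

definition rational_instance :: "nat kmedian \<Rightarrow> bool" where
  "rational_instance I \<longleftrightarrow>
     valid_instance I \<and> points I = {..<card (points I)} \<and>
     (\<forall>x\<in>points I. \<forall>y\<in>points I. dist_of I x y \<in> \<rat>) \<and>
     (\<forall>i\<in>nodes I. \<forall>x\<in>points I. pmf (law I i) x \<in> \<rat>) \<and>
     (\<forall>i\<in>nodes I. probe_cost I i \<in> \<rat>) \<and> budget I \<in> \<rat>"

definition enc_nat :: "nat \<Rightarrow> val" where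
  "enc_nat k = Num (int k)"

definition enc_rat :: "real \<Rightarrow> val" where
  "enc_rat x = (case quotient_of (the_inv real_of_rat x) of (p, q) \<Rightarrow> Pair (Num p) (Num q))"

fun enc_list :: "val list \<Rightarrow> val" where
  "enc_list [] = Num 0"
| "enc_list (x # xs) = Pair x (enc_list xs)"

definition enc_instance :: "nat kmedian \<Rightarrow> val" where
  "enc_instance I = (let m = card (points I); n = num_nodes I in
     enc_list
       [enc_nat m,
        enc_list (map (\<lambda>x. enc_list (map (\<lambda>y. enc_rat (dist_of I x y)) [0..<m])) [0..<m]),
        enc_nat n,
        enc_list (map (\<lambda>i. enc_list (map (\<lambda>x. enc_rat (pmf (law I i) x)) [0..<m])) [0..<n]),
        enc_list (map (\<lambda>i. enc_rat (probe_cost I i)) [0..<n]),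
        enc_rat (budget I),
        enc_nat (num_centers I),
        enc_list (map enc_nat (sorted_list_of_set (allowed_centers I)))])"

text \<open>A posterior problem: an instance, and for each node its location if it has been probed.\<close>

definition enc_posterior :: "nat kmedian \<Rightarrow> nat set \<Rightarrow> (nat \<Rightarrow> nat) \<Rightarrow> val" where
  "enc_posterior I S v =
     Pair (enc_instance I)
       (enc_list (map (\<lambda>i. if i \<in> S then Pair (Num 1) (enc_nat (v i)) else Num 0)
                      [0..<num_nodes I]))"

definition dec_nat :: "val \<Rightarrow> nat" where
  "dec_nat x = nat (as_int x)"

fun dec_set :: "val \<Rightarrow> nat set" where
  "dec_set (Num k) = {}"
| "dec_set (Pair a b) = insert (dec_nat a) (dec_set b)"

text \<open>
  A solution is output as a pair: the list of its centers, and the list of the centers assigned to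
  the nodes \<open>0, \<dots>, n - 1\<close>.
\<close>

definition dec_solution :: "nat kmedian \<Rightarrow> val \<Rightarrow> nat set \<times> (nat \<Rightarrow> nat)" where
  "dec_solution I y =
     (dec_set (car y), \<lambda>i\<in>nodes I. dec_nat (car ((cdr ^^ i) (cdr y))))"


subsection \<open>The two algorithmic guarantees\<close>

definition output_set :: "program \<Rightarrow> nat kmedian \<Rightarrow> nat set" where
  "output_set P I = dec_set (result P (enc_instance I))"

definition output_solution ::
  "program \<Rightarrow> nat kmedian \<Rightarrow> nat set \<Rightarrow> (nat \<Rightarrow> nat) \<Rightarrow> nat set \<times> (nat \<Rightarrow> nat)" where
  "output_solution P I S v = dec_solution I (result P (enc_posterior I S v))"

definition outlier_algorithm :: "real \<Rightarrow> real \<Rightarrow> program \<Rightarrow> bool" where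
  "outlier_algorithm \<alpha> \<beta> P \<longleftrightarrow>
     polynomial_time_on {enc_instance I | I. rational_instance I} P \<and>
     (\<forall>I. rational_instance I \<longrightarrow>
        output_set P I \<subseteq> nodes I \<and>
        total_cost I (output_set P I) \<le> \<alpha> * budget I \<and>
        outlier_objective I (output_set P I) \<le> \<beta> * outlier_opt I)"

definition posterior_instance :: "nat kmedian \<Rightarrow> nat set \<Rightarrow> (nat \<Rightarrow> nat) \<Rightarrow> bool" where
  "posterior_instance I S v \<longleftrightarrow>
     rational_instance I \<and> S \<subseteq> nodes I \<and> (\<forall>i\<in>S. v i \<in> points I)"

definition posterior_algorithm :: "real \<Rightarrow> program \<Rightarrow> bool" where
  "posterior_algorithm \<alpha> P \<longleftrightarrow>
     polynomial_time_on {enc_posterior I S v | I S v. posterior_instance I S v} P \<and>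
     (\<forall>I S v. posterior_instance I S v \<longrightarrow>
        output_solution P I S v \<in> solutions I (nodes I) \<and>
        posterior_cost I S v (output_solution P I S v) \<le> \<alpha> * posterior_value I S v)"

end

theory Submission
  imports Defs "HOL-Library.More_List"
begin

text \<open>
  Let \<open>d\<^sub>i(w)\<close> be the distance of node \<open>i\<close> from the point \<open>w\<close>, in expectation if \<open>i\<close> is not probed.
  Both algorithmic problems are \<open>K\<close>-median problems with penalties, that is, \<open>F\<close> has to minimize
  \<open>\<Sum>\<^sub>i min(p\<^sub>i, min\<^bsub>w\<in>F\<^esub> d\<^sub>i(w))\<close>. Local search with swaps of up to \<open>p\<close> centers finds a set whose cost
  is at most \<open>3 + 2/p\<close> times the connection cost plus \<open>1 + 1/p\<close> times the penalties of any
  competitor, up to an error that vanishes by integrality. The posterior problem is the case of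
  penalties that are never paid. For the outlier problem the penalties are \<open>\<mu> c\<^sub>i\<close>, and a geometric search
  for \<open>\<mu>\<close> balances cost and objective; since penalties are only multiplied by about 1, both
  ratios are below 5 for some power of 2.

  For the expected cost, an adaptive policy stops with a probed set of cost at most \<open>C\<close>, hence
  \<open>\<G>\<^sup>*(C) \<le> OPT\<close>, and it cannot beat the expected optimum under full information. (P2) bounds the
  posterior value by these two quantities.

  Both algorithms are composed of primitives and folds whose intermediate states have polynomially
  bounded size, and such functions are computed by polynomial-time programs.
\<close>

section \<open>Polynomial-time functions\<close>

text \<open>The obstacle to local search is its stopping rule: no polynomial bound on the number of
  rounds to a true local optimum is at hand. The analysis is therefore carried out with the gain
  \<open>g\<close> of the best swap in place of local optimality. The excess over the guarantee is
  at most \<open>K * g\<close>, so a number of rounds fixed in advance suffices. All data are scaled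
  to integers by products of denominators, which is what lets a small additive error be absorbed.

  The value 5 is reached with \<open>p = 20\<close>: the connection factor is 3.1 and the penalty
  factor 1.05. A power of 2 can be found between 0.8 G and 1.6 G; the objective is then at most (3.1
  + 1.05 * 1.6) G and the cost at most (3.1 / 0.8 + 1.05) C. Both factors are below 5 and leave room
  for the additive error. Since G itself is unknown, every power of 2 in a suitable range is tried.

  Time bounds are claimed for all values of an input type and not only for valid encodings, so size
  estimates must hold for arbitrary lists, while correctness is proved for instances only.\<close>

class enc =
  fixes enc :: "'a \<Rightarrow> val"

instantiation int :: enc
begin
definition enc_int_def: "enc = Num"
instance ..
end

instantiation nat :: enc
begin
definition enc_nat_eq: "enc = enc_nat"
instance ..
end

instantiation bool :: enc
begin
definition enc_bool_def: "enc b = Num (if b then 1 else 0)"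
instance ..
end

instantiation prod :: (enc, enc) enc
begin
definition enc_prod_def: "enc p = Pair (enc (fst p)) (enc (snd p))"
instance ..
end

instantiation list :: (enc) enc
begin
definition enc_list_def: "enc xs = enc_list (map enc xs)"
instance ..
end

instantiation option :: (enc) enc
begin
definition enc_option_def: "enc x = (case x of None \<Rightarrow> Num 0 | Some y \<Rightarrow> Pair (Num 1) (enc y))"
instance ..
end

lemma enc_simps [simp]:
  "enc (k :: int) = Num k"
  "enc (n :: nat) = Num (int n)"
  "enc b = Num (if b then 1 else 0)"
  "enc (x, y) = Pair (enc x) (enc y)"
  "enc [] = Num 0"
  "enc (z # zs) = Pair (enc z) (enc zs)"
  "enc None = Num 0"
  "enc (Some u) = Pair (Num 1) (enc u)"
  by (simp_all add: enc_int_def enc_nat_eq enc_nat_def enc_bool_def enc_prod_def enc_list_def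
      enc_option_def)

section \<open>Bit sizes of lists and of arithmetic\<close>

lemma floorlog_0 [simp]: "floorlog b 0 = 0"
  by (simp add: floorlog_def)

lemma floorlog_1 [simp]: "floorlog 2 (Suc 0) = 1"
  by (simp add: floorlog_def)

definition size_of :: "'a :: enc \<Rightarrow> nat" where
  "size_of x = bits (enc x)"

lemma bits_ge_2: "2 \<le> bits x"
  by (induction x) auto

lemma size_of_ge_2: "2 \<le> size_of x"
  by (simp add: size_of_def bits_ge_2)

lemma size_of_simps [simp]:
  "size_of (x, y) = 1 + size_of x + size_of y"
  "size_of [] = 2"
  "size_of (z # zs) = 1 + size_of z + size_of zs"
  by (simp_all add: size_of_def)

lemma size_of_bool [simp]: "size_of b = (if b then 3 else 2)" for b :: bool
  by (simp add: size_of_def floorlog_def)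

lemma floorlog2_le: "floorlog 2 n \<le> n"
proof (induction n rule: less_induct)
  case (less n)
  show ?case
  proof (cases "n = 0")
    case False
    then show ?thesis using less[of "n div 2"] by (simp add: compute_floorlog[of 2 n])
  qed simp
qed

lemma size_of_nat_le: "size_of (n :: nat) \<le> n + 2"
  using floorlog2_le[of n] by (simp add: size_of_def)

lemma size_of_list: "size_of xs = 2 + (\<Sum>x\<leftarrow>xs. 1 + size_of x)"
  by (induction xs) auto

text \<open>The 2 is the size of the end marker \<open>Num 0\<close>, which two separate lists have
  twice and their concatenation once.\<close>

lemma size_of_append [simp]: "size_of (xs @ ys) + 2 = size_of xs + size_of ys"
  by (induction xs) auto

lemma length_le_size: "length xs \<le> size_of xs"
  by (induction xs) auto

lemma size_of_mem_le: "x \<in> set xs \<Longrightarrow> size_of x \<le> size_of xs"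
  by (induction xs) auto

lemma size_of_list_bound:
  assumes "\<And>x. x \<in> set xs \<Longrightarrow> size_of x \<le> b"
  shows "size_of xs \<le> 2 + length xs * (b + 1)"
  using assms by (induction xs) (auto simp: algebra_simps, fastforce)

lemma floorlog2_mono: "a \<le> b \<Longrightarrow> floorlog 2 a \<le> floorlog 2 b"
  by (simp add: floorlog_mono)

lemma floorlog2_le_iff: "floorlog 2 n \<le> k \<longleftrightarrow> n < 2 ^ k"
  by (simp add: floorlog_le_iff)

lemma floorlog2_add: "floorlog 2 (a + b) \<le> floorlog 2 a + floorlog 2 b + 1"
proof -
  let ?m = "max (floorlog 2 a) (floorlog 2 b)"
  have "a < 2 ^ ?m" "b < 2 ^ ?m"
    using floorlog2_le_iff max.cobounded1 max.cobounded2 by blast+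
  then have "a + b < 2 ^ (?m + 1)" by simp
  then have "floorlog 2 (a + b) \<le> ?m + 1" by (simp only: floorlog2_le_iff)
  then show ?thesis by linarith
qed

lemma floorlog2_mult: "floorlog 2 (a * b) \<le> floorlog 2 a + floorlog 2 b"
proof -
  have "a < 2 ^ floorlog 2 a" "b < 2 ^ floorlog 2 b"
    using floorlog2_le_iff by blast+
  then have "a * b < 2 ^ floorlog 2 a * 2 ^ floorlog 2 b"
    by (intro mult_strict_mono') auto
  then show ?thesis by (simp only: floorlog2_le_iff power_add)
qed

text \<open>A carry may add one bit, but \<open>bits\<close> charges a constant 2 for every number,
  and the sum pays it only once.\<close>

lemma bits_add: "bits (Num (a + b)) + 1 \<le> bits (Num a) + bits (Num b)"
proof -
  have "nat \<bar>a + b\<bar> \<le> nat \<bar>a\<bar> + nat \<bar>b\<bar>" by linarith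
  then have "floorlog 2 (nat \<bar>a + b\<bar>) \<le> floorlog 2 (nat \<bar>a\<bar> + nat \<bar>b\<bar>)"
    by (rule floorlog2_mono)
  also have "\<dots> \<le> floorlog 2 (nat \<bar>a\<bar>) + floorlog 2 (nat \<bar>b\<bar>) + 1"
    by (rule floorlog2_add)
  finally show ?thesis by simp
qed

lemma bits_minus: "bits (Num (a - b)) + 1 \<le> bits (Num a) + bits (Num b)"
  using bits_add[of a "- b"] by simp

lemma bits_mult: "bits (Num (a * b)) \<le> bits (Num a) + bits (Num b)"
  using floorlog2_mult[of "nat \<bar>a\<bar>" "nat \<bar>b\<bar>"] by (simp add: abs_mult nat_mult_distrib)

text \<open>\<open>div\<close> rounds towards minus infinity, so the absolute value of a negative
  quotient is rounded up. Since the remainder is smaller than \<open>b\<close> in absolute value,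
  the result still stays below |a| + 1. For \<open>b = 0\<close> the quotient is 0.\<close>

lemma abs_div_le: "\<bar>a div b\<bar> \<le> \<bar>a :: int\<bar>"
proof -
  have "\<bar>b\<bar> * \<bar>a div b\<bar> \<le> \<bar>a\<bar> + (\<bar>b\<bar> - 1)" if "b \<noteq> 0"
  proof -
    have "\<bar>a mod b\<bar> \<le> \<bar>b\<bar> - 1"
      using that abs_mod_less[of b a] by linarith
    moreover have "b * (a div b) = a - a mod b"
      by (simp add: minus_mod_eq_mult_div)
    then have "\<bar>b\<bar> * \<bar>a div b\<bar> = \<bar>a - a mod b\<bar>" by (metis abs_mult)
    ultimately show ?thesis by linarith
  qed
  moreover have "\<bar>a\<bar> + (\<bar>b\<bar> - 1) < \<bar>b\<bar> * (\<bar>a\<bar> + 1)" if "b \<noteq> 0"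
  proof -
    have "\<bar>a\<bar> \<le> \<bar>b\<bar> * \<bar>a\<bar>" using that mult_right_mono[of 1 "\<bar>b\<bar>" "\<bar>a\<bar>"] by simp
    then show ?thesis by (simp add: algebra_simps)
  qed
  ultimately have "\<bar>b\<bar> * \<bar>a div b\<bar> < \<bar>b\<bar> * (\<bar>a\<bar> + 1)" if "b \<noteq> 0"
    using that by (meson le_less_trans)
  then show ?thesis by (cases "b = 0") (auto simp: mult_less_cancel_left)
qed

lemma bits_div: "bits (Num (a div b)) \<le> bits (Num a)"
  using abs_div_le[of a b] by (simp add: floorlog2_mono)

lemma bits_as_int: "bits (Num (as_int a)) \<le> bits a"
  using bits_ge_2[of "car a"] by (cases a) auto

lemma bits_apply1: "bits (apply1 f a) \<le> bits a + 1"
  using bits_ge_2[of a] bits_ge_2[of "car a"] by (cases f; cases a) auto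

text \<open>Operand sizes only add up, even for products; a single primitive is therefore harmless,
  and growth has to be watched only in loops.\<close>

lemma bits_apply2: "bits (apply2 f a b) \<le> bits a + bits b + 1"
proof -
  note le = bits_as_int[of a] bits_as_int[of b] bits_ge_2[of a] bits_ge_2[of b]
  show ?thesis
  proof (cases f)
    case Add
    then show ?thesis using bits_add[of "as_int a" "as_int b"] le by (simp del: bits.simps)
  next
    case Sub
    then show ?thesis using bits_minus[of "as_int a" "as_int b"] le by (simp del: bits.simps)
  next
    case Mul
    then show ?thesis using bits_mult[of "as_int a" "as_int b"] le by (simp del: bits.simps)
  next
    case Div
    then show ?thesis using bits_div[of "as_int a" "as_int b"] le by (simp del: bits.simps)
  next
    case Less
    then show ?thesis using le by auto
  qed simp
qed

section \<open>Evaluation with upper bounds on time\<close>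

definition ev :: "program \<Rightarrow> val list \<Rightarrow> expr \<Rightarrow> val \<Rightarrow> nat \<Rightarrow> bool" where
  "ev P env e x T \<longleftrightarrow> (\<exists>t\<le>T. eval P env e x t)"

definition evs :: "program \<Rightarrow> val list \<Rightarrow> expr list \<Rightarrow> val list \<Rightarrow> nat \<Rightarrow> bool" where
  "evs P env es xs T \<longleftrightarrow> (\<exists>t\<le>T. evals P env es xs t)"

lemma ev_mono: "ev P env e x S \<Longrightarrow> S \<le> T \<Longrightarrow> ev P env e x T"
  unfolding ev_def by (meson le_trans)

lemma eval_bits: "eval P env e x t \<Longrightarrow> bits x \<le> t"
  by (cases rule: eval.cases) auto

text \<open>Every evaluation rule charges the size of the value it produces, so each time bound is
  at the same time a bound on the size of the result.\<close>

lemma ev_bits: "ev P env e x T \<Longrightarrow> bits x \<le> T"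
  unfolding ev_def using eval_bits by (meson le_trans)

lemma ev_Var: "i < length env \<Longrightarrow> x = env ! i \<Longrightarrow> ev P env (Var i) x (1 + bits x)"
  unfolding ev_def using eval_evals.Var by blast

lemma ev_Vars:
  "ev P (x # env) (Var 0) x (1 + bits x)"
  "ev P (y # x # env) (Var 1) x (1 + bits x)"
  "ev P (z # y # x # env) (Var 2) x (1 + bits x)"
  using ev_Var[of 0 "x # env" x P] ev_Var[of 1 "y # x # env" x P]
    ev_Var[of 2 "z # y # x # env" x P] by auto

lemma ev_Const: "ev P env (Const x) x (1 + bits x)"
  unfolding ev_def using eval_evals.Const by blast

lemma ev_Op1:
  "ev P env e a T \<Longrightarrow> x = apply1 f a \<Longrightarrow> ev P env (Op1 f e) x (1 + bits x + T)"
  unfolding ev_def by (meson add_left_mono eval_evals.Op1)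

lemma ev_Op2:
  assumes "ev P env e1 a T1" "ev P env e2 b T2" "x = apply2 f a b"
  shows "ev P env (Op2 f e1 e2) x (1 + bits x + T1 + T2)"
proof -
  obtain t1 t2 where t: "t1 \<le> T1" "eval P env e1 a t1" "t2 \<le> T2" "eval P env e2 b t2"
    using assms unfolding ev_def by blast
  show ?thesis unfolding ev_def
    using t(1,3) eval_evals.Op2[OF t(2,4) assms(3)]
    by (intro exI[of _ "1 + bits x + t1 + t2"]) auto
qed

lemma ev_If_true:
  assumes "ev P env c a T1" "as_int a \<noteq> 0" "ev P env e1 x T2"
  shows "ev P env (If c e1 e2) x (1 + bits x + T1 + T2)"
proof -
  obtain t1 t2 where t: "t1 \<le> T1" "eval P env c a t1" "t2 \<le> T2" "eval P env e1 x t2"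
    using assms unfolding ev_def by blast
  show ?thesis unfolding ev_def
    using t(1,3) eval_evals.If_true[OF t(2) assms(2) t(4)]
    by (intro exI[of _ "1 + bits x + t1 + t2"]) auto
qed

lemma ev_If_false:
  assumes "ev P env c a T1" "as_int a = 0" "ev P env e2 x T2"
  shows "ev P env (If c e1 e2) x (1 + bits x + T1 + T2)"
proof -
  obtain t1 t2 where t: "t1 \<le> T1" "eval P env c a t1" "t2 \<le> T2" "eval P env e2 x t2"
    using assms unfolding ev_def by blast
  show ?thesis unfolding ev_def
    using t(1,3) eval_evals.If_false[OF t(2) assms(2) t(4)]
    by (intro exI[of _ "1 + bits x + t1 + t2"]) auto
qed

lemma ev_Call:
  assumes "evs P env es as T1" "f < length P" "ev P as (P ! f) x T2"
  shows "ev P env (Call f es) x (1 + bits x + T1 + T2)"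
proof -
  obtain t1 t2 where t: "t1 \<le> T1" "evals P env es as t1" "t2 \<le> T2" "eval P as (P ! f) x t2"
    using assms unfolding ev_def evs_def by blast
  show ?thesis unfolding ev_def
    using t(1,3) eval_evals.Call[OF t(2) assms(2) t(4)]
    by (intro exI[of _ "1 + bits x + t1 + t2"]) auto
qed

lemma evs_Nil: "evs P env [] [] 1"
  unfolding evs_def using eval_evals.Nil by blast

lemma evs_Cons:
  assumes "ev P env e x T1" "evs P env es xs T2"
  shows "evs P env (e # es) (x # xs) (1 + T1 + T2)"
proof -
  obtain t1 t2 where t: "t1 \<le> T1" "eval P env e x t1" "t2 \<le> T2" "evals P env es xs t2"
    using assms unfolding ev_def evs_def by blast
  show ?thesis unfolding evs_def
    using t(1,3) eval_evals.Cons[OF t(2,4)]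
    by (intro exI[of _ "1 + t1 + t2"]) auto
qed

text \<open>
  The quantifier over the length \<open>n\<close> of the prefix \<open>P\<close> makes the code relocatable, and \<open>R\<close> allows
  further functions to follow; hence pieces of code can be linked by concatenation.
\<close>

definition polytime :: "('a :: enc \<Rightarrow> 'b :: enc) \<Rightarrow> bool" where
  "polytime f \<longleftrightarrow> (\<forall>n. \<exists>Q e q. \<forall>P R x. length P = n \<longrightarrow>
     ev (P @ Q @ R) [enc x] e (enc (f x)) (poly q (size_of x)))"

definition polybound :: "('a :: enc \<Rightarrow> nat) \<Rightarrow> bool" where
  "polybound g \<longleftrightarrow> (\<exists>q. \<forall>x. g x \<le> poly q (size_of x))"

lemma poly_nat_mono: "a \<le> b \<Longrightarrow> poly q a \<le> poly q b" for q :: "nat poly"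
  by (induction q) (auto intro: add_mono mult_mono)

lemma polybound_mono: "polybound g \<Longrightarrow> (\<And>x. f x \<le> g x) \<Longrightarrow> polybound f"
  unfolding polybound_def by (meson le_trans)

lemma polybound_const: "polybound (\<lambda>x. c)"
  unfolding polybound_def by (rule exI[of _ "[:c:]"]) auto

lemma polybound_size: "polybound size_of"
  unfolding polybound_def by (rule exI[of _ "[:0, 1:]"]) auto

lemma polybound_add: "polybound f \<Longrightarrow> polybound g \<Longrightarrow> polybound (\<lambda>x. f x + g x)"
  unfolding polybound_def by (metis add_mono poly_add)

lemma polybound_mult: "polybound f \<Longrightarrow> polybound g \<Longrightarrow> polybound (\<lambda>x. f x * g x)"
  unfolding polybound_def by (metis mult_mono poly_mult zero_le)

lemma polybound_poly: "polybound f \<Longrightarrow> polybound (\<lambda>x. poly q (f x))"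
  unfolding polybound_def by (metis poly_nat_mono poly_pcompose)

lemma polybound_comp:
  assumes "polybound g" "polybound (\<lambda>x. size_of (f x))"
  shows "polybound (\<lambda>x. g (f x))"
proof -
  obtain q where "\<forall>x. g x \<le> poly q (size_of x)" using assms(1) unfolding polybound_def by blast
  then show ?thesis by (intro polybound_mono[OF polybound_poly[OF assms(2), of q]]) auto
qed

lemma polybound_Suc: "polybound f \<Longrightarrow> polybound (\<lambda>x. Suc (f x))"
  using polybound_add[OF polybound_const[of 1]] by simp

lemmas polybound_intros =
  polybound_Suc polybound_const polybound_size polybound_add polybound_mult polybound_poly

text \<open>Any polynomially bounded function may stand in for the polynomial, so running times can
  be written in terms of the sizes of intermediate results.\<close>

lemma polytimeI:
  assumes "\<And>n. \<exists>Q e g. polybound g \<and> (\<forall>P R x. length P = n \<longrightarrow>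
     ev (P @ Q @ R) [enc x] e (enc (f x)) (g x))"
  shows "polytime f"
  unfolding polytime_def
proof
  fix n
  obtain Q e g where "polybound g" and *: "\<And>P R x. length P = n \<Longrightarrow>
     ev (P @ Q @ R) [enc x] e (enc (f x)) (g x)"
    using assms by metis
  then obtain q where "\<And>x. g x \<le> poly q (size_of x)" unfolding polybound_def by blast
  then show "\<exists>Q e q. \<forall>P R x. length P = n \<longrightarrow>
     ev (P @ Q @ R) [enc x] e (enc (f x)) (poly q (size_of x))"
    using * ev_mono by blast
qed

lemma polytimeE:
  assumes "polytime f"
  obtains Q e g where "polybound g"
    "\<And>P R x. length P = n \<Longrightarrow> ev (P @ Q @ R) [enc x] e (enc (f x)) (g x)"
proof -
  obtain Q e q where "\<And>P R x. length P = n \<Longrightarrow>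
     ev (P @ Q @ R) [enc x] e (enc (f x)) (poly q (size_of x))"
    using assms unfolding polytime_def by metis
  then show thesis
    using that[of "\<lambda>x. poly q (size_of x)"] polybound_poly[OF polybound_size] by blast
qed

lemma polytime_size: "polytime f \<Longrightarrow> polybound (\<lambda>x. size_of (f x))"
proof (erule polytimeE[where n = 0])
  fix Q e g
  assume "polybound g"
    and "\<And>P R x. length P = 0 \<Longrightarrow> ev (P @ Q @ R) [enc x] e (enc (f x)) (g x)"
  then show "polybound (\<lambda>x. size_of (f x))"
    unfolding size_of_def using ev_bits polybound_mono
    by (metis (no_types, lifting) list.size(3))
qed

lemma polytime_bound_comp: "polybound g \<Longrightarrow> polytime f \<Longrightarrow> polybound (\<lambda>x. g (f x))"
  by (rule polybound_comp[OF _ polytime_size])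

section \<open>Closure under primitives, composition and branching\<close>

lemma polytime_id: "polytime (\<lambda>x. x)"
proof (rule polytimeI, intro exI conjI allI impI)
  fix P R :: program and x :: 'a
  show "ev (P @ [] @ R) [enc x] (Var 0) (enc x) (1 + size_of x)"
    unfolding size_of_def by (rule ev_Var) auto
qed (intro polybound_intros)

lemma polytime_const: "polytime (\<lambda>x. c)"
proof (rule polytimeI, intro exI conjI allI impI)
  fix P R :: program and x :: 'a
  show "ev (P @ [] @ R) [enc x] (Const (enc c)) (enc c) (1 + size_of c)"
    unfolding size_of_def by (rule ev_Const)
qed (intro polybound_intros)

lemma polytime_op1:
  assumes "polytime f" "\<And>x. enc (g x) = apply1 p (enc (f x))"
  shows "polytime g"
proof (rule polytimeI, goal_cases)
  case (1 n)
  obtain Q e T where T: "polybound T"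
    "\<And>P R x. length P = n \<Longrightarrow> ev (P @ Q @ R) [enc x] e (enc (f x)) (T x)"
    using polytimeE[OF assms(1)] by metis
  have "ev (P @ Q @ R) [enc x] (Op1 p e) (enc (g x)) (1 + (size_of (f x) + 1) + T x)"
    if "length P = n" for P R x
    by (rule ev_mono[OF ev_Op1[OF T(2) assms(2)]])
       (use that bits_apply1[of p "enc (f x)"] assms(2) in \<open>auto simp: size_of_def\<close>)
  moreover have "polybound (\<lambda>x. 1 + (size_of (f x) + 1) + T x)"
    by (intro polybound_intros polytime_size assms T)
  ultimately show ?case by meson
qed

lemma polytime_op2:
  assumes "polytime f1" "polytime f2" "\<And>x. enc (g x) = apply2 p (enc (f1 x)) (enc (f2 x))"
  shows "polytime g"
proof (rule polytimeI, goal_cases)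
  case (1 n)
  obtain Q1 e1 T1 where T1: "polybound T1"
    "\<And>P R x. length P = n \<Longrightarrow> ev (P @ Q1 @ R) [enc x] e1 (enc (f1 x)) (T1 x)"
    using polytimeE[OF assms(1)] by metis
  obtain Q2 e2 T2 where T2: "polybound T2"
    "\<And>P R x. length P = n + length Q1 \<Longrightarrow> ev (P @ Q2 @ R) [enc x] e2 (enc (f2 x)) (T2 x)"
    using polytimeE[OF assms(2)] by metis
  have "ev (P @ (Q1 @ Q2) @ R) [enc x] (Op2 p e1 e2) (enc (g x))
          (1 + (size_of (f1 x) + size_of (f2 x) + 1) + T1 x + T2 x)"
    if "length P = n" for P R x
  proof (rule ev_mono[OF ev_Op2])
    show "ev (P @ (Q1 @ Q2) @ R) [enc x] e1 (enc (f1 x)) (T1 x)"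
      using T1(2)[of P "Q2 @ R" x] that by simp
    show "ev (P @ (Q1 @ Q2) @ R) [enc x] e2 (enc (f2 x)) (T2 x)"
      using T2(2)[of "P @ Q1" R x] that by simp
  qed (use bits_apply2[of p "enc (f1 x)" "enc (f2 x)"] assms(3) in \<open>auto simp: size_of_def\<close>)
  moreover have "polybound (\<lambda>x. 1 + (size_of (f1 x) + size_of (f2 x) + 1) + T1 x + T2 x)"
    by (intro polybound_intros polytime_size assms T1 T2)
  ultimately show ?case by meson
qed

lemma polytime_Pair: "polytime f \<Longrightarrow> polytime g \<Longrightarrow> polytime (\<lambda>x. (f x, g x))"
  by (rule polytime_op2[where p = Cons_Pair and ?f1.0 = f and ?f2.0 = g]) auto

lemma polytime_fst: "polytime f \<Longrightarrow> polytime (\<lambda>x. fst (f x))"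
  by (rule polytime_op1[where p = Car]) (auto simp: enc_prod_def)

lemma polytime_snd: "polytime f \<Longrightarrow> polytime (\<lambda>x. snd (f x))"
  by (rule polytime_op1[where p = Cdr]) (auto simp: enc_prod_def)

lemma polytime_Cons: "polytime f \<Longrightarrow> polytime g \<Longrightarrow> polytime (\<lambda>x. f x # g x)"
  by (rule polytime_op2[where p = Cons_Pair and ?f1.0 = f and ?f2.0 = g]) auto

lemma polytime_int_add: "polytime f \<Longrightarrow> polytime g \<Longrightarrow> polytime (\<lambda>x. f x + g x :: int)"
  by (rule polytime_op2[where p = Add and ?f1.0 = f and ?f2.0 = g]) auto

lemma polytime_int_diff: "polytime f \<Longrightarrow> polytime g \<Longrightarrow> polytime (\<lambda>x. f x - g x :: int)"
  by (rule polytime_op2[where p = Sub and ?f1.0 = f and ?f2.0 = g]) auto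

lemma polytime_int_mult: "polytime f \<Longrightarrow> polytime g \<Longrightarrow> polytime (\<lambda>x. f x * g x :: int)"
  by (rule polytime_op2[where p = Mul and ?f1.0 = f and ?f2.0 = g]) auto

lemma polytime_int_div: "polytime f \<Longrightarrow> polytime g \<Longrightarrow> polytime (\<lambda>x. f x div g x :: int)"
  by (rule polytime_op2[where p = Div and ?f1.0 = f and ?f2.0 = g]) auto

lemma polytime_int_less: "polytime f \<Longrightarrow> polytime g \<Longrightarrow> polytime (\<lambda>x. f x < (g x :: int))"
  by (rule polytime_op2[where p = Less and ?f1.0 = f and ?f2.0 = g]) auto

lemma polytime_nat_less: "polytime f \<Longrightarrow> polytime g \<Longrightarrow> polytime (\<lambda>x. f x < (g x :: nat))"
  by (rule polytime_op2[where p = Less and ?f1.0 = f and ?f2.0 = g]) auto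

lemma polytime_Suc: "polytime f \<Longrightarrow> polytime (\<lambda>x. Suc (f x))"
  by (rule polytime_op2[where p = Add, OF polytime_const[of "1 :: int"]]) auto

text \<open>Naturals and integers share their encoding, so the conversion needs no code.\<close>

lemma polytime_int_of_nat: "polytime f \<Longrightarrow> polytime (\<lambda>x. int (f x))"
  unfolding polytime_def by simp

text \<open>The code \<open>e2\<close> is only known to run when its argument is the sole variable.
  It therefore becomes a function of its own at position \<open>?k\<close>, and \<open>Call\<close>
  replaces the environment by the value of \<open>e1\<close>.\<close>

lemma polytime_comp:
  fixes f :: "'a :: enc \<Rightarrow> 'b :: enc" and g :: "'b \<Rightarrow> 'c :: enc"
  assumes "polytime g" "polytime f"
  shows "polytime (\<lambda>x. g (f x))"
proof (rule polytimeI, goal_cases)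
  case (1 n)
  obtain Q1 e1 T1 where T1: "polybound T1"
    "\<And>P R x. length P = n \<Longrightarrow> ev (P @ Q1 @ R) [enc x] e1 (enc (f x)) (T1 x)"
    using polytimeE[OF assms(2)] by metis
  obtain Q2 e2 T2 where T2: "polybound T2"
    "\<And>P R x. length P = n + length Q1 \<Longrightarrow> ev (P @ Q2 @ R) [enc x] e2 (enc (g x)) (T2 x)"
    using polytimeE[OF assms(1)] by metis
  let ?k = "n + length Q1 + length Q2"
  have "ev (P @ (Q1 @ Q2 @ [e2]) @ R) [enc x] (Call ?k [e1]) (enc (g (f x)))
          (1 + T2 (f x) + (1 + T1 x + 1) + T2 (f x))"
    if "length P = n" for P R x
  proof (rule ev_mono[OF ev_Call[OF evs_Cons[OF _ evs_Nil]]])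
    have Pk: "(P @ (Q1 @ Q2 @ [e2]) @ R) ! ?k = e2"
      using that by (simp add: nth_append)
    have ev2: "ev (P @ (Q1 @ Q2 @ [e2]) @ R) [enc (f x)] e2 (enc (g (f x))) (T2 (f x))"
      using T2(2)[of "P @ Q1" "[e2] @ R" "f x"] that by simp
    then show "ev (P @ (Q1 @ Q2 @ [e2]) @ R) [enc (f x)] ((P @ (Q1 @ Q2 @ [e2]) @ R) ! ?k)
        (enc (g (f x))) (T2 (f x))" unfolding Pk .
    show "ev (P @ (Q1 @ Q2 @ [e2]) @ R) [enc x] e1 (enc (f x)) (T1 x)"
      using T1(2)[of P "Q2 @ [e2] @ R" x] that by simp
    show "1 + bits (enc (g (f x))) + (1 + T1 x + 1) + T2 (f x)
        \<le> 1 + T2 (f x) + (1 + T1 x + 1) + T2 (f x)"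
      using ev_bits[OF ev2] by simp
  qed (use that in auto)
  moreover have "polybound (\<lambda>x. 1 + T2 (f x) + (1 + T1 x + 1) + T2 (f x))"
    by (intro polybound_intros polytime_bound_comp[OF T2(1)] assms T1)
  ultimately show ?case by meson
qed

lemma polytime_If:
  assumes "polytime b" "polytime f" "polytime g"
  shows "polytime (\<lambda>x. if b x then f x else g x)"
proof (rule polytimeI, goal_cases)
  case (1 n)
  obtain Q0 e0 T0 where T0: "polybound T0"
    "\<And>P R x. length P = n \<Longrightarrow> ev (P @ Q0 @ R) [enc x] e0 (enc (b x)) (T0 x)"
    using polytimeE[OF assms(1)] by metis
  obtain Q1 e1 T1 where T1: "polybound T1"
    "\<And>P R x. length P = n + length Q0 \<Longrightarrow> ev (P @ Q1 @ R) [enc x] e1 (enc (f x)) (T1 x)"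
    using polytimeE[OF assms(2)] by metis
  obtain Q2 e2 T2 where T2: "polybound T2"
    "\<And>P R x. length P = n + length Q0 + length Q1 \<Longrightarrow>
       ev (P @ Q2 @ R) [enc x] e2 (enc (g x)) (T2 x)"
    using polytimeE[OF assms(3)] by metis
  let ?h = "\<lambda>x. 1 + T1 x + T2 x + T0 x + T1 x + T2 x"
  have "ev (P @ (Q0 @ Q1 @ Q2) @ R) [enc x] (If e0 e1 e2) (enc (if b x then f x else g x)) (?h x)"
    if "length P = n" for P R x
  proof -
    have ev0: "ev (P @ (Q0 @ Q1 @ Q2) @ R) [enc x] e0 (enc (b x)) (T0 x)"
      using T0(2)[of P "Q1 @ Q2 @ R" x] that by simp
    have ev1: "ev (P @ (Q0 @ Q1 @ Q2) @ R) [enc x] e1 (enc (f x)) (T1 x)"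
      using T1(2)[of "P @ Q0" "Q2 @ R" x] that by simp
    have ev2: "ev (P @ (Q0 @ Q1 @ Q2) @ R) [enc x] e2 (enc (g x)) (T2 x)"
      using T2(2)[of "P @ Q0 @ Q1" R x] that by simp
    show ?thesis
    proof (cases "b x")
      case True
      then show ?thesis
        using ev_mono[OF ev_If_true[OF ev0 _ ev1], of "?h x" e2] ev_bits[OF ev1] by simp
    next
      case False
      then show ?thesis
        using ev_mono[OF ev_If_false[OF ev0 _ ev2], of "?h x" e1] ev_bits[OF ev2] by simp
    qed
  qed
  moreover have "polybound ?h"
    by (intro polybound_intros T0 T1 T2)
  ultimately show ?case by meson
qed

text \<open>\<open>None\<close> is encoded by a number and \<open>Some\<close> by a pair, so
  \<open>IsPair\<close> tells them apart and \<open>Cdr\<close> unpacks the value. As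
  \<open>e0\<close> is only known to run in a one-variable environment, it is evaluated a second
  time instead of being bound by \<open>Let\<close>.\<close>

lemma polytime_case_option:
  fixes f :: "'a :: enc \<Rightarrow> 'b :: enc option" and h' :: "'a \<Rightarrow> 'b \<Rightarrow> 'c :: enc"
  assumes "polytime f" "polytime g" "polytime (\<lambda>z. h' (fst z) (snd z))"
  shows "polytime (\<lambda>x. case f x of None \<Rightarrow> g x | Some y \<Rightarrow> h' x y)"
proof (rule polytimeI, goal_cases)
  case (1 n)
  obtain Q0 e0 T0 where T0: "polybound T0"
    "\<And>P R x. length P = n \<Longrightarrow> ev (P @ Q0 @ R) [enc x] e0 (enc (f x)) (T0 x)"
    using polytimeE[OF assms(1)] by metis
  obtain Q1 e1 T1 where T1: "polybound T1"
    "\<And>P R x. length P = n + length Q0 \<Longrightarrow> ev (P @ Q1 @ R) [enc x] e1 (enc (g x)) (T1 x)"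
    using polytimeE[OF assms(2)] by metis
  obtain Q2 e2 T2 where T2: "polybound T2"
    "\<And>P R z. length P = n + length Q0 + length Q1 \<Longrightarrow>
       ev (P @ Q2 @ R) [enc z] e2 (enc (h' (fst z) (snd z))) (T2 z)"
    using polytimeE[OF assms(3)] by metis
  obtain q where q: "\<And>z. T2 z \<le> poly q (size_of z)" using T2(1) unfolding polybound_def by blast
  let ?k = "n + length Q0 + length Q1 + length Q2"
  let ?S = "\<lambda>x. poly q (1 + size_of x + size_of (f x))"
  let ?h = "\<lambda>x. 100 + 10 * T0 x + 10 * T1 x + 10 * ?S x + 10 * size_of x + 10 * size_of (f x)"
  let ?e = "If (Op1 IsPair e0) (Call ?k [Op2 Cons_Pair (Var 0) (Op1 Cdr e0)]) e1"
  have "ev (P @ (Q0 @ Q1 @ Q2 @ [e2]) @ R) [enc x] ?e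
      (enc (case f x of None \<Rightarrow> g x | Some y \<Rightarrow> h' x y)) (?h x)"
    if "length P = n" for P R x
  proof -
    let ?P = "P @ (Q0 @ Q1 @ Q2 @ [e2]) @ R"
    have ev0: "ev ?P [enc x] e0 (enc (f x)) (T0 x)"
      using T0(2)[of P "Q1 @ Q2 @ [e2] @ R" x] that by simp
    have ev1: "ev ?P [enc x] e1 (enc (g x)) (T1 x)"
      using T1(2)[of "P @ Q0" "Q2 @ [e2] @ R" x] that by simp
    have Pk: "?P ! ?k = e2" using that by (simp add: nth_append)
    show ?thesis
    proof (cases "f x")
      case None
      have ev0': "ev ?P [enc x] e0 (Num 0) (T0 x)" using ev0 None by simp
      show ?thesis
        using ev_mono[OF ev_If_false[OF ev_Op1[OF ev0', where f = IsPair, OF refl] _ ev1], of "?h x"]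
          None ev_bits[OF ev1] by (simp add: floorlog_def)
    next
      case (Some y)
      have ev0': "ev ?P [enc x] e0 (Pair (Num 1) (enc y)) (T0 x)" using ev0 Some by simp
      have "T2 (x, y) \<le> poly q (size_of (x, y))" by (rule q)
      also have "\<dots> \<le> ?S x"
        by (rule poly_nat_mono) (simp add: Some size_of_def)
      finally have ev2: "ev ?P [Pair (enc x) (enc y)] (?P ! ?k) (enc (h' x y)) (?S x)"
        using T2(2)[of "P @ Q0 @ Q1" "[e2] @ R" "(x, y)"] that ev_mono unfolding Pk by simp
      have "ev ?P [enc x] ?e (enc (h' x y)) (?h x)"
        apply (rule ev_mono)
         apply (rule ev_If_true)
           apply (rule ev_Op1[OF ev0' refl])
          apply simp
         apply (rule ev_Call)
           apply (rule evs_Cons[OF _ evs_Nil])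
           apply (rule ev_Op2)
             apply (rule ev_Vars)
            apply (rule ev_Op1[OF ev0' refl])
           apply simp
          using that apply simp
         apply simp
         using ev2 apply simp
        using ev_bits[OF ev2] Some
        apply (simp add: size_of_def)
        done
      then show ?thesis using Some by simp
    qed
  qed
  moreover have "polybound ?h"
    by (intro polybound_intros polytime_size assms T0 T1 T2)
  ultimately show ?case by meson
qed

section \<open>Loops over lists\<close>

text \<open>The environment consists of the parameter, the remaining list and the state. The step
  function at position \<open>s\<close> takes a single argument, so the three are packed into nested
  pairs; \<open>l\<close> is the position of the loop itself.\<close>

definition loop_body :: "nat \<Rightarrow> nat \<Rightarrow> expr" where
  "loop_body s l = If (Op1 IsPair (Var 1))
     (Call l [Var 0, Op1 Cdr (Var 1),
        Call s [Op2 Cons_Pair (Var 0) (Op2 Cons_Pair (Op1 Car (Var 1)) (Var 2))]])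
     (Var 2)"

text \<open>Both bounds are assumed along all prefixes of the list, so that they pass to the tail
  together with the state after one step. The numbers 10 and 100 are slack for the fixed number of
  evaluation steps in a round.\<close>

lemma ev_loop:
  assumes P: "s < length P" "l < length P" "P ! l = loop_body s l"
    and X: "bits xv \<le> X"
    and "\<And>k. k < length ys \<Longrightarrow>
      ev P [Pair xv (Pair (enc (ys ! k)) (enc (fold f (take k ys) a)))] (P ! s)
        (enc (f (ys ! k) (fold f (take k ys) a))) T"
    and "\<And>k. size_of (fold f (take k ys) a) \<le> B"
    and "size_of ys \<le> L"
  shows "ev P [xv, enc ys, enc a] (P ! l) (enc (fold f ys a))
    ((length ys + 1) * (100 + 10 * T + 10 * X + 10 * L + 10 * B))"
  using assms(5-7)
proof (induction ys arbitrary: a)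
  case Nil
  have B: "bits (enc a) \<le> B" using Nil(2)[of 0] by (simp add: size_of_def)
  show ?case unfolding P(3) loop_body_def
    apply (rule ev_mono)
     apply (rule ev_If_false)
       apply (rule ev_Op1)
        apply (rule ev_Vars)
       apply (rule refl)
      apply simp
     apply (rule ev_Var)
      apply simp
     apply simp
    using B apply (simp add: floorlog_def)
    done
next
  case (Cons y ys)
  let ?a = "f y a"
  let ?W = "100 + 10 * T + 10 * X + 10 * L + 10 * B"
  have tl: "ev P [xv, enc ys, enc ?a] (P ! l) (enc (fold f ys ?a)) ((length ys + 1) * ?W)"
  proof (rule Cons.IH)
    fix k assume "k < length ys"
    then show "ev P [Pair xv (Pair (enc (ys ! k)) (enc (fold f (take k ys) (f y a))))] (P ! s)
        (enc (f (ys ! k) (fold f (take k ys) (f y a)))) T"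
      using Cons.prems(1)[of "Suc k"] by simp
  next
    fix k
    show "size_of (fold f (take k ys) (f y a)) \<le> B"
      using Cons.prems(2)[of "Suc k"] by simp
  qed (use Cons.prems(3) in simp)
  have st: "ev P [Pair xv (Pair (enc y) (enc a))] (P ! s) (enc ?a) T"
    using Cons.prems(1)[of 0] by simp
  have B: "bits (enc a) \<le> B" "bits (enc (f y a)) \<le> B" "bits (enc (fold f ys (f y a))) \<le> B"
    using Cons.prems(2)[of 0] Cons.prems(2)[of 1] Cons.prems(2)[of "Suc (length ys)"]
    by (simp_all add: size_of_def)
  have L: "bits (enc y) + bits (enc ys) + 1 \<le> L" using Cons.prems(3) by (simp add: size_of_def)
  have "ev P [xv, enc (y # ys), enc a] (loop_body s l) (enc (fold f (y # ys) a))
    (?W + (length ys + 1) * ?W)"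
    unfolding loop_body_def
    apply (rule ev_mono)
     apply (rule ev_If_true)
       apply (rule ev_Op1)
        apply (rule ev_Vars)
       apply (rule refl)
      apply simp
     apply (rule ev_Call[OF _ P(2)])
      apply (rule evs_Cons)
       apply (rule ev_Vars)
      apply (rule evs_Cons)
       apply (rule ev_Op1)
        apply (rule ev_Vars)
       apply (rule refl)
      apply (rule evs_Cons[OF _ evs_Nil])
      apply (rule ev_Call[OF _ P(1)])
       apply (rule evs_Cons[OF _ evs_Nil])
       apply (rule ev_Op2)
         apply (rule ev_Vars)
        apply (rule ev_Op2)
          apply (rule ev_Op1)
           apply (rule ev_Vars)
          apply (rule refl)
         apply (rule ev_Vars)
        apply (rule refl)
       apply (rule refl)
      apply simp
      apply (rule st)
     apply simp
     apply (rule tl)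
    using B L X apply (simp add: floorlog_def del: mult_Suc)
    done
  then show ?case unfolding P(3) by (simp del: fold_simps)
qed

text \<open>
  The bound on the intermediate states is indispensable: squaring the state in every round would
  make its size double each time.
\<close>

lemma polytime_fold:
  fixes s :: "'x :: enc \<Rightarrow> 'y :: enc \<Rightarrow> 'a :: enc \<Rightarrow> 'a"
  assumes s: "polytime (\<lambda>z. s (fst z) (fst (snd z)) (snd (snd z)))"
    and l: "polytime l" and i: "polytime i"
    and B: "polybound B" "\<And>x k. size_of (fold (s x) (take k (l x)) (i x)) \<le> B x"
  shows "polytime (\<lambda>x. fold (s x) (l x) (i x))"
proof (rule polytimeI, goal_cases)
  case (1 n)
  obtain Q0 e0 T0 where T0: "polybound T0"
    "\<And>P R z. length P = n \<Longrightarrow>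
       ev (P @ Q0 @ R) [enc z] e0 (enc (s (fst z) (fst (snd z)) (snd (snd z)))) (T0 z)"
    using polytimeE[OF s] by metis
  \<comment> \<open>Layout of the code: whatever the step needs, then the step at \<open>?s\<close>,
    the loop at \<open>?l\<close>, and behind them the code for the list and the initial
    state.\<close>
  let ?s = "n + length Q0"
  let ?l = "n + length Q0 + 1"
  let ?b = "loop_body ?s ?l"
  obtain Q1 e1 T1 where T1: "polybound T1"
    "\<And>P R x. length P = n + length Q0 + 2 \<Longrightarrow> ev (P @ Q1 @ R) [enc x] e1 (enc (l x)) (T1 x)"
    using polytimeE[OF l] by metis
  obtain Q2 e2 T2 where T2: "polybound T2"
    "\<And>P R x. length P = n + length Q0 + 2 + length Q1 \<Longrightarrow>
       ev (P @ Q2 @ R) [enc x] e2 (enc (i x)) (T2 x)"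
    using polytimeE[OF i] by metis
  obtain q where q: "\<And>z. T0 z \<le> poly q (size_of z)" using T0(1) unfolding polybound_def by blast
  let ?T = "\<lambda>x. poly q (2 + size_of x + size_of (l x) + B x)"
  let ?W = "\<lambda>x. (size_of (l x) + 1) * (100 + 10 * ?T x + 10 * size_of x + 10 * size_of (l x) + 10 * B x)"
  let ?h = "\<lambda>x. 10 + B x + size_of x + T1 x + T2 x + ?W x"
  have "ev (P @ (Q0 @ [e0, ?b] @ Q1 @ Q2) @ R) [enc x] (Call ?l [Var 0, e1, e2])
      (enc (fold (s x) (l x) (i x))) (?h x)"
    if n: "length P = n" for P R x
  proof -
    let ?P = "P @ (Q0 @ [e0, ?b] @ Q1 @ Q2) @ R"
    have ev1: "ev ?P [enc x] e1 (enc (l x)) (T1 x)"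
      using T1(2)[of "P @ Q0 @ [e0, ?b]" "Q2 @ R" x] that by simp
    have ev2: "ev ?P [enc x] e2 (enc (i x)) (T2 x)"
      using T2(2)[of "P @ Q0 @ [e0, ?b] @ Q1" R x] that by simp
    have Ps: "?P ! ?s = e0" "?P ! ?l = ?b"
      using n by (simp_all add: nth_append)
    have loop: "ev ?P [enc x, enc (l x), enc (i x)] (?P ! ?l) (enc (fold (s x) (l x) (i x)))
      ((length (l x) + 1) * (100 + 10 * ?T x + 10 * size_of x + 10 * size_of (l x) + 10 * B x))"
    proof (rule ev_loop)
      fix k assume k: "k < length (l x)"
      let ?y = "l x ! k" and ?a = "fold (s x) (take k (l x)) (i x)"
      have "T0 (x, ?y, ?a) \<le> poly q (size_of (x, ?y, ?a))" by (rule q)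
      also have "\<dots> \<le> ?T x"
        by (rule poly_nat_mono) (use size_of_mem_le[of ?y "l x"] k B(2)[where k=k and x=x] in simp)
      finally show "ev ?P [Pair (enc x) (Pair (enc ?y) (enc ?a))] (?P ! ?s) (enc (s x ?y ?a)) (?T x)"
        using T0(2)[of P "[e0, ?b] @ Q1 @ Q2 @ R" "(x, ?y, ?a)"] n ev_mono unfolding Ps by simp
    qed (use B(2) n Ps in \<open>simp_all add: size_of_def\<close>)
    have len: "(length (l x) + 1) * (100 + 10 * ?T x + 10 * size_of x + 10 * size_of (l x) + 10 * B x)
        \<le> ?W x"
      using length_le_size[of "l x"] by (intro mult_right_mono) auto
    note loop' = ev_mono[OF loop len]
    have res: "bits (enc (fold (s x) (l x) (i x))) \<le> B x"
      using B(2)[where k="length (l x)" and x=x] by (simp add: size_of_def)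
    show ?thesis
      apply (rule ev_mono)
       apply (rule ev_Call)
         apply (rule evs_Cons)
          apply (rule ev_Vars)
         apply (rule evs_Cons)
          apply (rule ev1)
         apply (rule evs_Cons[OF _ evs_Nil])
         apply (rule ev2)
        using n apply simp
       apply (rule loop')
      using res apply (simp add: size_of_def)
      done
  qed
  moreover have "polybound ?h"
    by (intro polybound_intros polytime_size assms T0 T1 T2)
  ultimately show ?case by meson
qed

text \<open>The growth \<open>B (x, y)\<close> does not depend on the state, so a whole fold adds at
  most one such term per list element. Most of the folds below are of this kind.\<close>

lemma polytime_fold_additive:
  fixes s :: "'x :: enc \<Rightarrow> 'y :: enc \<Rightarrow> 'a :: enc \<Rightarrow> 'a"
  assumes s: "polytime (\<lambda>z. s (fst z) (fst (snd z)) (snd (snd z)))"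
    and l: "polytime l" and i: "polytime i"
    and B: "polybound B" "\<And>x y a. size_of (s x y a) \<le> size_of a + B (x, y)"
  shows "polytime (\<lambda>x. fold (s x) (l x) (i x))"
proof -
  obtain q where q: "\<And>z. B z \<le> poly q (size_of z)" using B(1) unfolding polybound_def by blast
  let ?b = "\<lambda>x. poly q (1 + size_of x + size_of (l x))"
  show ?thesis
  proof (rule polytime_fold[OF s l i])
  show "polybound (\<lambda>x. size_of (i x) + size_of (l x) * ?b x)"
    by (intro polybound_intros polytime_size l i)
  fix x k
  have "size_of (fold (s x) ys a) \<le> size_of a + length ys * ?b x" if "set ys \<subseteq> set (l x)" for ys a
    using that
  proof (induction ys arbitrary: a)
    case (Cons y ys)
    have "B (x, y) \<le> poly q (size_of (x, y))" by (rule q)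
    also have "\<dots> \<le> ?b x"
      by (rule poly_nat_mono) (use size_of_mem_le[of y "l x"] Cons.prems in simp)
    finally show ?case using Cons.IH[of "s x y a"] Cons.prems B(2)[of x y a] by simp
  qed simp
  from this[of "take k (l x)" "i x"]
  have "size_of (fold (s x) (take k (l x)) (i x))
      \<le> size_of (i x) + length (take k (l x)) * ?b x"
    by (meson set_take_subset)
  also have "\<dots> \<le> size_of (i x) + size_of (l x) * ?b x"
    using length_le_size[of "l x"] by (intro add_mono mult_right_mono) auto
  finally show "size_of (fold (s x) (take k (l x)) (i x)) \<le> size_of (i x) + size_of (l x) * ?b x" .
  qed
qed

text \<open>A clock: loops run along lists, so a number of iterations proportional to a bit length
  needs a list of that length.\<close>

definition bitlist :: "int \<Rightarrow> nat list" where
  "bitlist k = replicate (floorlog 2 (nat k)) 0"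

lemma bitlist_rec: "bitlist k = (if 0 < k then 0 # bitlist (k div 2) else [])"
  by (simp add: bitlist_def compute_floorlog[of 2 "nat k"] nat_div_distrib)

text \<open>Besides the loop this is the only direct recursion: the body \<open>?b\<close> sits at
  position \<open>n\<close>, calls itself on half of its argument and conses one entry per
  bit.\<close>

lemma polytime_bitlist: "polytime bitlist"
proof (rule polytimeI, goal_cases)
  case (1 n)
  let ?b = "If (Op2 Less (Const (Num 0)) (Var 0))
     (Op2 Cons_Pair (Const (Num 0)) (Call n [Op2 Div (Var 0) (Const (Num 2))])) (Const (Num 0))"
  let ?h = "\<lambda>m. (m + 1) * (100 + 30 * m)"
  have "ev (P @ [?b] @ R) [enc k] ?b (enc (bitlist k)) (?h (size_of k))"
    if n: "length P = n" for P R k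
  proof -
    have Pn: "(P @ [?b] @ R) ! n = ?b" using n by (simp add: nth_append)
    have fl: "floorlog 2 (nat k) \<le> size_of k" if "0 \<le> k" for k
      using that by (simp add: size_of_def)
    have "ev (P @ [?b] @ R) [enc k] ?b (enc (bitlist k))
       ((floorlog 2 (nat k) + 1) * (100 + 30 * m))" if "size_of k \<le> m" for k m
      using that
    proof (induction "nat k" arbitrary: k rule: less_induct)
      case less
      show ?case
      proof (cases "0 < k")
        case False
        have [simp]: "bitlist k = []" using False by (subst bitlist_rec) simp
        show ?thesis
          apply (rule ev_mono)
           apply (rule ev_If_false)
             apply (rule ev_Op2)
               apply (rule ev_Const)
              apply (rule ev_Vars)
             apply (rule refl)
            using False apply simp
           apply simp
           apply (rule ev_Const)
          using False less.prems apply (simp add: size_of_def)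
          done
      next
        case True
        have [simp]: "bitlist k = 0 # bitlist (k div 2)" using True by (subst bitlist_rec) simp
        have fk: "floorlog 2 (nat k) = floorlog 2 (nat (k div 2)) + 1"
          using True by (simp add: compute_floorlog[of 2 "nat k"] nat_div_distrib)
        have sz: "size_of (k div 2) \<le> m"
          using bits_div[of k 2] less.prems by (simp add: size_of_def)
        have IH: "ev (P @ [?b] @ R) [Num (k div 2)] ?b (enc (bitlist (k div 2)))
           ((floorlog 2 (nat (k div 2)) + 1) * (100 + 30 * m))"
          using less.hyps[of "k div 2"] sz True by simp
        have IH': "ev (P @ ?b # R) [Num (k div 2)] ((P @ ?b # R) ! n) (enc (bitlist (k div 2)))
           ((floorlog 2 (nat (k div 2)) + 1) * (100 + 30 * m))"
          using IH Pn by simp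
        have sb: "bits (enc (bitlist (k div 2))) \<le> 2 + 3 * m"
          using fl[of "k div 2"] sz True
          by (simp add: bitlist_def size_of_list size_of_def[symmetric] sum_list_replicate)
             (simp add: size_of_def)
        have "ev (P @ [?b] @ R) [enc k] ?b (enc (bitlist k))
           ((100 + 30 * m) + (floorlog 2 (nat (k div 2)) + 1) * (100 + 30 * m))"
          apply (rule ev_mono)
           apply (rule ev_If_true)
             apply (rule ev_Op2)
               apply (rule ev_Const)
              apply (rule ev_Vars)
             apply (rule refl)
            using True apply simp
           apply simp
           apply (rule ev_Op2)
             apply (rule ev_Const)
            apply (rule ev_Call)
              apply (rule evs_Cons[OF _ evs_Nil])
              apply (rule ev_Op2)
                apply (rule ev_Vars)
               apply (rule ev_Const)
              apply (rule refl)
             using n apply simp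
            apply simp
            apply (rule IH')
           apply simp
          using True less.prems sz sb apply (simp add: size_of_def compute_floorlog[of 2 2] del: mult_Suc)
          done
        then show ?thesis unfolding fk by (elim ev_mono) (simp add: add_mult_distrib)
      qed
    qed
    from this[OF le_refl] have "ev (P @ [?b] @ R) [enc k] ?b (enc (bitlist k))
       ((floorlog 2 (nat k) + 1) * (100 + 30 * size_of k))" .
    moreover have "floorlog 2 (nat k) + 1 \<le> size_of k + 1"
      using fl[of k] by (cases "0 \<le> k") auto
    ultimately show ?thesis by (elim ev_mono mult_right_mono) auto
  qed
  moreover have "polybound (\<lambda>k. ?h (size_of k))" by (intro polybound_intros)
  ultimately show ?case
    by (intro exI[of _ "[?b]"] exI[of _ ?b] exI[of _ "\<lambda>k. ?h (size_of k)"]) auto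
qed

section \<open>Boolean and list functions\<close>

lemma polytime_conj:
  "polytime b \<Longrightarrow> polytime c \<Longrightarrow> polytime (\<lambda>x. b x \<and> c x)"
  using polytime_If[OF _ _ polytime_const, of b c False] by (simp add: if_bool_eq_conj conj_commute cong: conj_cong)

lemma polytime_not: "polytime b \<Longrightarrow> polytime (\<lambda>x. \<not> b x)"
  using polytime_If[OF _ polytime_const polytime_const, of b False True]
  by (simp add: if_bool_eq_conj)

lemma polytime_imp:
  "polytime b \<Longrightarrow> polytime c \<Longrightarrow> polytime (\<lambda>x. b x \<longrightarrow> c x)"
  using polytime_If[OF _ _ polytime_const, of b c True] by (simp add: if_bool_eq_conj)

lemma polytime_int_le: "polytime f \<Longrightarrow> polytime g \<Longrightarrow> polytime (\<lambda>x. f x \<le> (g x :: int))"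
  using polytime_not[OF polytime_int_less, of g f] by (simp add: not_less)

lemma polytime_nat_eq: "polytime f \<Longrightarrow> polytime g \<Longrightarrow> polytime (\<lambda>x. f x = (g x :: nat))"
  using polytime_conj[OF polytime_not[OF polytime_nat_less] polytime_not[OF polytime_nat_less],
      of f g g f] by (simp add: not_less eq_iff conj_commute)

lemma polytime_int_min:
  "polytime f \<Longrightarrow> polytime g \<Longrightarrow> polytime (\<lambda>x. min (f x) (g x :: int))"
  unfolding min_def by (intro polytime_If polytime_int_le)

lemmas polytime_intros =
  polytime_const polytime_id polytime_fst polytime_snd polytime_Pair polytime_Cons polytime_If
  polytime_int_add polytime_int_diff polytime_int_mult polytime_int_div polytime_int_less
  polytime_nat_less polytime_Suc polytime_int_of_nat polytime_conj polytime_imp polytime_not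
  polytime_int_le polytime_nat_eq polytime_int_min

lemma polytime_comp2:
  "polytime (\<lambda>z. g (fst z) (snd z)) \<Longrightarrow> polytime a \<Longrightarrow> polytime b \<Longrightarrow>
    polytime (\<lambda>x. g (a x) (b x))"
  using polytime_comp[of "\<lambda>z. g (fst z) (snd z)" "\<lambda>x. (a x, b x)"]
  by (simp add: polytime_Pair)

lemma polytime_comp3:
  "polytime (\<lambda>z. g (fst z) (fst (snd z)) (snd (snd z))) \<Longrightarrow> polytime a \<Longrightarrow> polytime b \<Longrightarrow>
    polytime c \<Longrightarrow> polytime (\<lambda>x. g (a x) (b x) (c x))"
  using polytime_comp[of "\<lambda>z. g (fst z) (fst (snd z)) (snd (snd z))" "\<lambda>x. (a x, b x, c x)"]
  by (simp add: polytime_Pair)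

lemma polybound_size_snd: "polybound (\<lambda>z. size_of (snd z))"
  by (intro polytime_size polytime_intros)

lemma polytime_rev: "polytime l \<Longrightarrow> polytime (\<lambda>x. rev (l x))"
  unfolding rev_conv_fold
  by (rule polytime_fold_additive[where B = "\<lambda>z. 1 + size_of (snd z)"])
     (auto intro!: polytime_intros polybound_intros polybound_size_snd)

lemma append_eq_fold: "xs @ ys = fold Cons (rev xs) ys"
  by (induction xs) auto

lemma polytime_append: "polytime l \<Longrightarrow> polytime m \<Longrightarrow> polytime (\<lambda>x. l x @ m x)"
  unfolding append_eq_fold
  by (rule polytime_fold_additive[where B = "\<lambda>z. 1 + size_of (snd z)"])
     (auto intro!: polytime_intros polytime_rev polybound_intros polybound_size_snd)

lemma fold_Cons_map: "fold (\<lambda>y a. f y # a) xs a = rev (map f xs) @ a"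
  by (induction xs arbitrary: a) auto

lemma polytime_map:
  assumes f: "polytime (\<lambda>z. f (fst z) (snd z))" and l: "polytime l"
  shows "polytime (\<lambda>x. map (f x) (l x))"
proof -
  have "polytime (\<lambda>x. fold (\<lambda>y a. f x y # a) (l x) [])"
    by (rule polytime_fold_additive[where B = "\<lambda>z. 1 + size_of (f (fst z) (snd z))"])
       (auto intro!: polytime_intros l polybound_intros polytime_size f polytime_comp2[OF f])
  from polytime_rev[OF this] show ?thesis by (simp add: fold_Cons_map)
qed

lemma fold_Cons_filter: "fold (\<lambda>y a. if P y then y # a else a) xs a = rev (filter P xs) @ a"
  by (induction xs arbitrary: a) auto

lemma polytime_filter:
  assumes f: "polytime (\<lambda>z. P (fst z) (snd z))" and l: "polytime l"
  shows "polytime (\<lambda>x. filter (P x) (l x))"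
proof -
  have "polytime (\<lambda>x. fold (\<lambda>y a. if P x y then y # a else a) (l x) [])"
    by (rule polytime_fold_additive[where B = "\<lambda>z. 1 + size_of (snd z)"])
       (auto intro!: polytime_intros l polybound_intros polytime_size polytime_comp2[OF f])
  from polytime_rev[OF this] show ?thesis by (simp add: fold_Cons_filter)
qed

lemma fold_rev_append: "fold (\<lambda>y a. rev y @ a) xs a = rev (concat xs) @ a"
  by (induction xs arbitrary: a) auto

lemma size_of_rev [simp]: "size_of (rev xs) = size_of xs"
  by (simp add: size_of_list rev_map[symmetric])

lemma polytime_concat: "polytime l \<Longrightarrow> polytime (\<lambda>x. concat (l x))"
proof -
  assume l: "polytime l"
  have le: "size_of (rev y @ a) \<le> size_of a + size_of y" for y a :: "'b list"
    using size_of_append[of "rev y" a] by simp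
  have "polytime (\<lambda>x. fold (\<lambda>y a. rev y @ a) (l x) [])"
    by (rule polytime_fold_additive[where B = "\<lambda>z. size_of (snd z)"])
       (auto intro!: polytime_intros polytime_append polytime_rev l polybound_size_snd le)
  from polytime_rev[OF this] show ?thesis by (simp add: fold_rev_append)
qed

lemma fold_Suc_length: "fold (\<lambda>_. Suc) xs n = length xs + n"
  by (induction xs arbitrary: n) auto

lemma size_of_Suc_le: "size_of (Suc n) \<le> Suc (Suc (size_of n))"
  using bits_add[of "int n" 1] by (simp add: size_of_def nat_add_distrib)

lemma polytime_length: "polytime l \<Longrightarrow> polytime (\<lambda>x. length (l x))"
proof -
  assume l: "polytime l"
  have "polytime (\<lambda>x. fold (\<lambda>_. Suc) (l x) 0)"
    by (rule polytime_fold_additive[where B = "\<lambda>z. 2"])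
       (auto intro!: polytime_intros l polybound_intros size_of_Suc_le)
  then show ?thesis by (simp add: fold_Suc_length)
qed

lemma polytime_sum_list: "polytime l \<Longrightarrow> polytime (\<lambda>x. sum_list (l x) :: int)"
proof -
  assume l: "polytime l"
  have le: "size_of (y + a) \<le> size_of a + size_of y" for y a :: int
    using bits_add[of y a] by (simp add: size_of_def)
  have "polytime (\<lambda>x. fold (\<lambda>y a. y + a) (l x) 0)"
    by (rule polytime_fold_additive[where B = "\<lambda>z. size_of (snd z)"])
       (auto intro!: polytime_intros l polybound_size_snd le)
  then show ?thesis by (simp add: fold_plus_sum_list_rev)
qed

lemma fold_times_prod_list: "fold (\<lambda>y a. y * a) xs a = prod_list xs * (a :: int)"
  by (induction xs arbitrary: a) auto

lemma polytime_prod_list: "polytime l \<Longrightarrow> polytime (\<lambda>x. prod_list (l x) :: int)"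
proof -
  assume l: "polytime l"
  have le: "size_of (y * a) \<le> size_of a + size_of y" for y a :: int
    using bits_mult[of y a] by (simp add: size_of_def)
  have "polytime (\<lambda>x. fold (\<lambda>y a. y * a) (l x) 1)"
    by (rule polytime_fold_additive[where B = "\<lambda>z. size_of (snd z)"])
       (auto intro!: polytime_intros l polybound_size_snd le)
  then show ?thesis by (simp add: fold_times_prod_list)
qed

lemma fold_member: "fold (\<lambda>y a. if y = v then True else a) xs b \<longleftrightarrow> v \<in> set xs \<or> b"
  by (induction xs arbitrary: b) auto

lemma polytime_member:
  fixes v :: "'x :: enc \<Rightarrow> nat"
  assumes v: "polytime v" and l: "polytime l"
  shows "polytime (\<lambda>x. v x \<in> set (l x))"
proof -
  have "polytime (\<lambda>x. fold (\<lambda>y a. if y = v x then True else a) (l x) False)"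
    by (rule polytime_fold_additive[where B = "\<lambda>z. 1"])
       (auto intro!: polytime_intros l polybound_intros polytime_comp[OF v])
  then show ?thesis by (simp add: fold_member)
qed

text \<open>The counter keeps falling after it has hit 0, so the entry that was picked is never
  overwritten. The induction passes through this situation, hence the integer counter and the case
  of negative \<open>k\<close>.\<close>

lemma fold_nth:
  "snd (fold (\<lambda>y (k, r). (k - 1, if k = 0 then y else r)) xs (k :: int, d))
    = (if 0 \<le> k \<and> k < int (length xs) then xs ! nat k else d)"
proof (induction xs arbitrary: k d)
  case (Cons y xs)
  show ?case
  proof (cases "k = 0")
    case True
    then show ?thesis using Cons[of "-1" y] by simp
  next
    case False
    then show ?thesis using Cons[of "k - 1" d] by (auto simp: nth_Cons' nat_diff_distrib)
  qed
qed auto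

lemma polytime_int_eq0: "polytime f \<Longrightarrow> polytime (\<lambda>x. f x = (0 :: int))"
  using polytime_conj[OF polytime_int_le[OF _ polytime_const] polytime_int_le[OF polytime_const],
      of f f 0 0] by (simp add: eq_iff)

lemma polytime_nth_default:
  assumes d: "polytime d" and l: "polytime l" and k: "polytime k"
  shows "polytime (\<lambda>x. nth_default (d x) (l x) (k x))"
proof -
  let ?s = "\<lambda>y (z :: int \<times> 'b). (fst z - 1, if fst z = 0 then y else snd z)"
  have sz: "size_of (j - 1) \<le> size_of j + 2" for j :: int
    using bits_minus[of j 1] by (simp add: size_of_def)
  have "size_of (?s y a) \<le> size_of a + (2 + size_of y)" for y a
    using sz[of "fst a"] by (cases a) auto
  then have "polytime (\<lambda>x. fold ?s (l x) (int (k x), d x))"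
    by (intro polytime_fold_additive[where B = "\<lambda>z. 2 + size_of (snd z)"])
       (auto intro!: polytime_intros polytime_int_eq0 assms polybound_intros polybound_size_snd)
  moreover have "snd (fold ?s (l x) (int (k x), d x)) = nth_default (d x) (l x) (k x)" for x
    using fold_nth[of "l x" "int (k x)" "d x"] by (simp add: nth_default_def case_prod_beta')
  ultimately show ?thesis using polytime_snd[of "\<lambda>x. fold ?s (l x) (int (k x), d x)"] by simp
qed

lemma fold_upt: "fold (\<lambda>_ a. a @ [length a]) xs [0..<n] = [0..<n + length xs]"
proof (induction xs arbitrary: n)
  case (Cons x xs)
  then show ?case using Cons[of "Suc n"] by simp
qed simp

text \<open>The bound is the length of a list and not a number: \<open>[0..<n]\<close> is
  exponentially large in the size of a binary \<open>n\<close>.\<close>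

lemma polytime_upt: "polytime l \<Longrightarrow> polytime (\<lambda>x. [0..<length (l x)])"
proof -
  assume l: "polytime l"
  let ?B = "\<lambda>x. 2 + size_of (l x) * (size_of (l x) + 3)"
  have "polytime (\<lambda>x. fold (\<lambda>_ a. a @ [length a]) (l x) [])"
  proof (rule polytime_fold)
    fix x k
    define n where "n = min (length (l x)) k"
    have n: "n \<le> length (l x)" by (simp add: n_def)
    have "size_of [0..<n] \<le> 2 + length [0..<n] * (size_of (l x) + 2 + 1)"
    proof (rule size_of_list_bound)
      fix i assume "i \<in> set [0..<n]"
      then show "size_of i \<le> size_of (l x) + 2"
        using n size_of_nat_le[of i] length_le_size[of "l x"] by auto
    qed
    also have "\<dots> \<le> ?B x"
      using n length_le_size[of "l x"] mult_right_mono[of n "size_of (l x)" "size_of (l x) + 3"]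
      by (simp add: algebra_simps)
    finally show "size_of (fold (\<lambda>_ a. a @ [length a]) (take k (l x)) []) \<le> ?B x"
      using fold_upt[of "take k (l x)" 0] by (simp add: n_def)
  qed (auto intro!: polytime_intros polytime_append polytime_length l polybound_intros
      polytime_size)
  moreover have "fold (\<lambda>_ a. a @ [length a]) (l x) [] = [0..<length (l x)]" for x
    using fold_upt[of "l x" 0] by simp
  ultimately show ?thesis by simp
qed

lemma fold_double:
  "fold (\<lambda>_ a. 2 * a) xs (2 ^ n) = (2 ^ (n + length xs) :: int)"
proof (induction xs arbitrary: n)
  case (Cons x xs)
  then show ?case using Cons[of "Suc n"] by simp
qed simp

lemma floorlog_power2: "floorlog 2 (2 ^ n) = n + 1"
proof (induction n)
  case (Suc n)
  then show ?case using compute_floorlog[of 2 "2 ^ Suc n"] by simp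
qed simp

text \<open>The exponent is given in unary, as the length of a list, for the same reason: the power
  has as many bits.\<close>

lemma polytime_power2: "polytime l \<Longrightarrow> polytime (\<lambda>x. 2 ^ length (l x) :: int)"
proof -
  assume l: "polytime l"
  have "polytime (\<lambda>x. fold (\<lambda>_ a. 2 * a) (l x) (1 :: int))"
  proof (rule polytime_fold)
    fix x k
    have "size_of (2 ^ length (take k (l x)) :: int) = 3 + length (take k (l x))"
      by (simp add: size_of_def nat_power_eq floorlog_power2)
    also have "\<dots> \<le> 3 + size_of (l x)" using length_le_size[of "l x"] by simp
    finally show "size_of (fold (\<lambda>_ a. 2 * a) (take k (l x)) (1 :: int)) \<le> 3 + size_of (l x)"
      using fold_double[of "take k (l x)" 0] by simp
  qed (auto intro!: polytime_intros l polybound_intros polytime_size)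
  moreover have "fold (\<lambda>_ a. 2 * a) (l x) (1 :: int) = 2 ^ length (l x)" for x
    using fold_double[of "l x" 0] by simp
  ultimately show ?thesis by simp
qed

lemma fold_take:
  "length a \<le> n \<Longrightarrow>
    fold (\<lambda>y a. if length a < n then a @ [y] else a) xs a = a @ take (n - length a) xs"
proof (induction xs arbitrary: a)
  case (Cons x xs)
  then show ?case by (cases "n - length a") (auto simp: Suc_diff_le diff_Suc)
qed simp

lemma polytime_take:
  assumes n: "polytime n" and l: "polytime l"
  shows "polytime (\<lambda>x. take (n x) (l x))"
proof -
  have le: "size_of (a @ [y]) \<le> Suc (size_of a + size_of y)" for y and a :: "'b list"
    using size_of_append[of a "[y]"] by simp
  have "polytime (\<lambda>x. fold (\<lambda>y a. if length a < n x then a @ [y] else a) (l x) [])"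
    by (rule polytime_fold_additive[where B = "\<lambda>z. 1 + size_of (snd z)"])
       (auto intro!: polytime_intros polytime_append polytime_length l polybound_intros
        polybound_size_snd polytime_comp[OF n] le)
  then show ?thesis by (simp add: fold_take)
qed

lemmas polytime_list_intros =
  polytime_intros polytime_rev polytime_append polytime_map polytime_filter polytime_concat
  polytime_length polytime_sum_list polytime_prod_list polytime_member polytime_nth_default
  polytime_upt polytime_power2 polytime_take

section \<open>Local search for K-median with penalties\<close>

definition conn :: "('j \<Rightarrow> real) \<Rightarrow> ('j \<Rightarrow> 'w \<Rightarrow> real) \<Rightarrow> 'w set \<Rightarrow> 'j \<Rightarrow> real" where
  "conn pen c X j = Min (insert (pen j) (c j ` X))"

lemma conn_le_pen: "finite X \<Longrightarrow> conn pen c X j \<le> pen j"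
  by (simp add: conn_def)

lemma conn_le: "finite X \<Longrightarrow> w \<in> X \<Longrightarrow> conn pen c X j \<le> c j w"
  by (simp add: conn_def)

lemma conn_antimono: "finite Y \<Longrightarrow> X \<subseteq> Y \<Longrightarrow> conn pen c Y j \<le> conn pen c X j"
  unfolding conn_def by (intro Min_antimono) auto

lemma conn_cases:
  assumes "finite X"
  shows "conn pen c X j = pen j \<or> (\<exists>w\<in>X. conn pen c X j = c j w)"
  using Min_in[of "insert (pen j) (c j ` X)"] assms by (auto simp: conn_def)

lemma conn_nonneg:
  "finite X \<Longrightarrow> 0 \<le> pen j \<Longrightarrow> (\<And>w. w \<in> X \<Longrightarrow> 0 \<le> c j w) \<Longrightarrow> 0 \<le> conn pen c X j"
  by (auto simp: conn_def)

lemma disjoint_subsets_exist: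
  assumes "finite R" "finite Z" "(\<Sum>r\<in>R. k r) \<le> card Z"
  shows "\<exists>D. (\<forall>r\<in>R. D r \<subseteq> Z \<and> card (D r) = k r) \<and> (\<forall>r\<in>R. \<forall>s\<in>R. r \<noteq> s \<longrightarrow> D r \<inter> D s = {})"
  using assms
proof (induction R arbitrary: Z rule: finite_induct)
  case (insert r R)
  then have "k r \<le> card Z" by simp
  then obtain D0 where D0: "D0 \<subseteq> Z" "card D0 = k r" by (meson obtain_subset_with_card_n)
  then have "card (Z - D0) = card Z - k r"
    using insert.prems(1) by (simp add: card_Diff_subset finite_subset)
  moreover have "k r + sum k R \<le> card Z" using insert by simp
  ultimately have "sum k R \<le> card (Z - D0)" by linarith
  then obtain D where D: "\<forall>s\<in>R. D s \<subseteq> Z - D0 \<and> card (D s) = k s"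
    "\<forall>s\<in>R. \<forall>t\<in>R. s \<noteq> t \<longrightarrow> D s \<inter> D t = {}"
    using insert.IH[of "Z - D0"] insert.prems(1) by auto
  then show ?case using D0 insert.hyps
    by (intro exI[of _ "D(r := D0)"]) (auto 0 3)
qed auto

text \<open>
  The analysis of \<open>p\<close>-swap local search by Arya et al. Every optimal center \<open>x\<close> is sent to the
  closest local center \<open>\<eta> x\<close>; the fibre of \<open>r\<close> together with \<open>r\<close> and suitable local centers
  outside the range of \<open>\<eta>\<close> forms a star. A star with at most \<open>p\<close> optimal centers is swapped as a
  whole; in a larger star every local center except \<open>r\<close> is swapped against every optimal
  one, and the resulting inequalities are averaged.
\<close>

lemma local_search_gap:
  fixes c :: "'j \<Rightarrow> 'w \<Rightarrow> real" and d :: "'w \<Rightarrow> 'w \<Rightarrow> real"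
    and g :: real
  assumes fin: "finite J" "finite S" "finite Z"
    and card: "card S = card Z" "S \<noteq> {}"
    and tri1: "\<And>j s x. j \<in> J \<Longrightarrow> s \<in> S \<Longrightarrow> x \<in> Z \<Longrightarrow> c j s \<le> c j x + d x s"
    and tri2: "\<And>j s x. j \<in> J \<Longrightarrow> s \<in> S \<Longrightarrow> x \<in> Z \<Longrightarrow> d x s \<le> c j x + c j s"
    and \<tau>: "\<And>j. j \<in> J \<Longrightarrow> \<tau> j \<in> Z"
    and c0: "\<And>j w. j \<in> J \<Longrightarrow> w \<in> S \<union> Z \<Longrightarrow> 0 \<le> c j w"
    and pen0: "\<And>j. j \<in> J \<Longrightarrow> 0 \<le> pen j"
    and T: "T \<subseteq> J" and p: "0 < p" and g0: "0 \<le> g"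
    and g: "\<And>P Q. P \<subseteq> S \<Longrightarrow> Q \<subseteq> Z \<Longrightarrow> card P = card Q \<Longrightarrow> card Q \<le> p \<Longrightarrow>
      sum (conn pen c S) J - sum (conn pen c ((S - P) \<union> Q)) J \<le> g"
  shows "sum (conn pen c S) J
    \<le> (3 + 2 / real p) * (\<Sum>j\<in>J - T. c j (\<tau> j)) + (1 + 1 / real p) * sum pen T + real (card S) * g"
proof -
  define A where "A = conn pen c S"
  have "\<exists>\<sigma>. \<sigma> \<in> S \<and> c j \<sigma> = Min (c j ` S)" for j
    using Min_in[of "c j ` S"] fin card(2) by (metis finite_imageI image_is_empty imageE)
  then obtain \<sigma> where \<sigma>: "\<And>j. \<sigma> j \<in> S" "\<And>j. c j (\<sigma> j) = Min (c j ` S)" by metis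
  have \<sigma>_le: "c j (\<sigma> j) \<le> c j s" if "s \<in> S" for j s
    using that \<sigma>(2) fin by simp
  have A_eq: "A j = min (pen j) (c j (\<sigma> j))" for j
    using \<sigma>(2) fin card by (simp add: A_def conn_def)
  have "\<exists>s. s \<in> S \<and> d x s = Min (d x ` S)" for x
    using Min_in[of "d x ` S"] fin card(2) by (metis finite_imageI image_is_empty imageE)
  then obtain \<eta> where \<eta>: "\<And>x. \<eta> x \<in> S" "\<And>x. d x (\<eta> x) = Min (d x ` S)" by metis
  have \<eta>_le: "d x (\<eta> x) \<le> d x s" if "s \<in> S" for x s
    using that \<eta>(2) fin by simp
  \<comment> \<open>\<open>X j\<close> is charged when the optimal center \<open>\<tau> j\<close>
    comes in, \<open>Y j\<close> when the local center \<open>\<sigma> j\<close> goes out. A client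
    of \<open>T\<close> falls back on its penalty; any other one moves to \<open>\<tau> j\<close> if
    that is open, or else is rerouted for at most \<open>2 * c j (\<tau> j)\<close> more.\<close>
  define X where "X j = (if j \<in> T then 0 else c j (\<tau> j) - A j)" for j
  define Y where "Y j = (if j \<in> T then pen j - A j else 2 * c j (\<tau> j))" for j
  have A_pen: "A j \<le> pen j" for j by (simp add: A_eq)
  have A0: "0 \<le> A j" if "j \<in> J" for j
    using that pen0 c0 \<sigma>(1) by (simp add: A_eq)
  have Y0: "0 \<le> Y j" if "j \<in> J" for j
    using that A_pen c0 \<tau> by (auto simp: Y_def)
  \<comment> \<open>By \<open>closed\<close>, an optimal center that does not come in keeps its
    nearest local center open. This is where displaced clients are sent.\<close>
  have swap: "- g \<le> (\<Sum>j\<in>J. X j * of_bool (\<tau> j \<in> Q) + Y j * of_bool (\<sigma> j \<in> P))"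
    if P: "P \<subseteq> S" and Q: "Q \<subseteq> Z" and card_PQ: "card P = card Q" "card Q \<le> p"
      and closed: "\<And>x. x \<in> Z \<Longrightarrow> x \<notin> Q \<Longrightarrow> \<eta> x \<notin> P" for P Q
  proof -
    let ?N = "(S - P) \<union> Q"
    have finN: "finite ?N" using fin Q finite_subset by blast
    have "conn pen c ?N j - A j \<le> X j * of_bool (\<tau> j \<in> Q) + Y j * of_bool (\<sigma> j \<in> P)"
      if j: "j \<in> J" for j
    proof -
      have keep: "conn pen c ?N j \<le> A j" if "\<sigma> j \<notin> P"
        using that conn_le_pen[OF finN, of pen c j] conn_le[OF finN, of "\<sigma> j" pen c j] \<sigma>(1)
        by (simp add: A_eq)
      have pen: "conn pen c ?N j \<le> pen j" by (rule conn_le_pen[OF finN])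
      consider "j \<in> T" | "j \<notin> T" "\<tau> j \<in> Q" | "j \<notin> T" "\<tau> j \<notin> Q" by blast
      then show ?thesis
      proof cases
        case 1
        then show ?thesis using keep pen by (auto simp: X_def Y_def)
      next
        case 2
        have "conn pen c ?N j \<le> c j (\<tau> j)" using 2 by (intro conn_le[OF finN]) simp
        then show ?thesis using 2 Y0[OF j] by (auto simp: X_def)
      next
        case 3
        show ?thesis
        proof (cases "\<sigma> j \<in> P")
          case True
          have "conn pen c ?N j \<le> c j (\<eta> (\<tau> j))"
            using closed[of "\<tau> j"] \<tau>[OF j] 3 \<eta>(1) by (intro conn_le[OF finN]) simp
          also have "\<dots> \<le> c j (\<tau> j) + d (\<tau> j) (\<sigma> j)"
            using tri1[OF j \<eta>(1) \<tau>[OF j], of "\<tau> j"] \<eta>_le[OF \<sigma>(1)] by (meson add_left_mono order_trans)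
          also have "\<dots> \<le> 2 * c j (\<tau> j) + c j (\<sigma> j)"
            using tri2[OF j \<sigma>(1) \<tau>[OF j], of j] by simp
          \<comment> \<open>If \<open>A j\<close> is the penalty and not
            \<open>c j (\<sigma> j)\<close>, the difference is not even positive, because the
            penalty can still be paid.\<close>
          finally have "conn pen c ?N j - A j \<le> 2 * c j (\<tau> j)"
            using pen c0[OF j, of "\<tau> j"] \<tau>[OF j] by (auto simp: A_eq min_def)
          then show ?thesis using 3 True by (simp add: Y_def)
        qed (use keep 3 in auto)
      qed
    qed
    then have "(\<Sum>j\<in>J. conn pen c ?N j - A j)
        \<le> (\<Sum>j\<in>J. X j * of_bool (\<tau> j \<in> Q) + Y j * of_bool (\<sigma> j \<in> P))"
      by (rule sum_mono)
    then show ?thesis using g[OF P Q card_PQ] by (simp add: sum_subtractf A_def)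
  qed
  define F where "F r = {x \<in> Z. \<eta> x = r}" for r
  define R where "R = \<eta> ` Z"
  have finF: "finite (F r)" for r using fin by (simp add: F_def)
  have finR: "finite R" using fin by (simp add: R_def)
  have R_S: "R \<subseteq> S" using \<eta> by (auto simp: R_def)
  have F_ge: "1 \<le> card (F r)" if "r \<in> R" for r
    using that finF[of r] by (auto simp: F_def R_def Suc_le_eq card_gt_0_iff)
  have card_F: "(\<Sum>r\<in>R. card (F r)) = card Z"
    using sum.image_gen[OF fin(3), of "\<lambda>_. 1 :: nat" \<eta>] by (simp add: R_def F_def)
  \<comment> \<open>The fibres partition \<open>Z\<close>, which is as large as \<open>S\<close>.
    Hence the local centers outside the range of \<open>\<eta>\<close> are exactly enough to give
    \<open>card (F r) - 1\<close> of them to every \<open>r\<close>.\<close>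
  have "(\<Sum>r\<in>R. card (F r) - 1) + card R = (\<Sum>r\<in>R. (card (F r) - 1) + 1)"
    by (subst sum.distrib) simp
  also have "\<dots> = (\<Sum>r\<in>R. card (F r))"
    by (rule sum.cong) (use F_ge in fastforce)+
  finally have "(\<Sum>r\<in>R. card (F r) - 1) = card (S - R)"
    using card_F card(1) card_Diff_subset[OF finR R_S] by simp
  then obtain D where D: "\<And>r. r \<in> R \<Longrightarrow> D r \<subseteq> S - R" "\<And>r. r \<in> R \<Longrightarrow> card (D r) = card (F r) - 1"
    "\<And>r s. r \<in> R \<Longrightarrow> s \<in> R \<Longrightarrow> r \<noteq> s \<Longrightarrow> D r \<inter> D s = {}"
    using disjoint_subsets_exist[OF finR, of "S - R" "\<lambda>r. card (F r) - 1"] fin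
    by (metis finite_Diff le_refl)
  have finD: "finite (D r)" if "r \<in> R" for r
    using D(1)[OF that] fin finite_subset by blast
  let ?s = "\<lambda>r j. X j * of_bool (\<tau> j \<in> F r)
    + (1 + 1 / p) * Y j * of_bool (\<sigma> j \<in> insert r (D r))"
  have star: "- g * real (card (F r))
      \<le> (\<Sum>j\<in>J. ?s r j)"
    if r: "r \<in> R" for r
  proof (cases "card (F r) \<le> p")
    case True
    have "- g * real (card (F r)) \<le> - g"
      using mult_left_mono[of 1 "real (card (F r))" g] F_ge[OF r] g0 by simp
    also have "- g \<le> (\<Sum>j\<in>J. X j * of_bool (\<tau> j \<in> F r) + Y j * of_bool (\<sigma> j \<in> insert r (D r)))"
    proof (rule swap)
      have "r \<notin> D r" using D(1) r by blast
      then show "card (insert r (D r)) = card (F r)"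
        using D(2)[OF r] F_ge[OF r] finD[OF r] by simp
      show "\<eta> x \<notin> insert r (D r)" if "x \<in> Z" "x \<notin> F r" for x
        using that D(1)[OF r] by (auto simp: F_def R_def)
    qed (use True D(1)[OF r] R_S r in \<open>auto simp: F_def\<close>)
    also have "\<dots> \<le> (\<Sum>j\<in>J. ?s r j)"
      using Y0 by (intro sum_mono add_left_mono mult_right_mono) (auto simp: algebra_simps)
    finally show ?thesis .
  next
    case False
    \<comment> \<open>All \<open>q * (q + 1)\<close> exchanges of one \<open>z\<close> in
      \<open>D r\<close> for one \<open>x\<close> in \<open>F r\<close> are added up and divided by
      \<open>q\<close>. Each \<open>x\<close> then comes in once, each \<open>z\<close> goes out
      \<open>1 + 1 / q \<le> 1 + 1 / p\<close> times, and \<open>g\<close> is paid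
      \<open>card (F r)\<close> times.\<close>
    define q where "q = real (card (F r)) - 1"
    have q: "real p \<le> q" "q = card (D r)" "q + 1 = card (F r)"
      using False F_ge[OF r] D(2)[OF r] by (simp_all add: q_def of_nat_diff)
    have q0: "0 < q" using q(1) p by simp
    have ind: "(\<Sum>x\<in>M. of_bool (y \<in> {x})) = (of_bool (y \<in> M) :: real)" if "finite M" for M and y :: 'w
    proof -
      have "(\<Sum>x\<in>M. of_bool (y \<in> {x})) = (\<Sum>x\<in>M. if x = y then 1 else (0 :: real))"
        by (rule sum.cong) auto
      then show ?thesis using that by simp
    qed
    have "(\<Sum>z\<in>D r. \<Sum>x\<in>F r. - g)
        \<le> (\<Sum>z\<in>D r. \<Sum>x\<in>F r. \<Sum>j\<in>J. X j * of_bool (\<tau> j \<in> {x}) + Y j * of_bool (\<sigma> j \<in> {z}))"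
    proof (intro sum_mono swap)
      fix z x y assume "z \<in> D r" "x \<in> F r" "y \<in> Z" "y \<notin> {x}"
      then show "\<eta> y \<notin> {z}" using D(1)[OF r] by (auto simp: R_def)
    qed (use D(1)[OF r] p in \<open>auto simp: F_def\<close>)
    also have "\<dots> = (\<Sum>j\<in>J. \<Sum>z\<in>D r. \<Sum>x\<in>F r. X j * of_bool (\<tau> j \<in> {x}) + Y j * of_bool (\<sigma> j \<in> {z}))"
      by (simp only: sum.swap[of _ J])
    also have "\<dots> = (\<Sum>j\<in>J. q * (X j * of_bool (\<tau> j \<in> F r)) + (q + 1) * (Y j * of_bool (\<sigma> j \<in> D r)))"
    proof (rule sum.cong[OF refl])
      fix j assume "j \<in> J"
      show "(\<Sum>z\<in>D r. \<Sum>x\<in>F r. X j * of_bool (\<tau> j \<in> {x}) + Y j * of_bool (\<sigma> j \<in> {z}))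
        = q * (X j * of_bool (\<tau> j \<in> F r)) + (q + 1) * (Y j * of_bool (\<sigma> j \<in> D r))"
        using ind[OF finF, of "\<tau> j" r] ind[OF finD[OF r], of "\<sigma> j"] q(2,3)
        by (simp only: sum.distrib sum_distrib_left[symmetric] sum_constant mult.assoc
              mult.left_commute)
    qed
    finally have "q * (- g * real (card (F r)))
        \<le> (\<Sum>j\<in>J. q * (X j * of_bool (\<tau> j \<in> F r)) + (q + 1) * (Y j * of_bool (\<sigma> j \<in> D r)))"
      using q(2) by (simp add: algebra_simps)
    also have "\<dots> \<le> (\<Sum>j\<in>J. q * (?s r j))"
    proof (rule sum_mono)
      fix j assume j: "j \<in> J"
      have "1 \<le> q / p" using q(1) p by simp
      then have "q + 1 \<le> q * (1 + 1 / p)" by (simp add: algebra_simps)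
      moreover have "Y j * of_bool (\<sigma> j \<in> D r) \<le> Y j * of_bool (\<sigma> j \<in> insert r (D r))"
        using Y0[OF j] by auto
      ultimately have "(q + 1) * (Y j * of_bool (\<sigma> j \<in> D r))
          \<le> (q * (1 + 1 / p)) * (Y j * of_bool (\<sigma> j \<in> insert r (D r)))"
        using Y0[OF j] q0 by (intro mult_mono) auto
      then show "q * (X j * of_bool (\<tau> j \<in> F r)) + (q + 1) * (Y j * of_bool (\<sigma> j \<in> D r))
        \<le> q * (?s r j)"
        by (simp only: distrib_left[of q "X j * of_bool (\<tau> j \<in> F r)"] mult.assoc)
    qed
    finally show ?thesis
      using q0 by (simp only: sum_distrib_left[symmetric] mult_le_cancel_left_pos)
  qed
  let ?b = "\<lambda>j. if j \<in> T then (1 + 1 / p) * pen j else (3 + 2 / p) * c j (\<tau> j)"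
  have "- g * real (card S) = (\<Sum>r\<in>R. - g * real (card (F r)))"
    using card_F card(1) by (simp add: sum_negf flip: sum_distrib_left of_nat_sum)
  also have "\<dots> \<le> (\<Sum>r\<in>R. \<Sum>j\<in>J. ?s r j)"
    by (intro sum_mono star)
  also have "\<dots> = (\<Sum>j\<in>J. \<Sum>r\<in>R. ?s r j)"
    by (rule sum.swap)
  also have "\<dots> \<le> (\<Sum>j\<in>J. X j + (1 + 1 / p) * Y j)"
  proof (rule sum_mono)
    fix j assume j: "j \<in> J"
    \<comment> \<open>\<open>X j\<close> may be negative, so \<open>\<tau> j\<close> has to be
      counted exactly once; \<open>Y j\<close> is nonnegative, so for \<open>\<sigma> j\<close> at
      most once is enough.\<close>
    have "(\<Sum>r\<in>R. of_bool (\<tau> j \<in> F r)) = (\<Sum>r\<in>R. if r = \<eta> (\<tau> j) then 1 else (0 :: real))"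
      by (rule sum.cong) (use \<tau>[OF j] in \<open>auto simp: F_def\<close>)
    also have "\<dots> = 1" using finR \<tau>[OF j] by (simp add: R_def)
    finally have 1: "(\<Sum>r\<in>R. of_bool (\<tau> j \<in> F r)) = (1 :: real)" .
    have "\<forall>r\<in>R. \<forall>s\<in>R. \<sigma> j \<in> insert r (D r) \<longrightarrow> \<sigma> j \<in> insert s (D s) \<longrightarrow> r = s"
      using D(1,3) by blast
    then have 2: "(\<Sum>r\<in>R. of_bool (\<sigma> j \<in> insert r (D r))) \<le> (1 :: real)"
    proof -
      assume uniq: "\<forall>r\<in>R. \<forall>s\<in>R. \<sigma> j \<in> insert r (D r) \<longrightarrow> \<sigma> j \<in> insert s (D s) \<longrightarrow> r = s"
      show ?thesis
      proof (cases "\<exists>r\<in>R. \<sigma> j \<in> insert r (D r)")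
        case True
        then obtain r where r: "r \<in> R" "\<sigma> j \<in> insert r (D r)" by blast
        have "(\<Sum>s\<in>R. of_bool (\<sigma> j \<in> insert s (D s))) = (\<Sum>s\<in>R. if s = r then 1 else (0 :: real))"
          by (rule sum.cong[OF refl]) (use uniq r in \<open>auto simp only: of_bool_def split: if_splits\<close>)
        then show ?thesis using finR r by simp
      next
        case False
        then have "(\<Sum>s\<in>R. of_bool (\<sigma> j \<in> insert s (D s))) = (\<Sum>s\<in>R. (0 :: real))"
          by (intro sum.cong) auto
        then show ?thesis by simp
      qed
    qed
    have "(\<Sum>r\<in>R. ?s r j)
      = X j * (\<Sum>r\<in>R. of_bool (\<tau> j \<in> F r)) + (1 + 1 / p) * Y j * (\<Sum>r\<in>R. of_bool (\<sigma> j \<in> insert r (D r)))"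
      by (simp only: sum.distrib sum_distrib_left)
    also have "\<dots> \<le> X j * 1 + (1 + 1 / p) * Y j * 1"
      unfolding 1 using 2 Y0[OF j] by (intro add_left_mono mult_left_mono mult_nonneg_nonneg) auto
    finally show "(\<Sum>r\<in>R. ?s r j)
      \<le> X j + (1 + 1 / p) * Y j" by simp
  qed
  also have "\<dots> \<le> (\<Sum>j\<in>J. ?b j - A j)"
  proof (rule sum_mono)
    fix j assume j: "j \<in> J"
    \<comment> \<open>For \<open>j\<close> in \<open>T\<close> the factor \<open>1 + 1 / p\<close>
      of \<open>Y j\<close> also multiplies \<open>- A j\<close>. One \<open>A j\<close> is kept for
      the left-hand side and the surplus is dropped.\<close>
    have "0 \<le> A j / p" using A0[OF j] by simp
    then show "X j + (1 + 1 / p) * Y j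
      \<le> ?b j - A j"
      by (simp add: X_def Y_def algebra_simps add_divide_distrib diff_divide_distrib)
  qed
  also have "\<dots> = sum ?b J - sum A J"
    by (rule sum_subtractf)
  also have "sum ?b J
    = (1 + 1 / p) * sum pen T + (3 + 2 / p) * (\<Sum>j\<in>J - T. c j (\<tau> j))"
    using fin T by (simp add: sum.If_cases Int_absorb1 Diff_eq[symmetric] sum_distrib_left
        Collect_neg_eq)
  finally show ?thesis by (simp add: A_def algebra_simps)
qed

section \<open>Local search as a polynomial-time function\<close>

type_synonym client = "int \<times> int list"

definition client_cost :: "nat list \<Rightarrow> client \<Rightarrow> int" where
  "client_cost F cl = fold (\<lambda>w a. min a (nth_default 0 (snd cl) w)) F (fst cl)"

definition cost :: "client list \<Rightarrow> nat list \<Rightarrow> int" where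
  "cost cls F = sum_list (map (client_cost F) cls)"

text \<open>A center that is already open is not inserted again. This keeps lists distinct and makes
  the exchange for an open center the idle move.\<close>

definition swaps :: "nat list \<Rightarrow> nat list \<Rightarrow> nat list list" where
  "swaps facs F = concat (map (\<lambda>a. map (\<lambda>b. if b \<in> set F then F
     else b # filter (\<lambda>w. \<not> w = a) F) facs) F)"

primrec multiswaps :: "nat \<Rightarrow> nat list \<Rightarrow> nat list \<Rightarrow> nat list list" where
  "multiswaps 0 facs F = [F]"
| "multiswaps (Suc p) facs F = concat (map (swaps facs) (multiswaps p facs F))"

definition best :: "('b \<Rightarrow> int) \<Rightarrow> 'b list \<Rightarrow> 'b \<Rightarrow> 'b" where
  "best k xs b = fold (\<lambda>x y. if k x < k y then x else y) xs b"

definition improve :: "nat \<Rightarrow> nat list \<Rightarrow> client list \<Rightarrow> nat list \<Rightarrow> nat list" where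
  "improve p facs cls F = best (cost cls) (multiswaps p facs F) F"

definition rounds :: "int \<Rightarrow> client list \<Rightarrow> nat list \<Rightarrow> nat list" where
  "rounds m cls F = concat (map (\<lambda>_. bitlist (m * cost cls F)) F)"

definition local_search :: "nat \<Rightarrow> int \<Rightarrow> nat list \<Rightarrow> client list \<Rightarrow> nat list \<Rightarrow> nat list" where
  "local_search p m facs cls F = fold (\<lambda>_. improve p facs cls) (rounds m cls F) F"

lemma polytime_client_cost:
  assumes "polytime F" "polytime cl"
  shows "polytime (\<lambda>x. client_cost (F x) (cl x))"
proof -
  have le: "size_of (min a (nth_default 0 row w)) \<le> size_of a + size_of row + 2"
    for a :: int and row w
    using size_of_mem_le[of "row ! w" row]
    by (auto simp: min_def nth_default_def size_of_def intro: trans_le_add1)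
  have "polytime (\<lambda>z. client_cost (fst z) (snd z))"
    unfolding client_cost_def
    by (rule polytime_fold_additive[where B = "\<lambda>z. size_of (snd (snd (fst z))) + 2"])
       (use le in \<open>auto intro!: polytime_list_intros polybound_intros polytime_size\<close>)
  from polytime_comp2[OF this assms] show ?thesis .
qed

lemma polytime_cost_pair: "polytime (\<lambda>z. cost (fst z) (snd z))"
  unfolding cost_def by (intro polytime_list_intros polytime_client_cost)

lemmas polytime_cost = polytime_comp2[of cost, OF polytime_cost_pair]

lemma polytime_swaps_pair: "polytime (\<lambda>z. swaps (fst z) (snd z))"
  unfolding swaps_def by (intro polytime_list_intros)

lemmas polytime_swaps = polytime_comp2[of swaps, OF polytime_swaps_pair]

text \<open>\<open>p\<close> is a constant of the program and not part of its input; the induction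
  builds one program for each \<open>p\<close>, with a polynomial that depends on
  \<open>p\<close>.\<close>

lemma polytime_multiswaps:
  assumes "polytime facs" "polytime F"
  shows "polytime (\<lambda>x. multiswaps p (facs x) (F x))"
proof -
  have "polytime (\<lambda>z. multiswaps p (fst z) (snd z))"
  proof (induction p)
    case 0
    show ?case unfolding multiswaps.simps by (intro polytime_list_intros)
  next
    case (Suc p)
    show ?case unfolding multiswaps.simps
      by (intro polytime_concat polytime_map polytime_swaps polytime_intros Suc)
  qed
  from polytime_comp2[OF this assms] show ?thesis .
qed

lemma polytime_best:
  assumes k: "polytime (\<lambda>z. k (fst z) (snd z))" and l: "polytime l" and b: "polytime b"
  shows "polytime (\<lambda>x. best (k x) (l x) (b x))"
  unfolding best_def
  by (rule polytime_fold_additive[where B = "\<lambda>z. size_of (snd z)"])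
     (auto intro!: polytime_list_intros l b polytime_comp2[OF k] polybound_size_snd)

lemma polytime_improve_triple: "polytime (\<lambda>z. improve p (fst z) (fst (snd z)) (snd (snd z)))"
  unfolding improve_def
  by (intro polytime_best polytime_cost polytime_multiswaps polytime_intros)

lemmas polytime_improve = polytime_comp3[of "improve _", OF polytime_improve_triple]

lemma set_swaps: "G \<in> set (swaps facs F) \<longleftrightarrow> (\<exists>a\<in>set F. \<exists>b\<in>set facs.
    G = (if b \<in> set F then F else b # filter (\<lambda>w. \<not> w = a) F))"
  unfolding swaps_def by (simp only: set_concat set_map UN_iff image_iff) (simp add: image_iff, blast)

text \<open>\<open>F\<close> is an arbitrary list here, possibly with repetitions, because running
  times are claimed for every input of the type.\<close>

lemma swapsD:
  assumes "G \<in> set (swaps facs F)"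
  shows "length G \<le> length F" "set G \<subseteq> set F \<union> set facs"
proof -
  have "length (filter (\<lambda>w. w \<noteq> a) F) < length F" if "a \<in> set F" for a
    using that length_filter_less[of a F "\<lambda>w. w \<noteq> a"] by simp
  then show "length G \<le> length F" using assms by (fastforce simp: set_swaps Suc_le_eq)
  show "set G \<subseteq> set F \<union> set facs" using assms by (auto simp: set_swaps split: if_splits)
qed

lemma multiswapsD:
  "G \<in> set (multiswaps p facs F) \<Longrightarrow> length G \<le> length F \<and> set G \<subseteq> set F \<union> set facs"
proof (induction p arbitrary: G)
  case (Suc p)
  then obtain H where "H \<in> set (multiswaps p facs F)" "G \<in> set (swaps facs H)" by auto
  then show ?case using Suc.IH[of H] swapsD[of G facs H] by auto
qed simp

lemma best_in: "best k xs b \<in> insert b (set xs)"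
  unfolding best_def by (induction xs arbitrary: b) auto

lemma best_le: "x \<in> insert b (set xs) \<Longrightarrow> k (best k xs b) \<le> k x"
  unfolding best_def
proof (induction xs arbitrary: b x)
  case (Cons y xs)
  let ?C = "fold (\<lambda>x y. if k x < k y then x else y) xs"
  have "k (?C y) \<le> k y" "k (?C b) \<le> k b"
    "x \<in> set xs \<Longrightarrow> k (?C y) \<le> k x" "x \<in> set xs \<Longrightarrow> k (?C b) \<le> k x"
    using Cons.IH by simp_all
  then show ?case using Cons.prems by (cases "k y < k b") auto
qed simp

lemma polytime_local_search:
  assumes "polytime facs" "polytime cls" "polytime F"
  shows "polytime (\<lambda>x. local_search p m (facs x) (cls x) (F x))"
proof -
  let ?B = "\<lambda>z :: nat list \<times> client list \<times> nat list.
    2 + size_of (snd (snd z)) * (size_of (snd (snd z)) + size_of (fst z) + 1)"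
  have "polytime (\<lambda>z. local_search p m (fst z) (fst (snd z)) (snd (snd z)))"
    unfolding local_search_def
  proof (rule polytime_fold[where B = ?B])
    show "polytime (\<lambda>z :: nat list \<times> client list \<times> nat list. rounds m (fst (snd z)) (snd (snd z)))"
      unfolding rounds_def
      by (intro polytime_list_intros polytime_comp[OF polytime_bitlist] polytime_cost)
    show "polybound ?B"
      by (intro polybound_intros polytime_size polytime_intros)
    fix z :: "nat list \<times> client list \<times> nat list" and k
    define G where "G = fold (\<lambda>_. improve p (fst z) (fst (snd z)))
      (take k (rounds m (fst (snd z)) (snd (snd z)))) (snd (snd z))"
    have "length (fold (\<lambda>_. improve p facs cls) ts F) \<le> length F \<and>
        set (fold (\<lambda>_. improve p facs cls) ts F) \<subseteq> set F \<union> set facs"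
      for ts :: "nat list" and facs cls F
    proof (induction ts arbitrary: F)
      case (Cons t ts)
      have "length (improve p facs cls F) \<le> length F \<and>
          set (improve p facs cls F) \<subseteq> set F \<union> set facs"
        using best_in[of "cost cls" "multiswaps p facs F" F] unfolding improve_def
        by (elim insertE) (auto dest: multiswapsD)
      then show ?case using Cons[of "improve p facs cls F"] by auto
    qed simp
    then have G: "length G \<le> length (snd (snd z))" "set G \<subseteq> set (snd (snd z)) \<union> set (fst z)"
      unfolding G_def by blast+
    have "size_of w \<le> size_of (snd (snd z)) + size_of (fst z)" if "w \<in> set G" for w
      using that G(2) size_of_mem_le[of w "snd (snd z)"] size_of_mem_le[of w "fst z"] by force
    then have "size_of G \<le> 2 + length G * (size_of (snd (snd z)) + size_of (fst z) + 1)"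
      by (rule size_of_list_bound)
    also have "\<dots> \<le> ?B z"
      using G(1) length_le_size[of "snd (snd z)"] by (intro add_left_mono mult_right_mono) auto
    finally show "size_of (fold (\<lambda>_. improve p (fst z) (fst (snd z)))
      (take k (rounds m (fst (snd z)) (snd (snd z)))) (snd (snd z))) \<le> ?B z"
      unfolding G_def .
  qed (intro polytime_intros polytime_improve)+
  from polytime_comp3[OF this assms] show ?thesis .
qed

section \<open>Guarantee of the integer local search\<close>

lemma fold_const: "fold (\<lambda>_. f) xs a = (f ^^ length xs) a"
  by (induction xs arbitrary: a) (simp_all add: funpow_swap1)

lemma fold_min: "fold (\<lambda>w a. min a (f w)) F a = Min (insert a (f ` set F))"
  for f :: "'w \<Rightarrow> int"
proof (induction F arbitrary: a)
  case (Cons w F)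
  show ?case
    by (cases "set F = {}") (simp_all add: Cons min.assoc)
qed simp

lemma real_Min: "finite A \<Longrightarrow> A \<noteq> {} \<Longrightarrow> real_of_int (Min A) = Min (real_of_int ` A)"
  by (rule mono_Min_commute) (auto intro: monoI)

definition center_dist :: "client list \<Rightarrow> nat \<Rightarrow> nat \<Rightarrow> real" where
  "center_dist cls j w = of_int (nth_default 0 (snd (cls ! j)) w)"

definition penalty :: "client list \<Rightarrow> nat \<Rightarrow> real" where
  "penalty cls j = of_int (fst (cls ! j))"

lemma client_cost_conn:
  "real_of_int (client_cost F (cls ! j)) = conn (penalty cls) (center_dist cls) (set F) j"
  unfolding client_cost_def fold_min conn_def penalty_def center_dist_def
  by (subst real_Min) (simp_all add: image_image)

lemma cost_conn:
  "real_of_int (cost cls F)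
    = sum (conn (penalty cls) (center_dist cls) (set F)) {..<length cls}"
  by (simp add: cost_def sum_list_sum_nth atLeast0LessThan client_cost_conn)

definition center_set :: "nat list \<Rightarrow> nat \<Rightarrow> nat list \<Rightarrow> bool" where
  "center_set facs K F \<longleftrightarrow> distinct F \<and> length F = K \<and> set F \<subseteq> set facs"

lemma swaps_center_set:
  assumes "center_set facs K F" "G \<in> set (swaps facs F)"
  shows "center_set facs K G"
proof -
  obtain a b where ab: "a \<in> set F" "b \<in> set facs"
    "G = (if b \<in> set F then F else b # filter (\<lambda>w. \<not> w = a) F)"
    using assms(2) by (auto simp only: set_swaps)
  have d: "distinct F" using assms(1) by (simp add: center_set_def)
  have "set (filter (\<lambda>w. \<not> w = a) F) = set F - {a}" by auto
  then have "length (filter (\<lambda>w. \<not> w = a) F) = card (set F - {a})"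
    using distinct_card[OF distinct_filter[OF d, of "\<lambda>w. \<not> w = a"]] by simp
  then have "Suc (length (filter (\<lambda>w. \<not> w = a) F)) = length F"
    using card.remove[OF finite_set ab(1), symmetric] distinct_card[OF d] by simp
  then show ?thesis using assms(1) ab by (auto simp: center_set_def)
qed

lemma multiswaps_center_set:
  "center_set facs K F \<Longrightarrow> G \<in> set (multiswaps p facs F) \<Longrightarrow> center_set facs K G"
  by (induction p arbitrary: G) (auto intro: swaps_center_set)

text \<open>Each round brings in one element of \<open>Q\<close> in exchange for one of
  \<open>P\<close>. An inclusion is all that is needed, since additional centers only lower the
  cost, and it allows \<open>Q\<close> to be smaller than \<open>P\<close>.\<close>

lemma multiswaps_exist:
  assumes "center_set facs K F" "F \<noteq> []"
    and "P \<subseteq> set F" "Q \<inter> set F = {}" "Q \<subseteq> set facs" "card Q \<le> card P" "card Q \<le> p"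
  shows "\<exists>G\<in>set (multiswaps p facs F). (set F - P) \<union> Q \<subseteq> set G"
  using assms(3-7)
proof (induction p arbitrary: P Q)
  case 0
  then have "Q = {}" using finite_subset[of Q "set facs"] by simp
  then show ?case by simp
next
  case (Suc p)
  \<comment> \<open>The idle round, for the case that fewer than \<open>p\<close> exchanges are
    wanted: a center is exchanged for itself. There must be a center for this, hence
    \<open>F \<noteq> []\<close>.\<close>
  have stay: "G \<in> set (swaps facs G)" if "G \<in> set (multiswaps p facs F)" for G
  proof -
    have "center_set facs K G" using multiswaps_center_set[OF assms(1) that] .
    then have "G \<noteq> []" "set G \<subseteq> set facs" using assms(1,2) by (auto simp: center_set_def)
    then have "hd G \<in> set G" "hd G \<in> set facs" by auto
    then show ?thesis unfolding set_swaps by (intro bexI[of _ "hd G"]) auto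
  qed
  have finQ: "finite Q" using Suc.prems(3) finite_subset by blast
  show ?case
  proof (cases "Q = {}")
    case True
    then obtain G where "G \<in> set (multiswaps p facs F)" "set F - P \<union> Q \<subseteq> set G"
      using Suc.IH[of P Q] Suc.prems by auto
    then show ?thesis using stay by auto
  next
    case False
    then obtain q where q: "q \<in> Q" by blast
    then have cQ: "card Q = Suc (card (Q - {q}))" using finQ by (metis card.remove)
    then obtain r where r: "r \<in> P" using Suc.prems(4) by (metis card.empty all_not_in_conv not_less_eq_eq le0)
    have finP: "finite P" using Suc.prems(1) finite_subset by blast
    then have cP: "card P = Suc (card (P - {r}))" using r by (metis card.remove)
    have "\<exists>G\<in>set (multiswaps p facs F). (set F - (P - {r})) \<union> (Q - {q}) \<subseteq> set G"
      by (rule Suc.IH) (use Suc.prems cP cQ in auto)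
    then obtain G where G: "G \<in> set (multiswaps p facs F)"
      "(set F - (P - {r})) \<union> (Q - {q}) \<subseteq> set G" by blast
    show ?thesis
    proof (cases "q \<in> set G")
      case True
      then show ?thesis using G stay by (auto intro!: bexI[of _ G])
    next
      case False
      let ?H = "q # filter (\<lambda>w. \<not> w = r) G"
      have "r \<in> set G" "q \<in> set facs" using G(2) r q Suc.prems by auto
      then have "?H \<in> set (swaps facs G)"
        using False unfolding set_swaps by (intro bexI[of _ r] bexI[of _ q]) auto
      moreover have "(set F - P) \<union> Q \<subseteq> set ?H"
        using G(2) r Suc.prems(1,2) by auto
      ultimately show ?thesis using G(1) by (intro bexI[of _ ?H]) auto
    qed
  qed
qed

text \<open>
  The cost minus the guarantee shrinks by the factor \<open>1 - 1 / K\<close> per round, and there are \<open>K\<close>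
  times the bit length of \<open>m\<close> times the initial cost rounds.
\<close>

lemma local_search_guarantee:
  fixes d :: "nat \<Rightarrow> nat \<Rightarrow> real"
  assumes F: "center_set facs K F" "0 < K"
    and tri1: "\<And>j s x. j < length cls \<Longrightarrow> s \<in> set facs \<Longrightarrow> x \<in> set facs \<Longrightarrow>
      center_dist cls j s \<le> center_dist cls j x + d x s"
    and tri2: "\<And>j s x. j < length cls \<Longrightarrow> s \<in> set facs \<Longrightarrow> x \<in> set facs \<Longrightarrow>
      d x s \<le> center_dist cls j x + center_dist cls j s"
    and c0: "\<And>j w. j < length cls \<Longrightarrow> w \<in> set facs \<Longrightarrow> 0 \<le> center_dist cls j w"
    and pen0: "\<And>j. j < length cls \<Longrightarrow> 0 \<le> penalty cls j"
    and Z: "Z \<subseteq> set facs" "card Z = K" and \<tau>: "\<And>j. j < length cls \<Longrightarrow> \<tau> j \<in> Z"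
    and T: "T \<subseteq> {..<length cls}" and p: "0 < p" and m: "0 < m"
  shows "center_set facs K (local_search p m facs cls F)"
    and "of_int (cost cls (local_search p m facs cls F))
      \<le> (3 + 2 / real p) * (\<Sum>j\<in>{..<length cls} - T. center_dist cls j (\<tau> j))
        + (1 + 1 / real p) * sum (penalty cls) T + 1 / of_int m"
      (is "_ \<le> ?B + _")
proof -
  define b where "b = ?B"
  let ?i = "improve p facs cls"
  have inv: "center_set facs K (?i G)" if "center_set facs K G" for G
    using best_in[of "cost cls" "multiswaps p facs G" G] multiswaps_center_set[OF that] that
    unfolding improve_def by (elim insertE) simp_all
  \<comment> \<open>This is \<open>local_search_gap\<close> with \<open>g\<close> the progress made
    by one round.\<close>
  have gap: "cost cls G - b \<le> K * (real_of_int (cost cls G) - cost cls (?i G))"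
    if G: "center_set facs K G" for G
  proof -
    let ?g = "real_of_int (cost cls G) - cost cls (?i G)"
    have G': "G \<noteq> []" "card (set G) = K" "set G \<subseteq> set facs"
      using G F(2) by (auto simp: center_set_def distinct_card)
    have "sum (conn (penalty cls) (center_dist cls) (set G)) {..<length cls}
      \<le> ?B + real (card (set G)) * ?g"
    proof (rule local_search_gap[where d = d and Z = Z])
      show "finite Z" using Z finite_subset by blast
      show "0 \<le> ?g"
        using best_le[of G G "multiswaps p facs G" "cost cls"] by (simp add: improve_def)
      fix P Q assume PQ: "P \<subseteq> set G" "Q \<subseteq> Z" "card P = card Q" "card Q \<le> p"
      \<comment> \<open>\<open>P\<close> and \<open>Q\<close> may overlap, and \<open>Q\<close> may
        contain open centers. Only \<open>Q - set G\<close> has to come in; as \<open>P\<close> lies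
        in \<open>set G\<close> and is as large as \<open>Q\<close>, giving up \<open>P - Q\<close>
        makes room for it.\<close>
      let ?P = "P - Q" and ?Q = "Q - set G"
      have fin: "finite P" "finite Q" using PQ \<open>finite Z\<close> finite_subset by blast+
      have "card ?Q \<le> card (Q - P)"
        using fin PQ(1) by (intro card_mono) auto
      also have "\<dots> = card ?P"
        using fin PQ(3) card_Diff_subset_Int[of Q P] card_Diff_subset_Int[of P Q]
        by (simp add: Int_commute)
      finally have "card ?Q \<le> card ?P" .
      moreover have "card ?Q \<le> p" using PQ(4) card_Diff_subset_Int[of Q "set G"] fin by simp
      ultimately obtain H where H: "H \<in> set (multiswaps p facs G)"
        "(set G - ?P) \<union> ?Q \<subseteq> set H"
        using multiswaps_exist[OF G G'(1), of ?P ?Q p] PQ Z(1) by blast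
      have "cost cls (?i G) \<le> cost cls H"
        using best_le[of H G "multiswaps p facs G" "cost cls"] H(1) by (simp add: improve_def)
      then have "real_of_int (cost cls (?i G)) \<le> real_of_int (cost cls H)" by simp
      also have "\<dots> = sum (conn (penalty cls) (center_dist cls) (set H)) {..<length cls}"
        by (rule cost_conn)
      also have "\<dots> \<le> sum (conn (penalty cls) (center_dist cls) ((set G - P) \<union> Q)) {..<length cls}"
        using H(2) by (intro sum_mono conn_antimono) auto
      finally show "sum (conn (penalty cls) (center_dist cls) (set G)) {..<length cls}
          - sum (conn (penalty cls) (center_dist cls) ((set G - P) \<union> Q)) {..<length cls} \<le> ?g"
        by (simp add: cost_conn)
    qed (use assms G' in \<open>auto simp: subset_iff\<close>)
    then show ?thesis using G'(2) by (simp add: b_def cost_conn)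
  qed
  let ?q = "1 - 1 / real K"
  have q: "0 \<le> ?q" using F(2) by simp
  have b0: "0 \<le> b"
    unfolding b_def using c0 pen0 \<tau> Z(1) T
    by (intro add_nonneg_nonneg mult_nonneg_nonneg sum_nonneg c0) (auto intro: c0 pen0)
  have iter: "center_set facs K ((?i ^^ t) F) \<and> cost cls ((?i ^^ t) F) - b \<le> ?q ^ t * cost cls F"
    for t
  proof (induction t)
    case 0
    then show ?case using F b0 by simp
  next
    case (Suc t)
    let ?G = "(?i ^^ t) F"
    have "cost cls ?G - b \<le> K * (real_of_int (cost cls ?G) - cost cls (?i ?G))"
      using gap Suc by blast
    then have "(cost cls ?G - b) / K \<le> real_of_int (cost cls ?G) - cost cls (?i ?G)"
      using F(2) by (simp add: divide_le_eq mult.commute)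
    then have "cost cls (?i ?G) - b \<le> ?q * (cost cls ?G - b)"
      by (simp add: left_diff_distrib)
    also have "\<dots> \<le> ?q * (?q ^ t * cost cls F)"
      using Suc q by (intro mult_left_mono) auto
    finally show ?case using inv Suc by simp
  qed
  let ?L = "floorlog 2 (nat (m * cost cls F))"
  have cost0: "0 \<le> real_of_int (cost cls F)"
    unfolding cost_conn using c0 pen0 F(1)
    by (intro sum_nonneg conn_nonneg) (auto simp: center_set_def)
  have "length (rounds m cls F) = K * ?L"
    using F(1) by (simp add: rounds_def length_concat o_def bitlist_def sum_list_triv center_set_def)
  then have ls: "local_search p m facs cls F = (?i ^^ (K * ?L)) F"
    by (simp add: local_search_def fold_const)
  show "center_set facs K (local_search p m facs cls F)"
    using iter unfolding ls by blast
  \<comment> \<open>\<open>K\<close> rounds shrink the excess by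
    \<open>(1 - 1 / K) ^ K \<le> 1 / e \<le> 1 / 2\<close>, and there are \<open>?L\<close> such
    blocks, one for each bit of \<open>m\<close> times the initial cost.\<close>
  have "?q \<le> exp (- (1 / K))" using exp_ge_add_one_self[of "- (1 / real K)"] by simp
  then have "?q ^ K \<le> exp (- (1 / K)) ^ K" using q by (rule power_mono)
  also have "\<dots> = exp (- 1)" using F(2) by (simp add: exp_of_nat_mult[symmetric])
  also have "\<dots> \<le> 1 / 2"
    using exp_ge_add_one_self[of 1] by (simp add: exp_minus field_simps)
  finally have "(?q ^ K) ^ ?L \<le> (1 / 2) ^ ?L" using q by (intro power_mono) auto
  then have "?q ^ (K * ?L) * cost cls F \<le> (1 / 2) ^ ?L * cost cls F"
    using cost0 by (intro mult_right_mono) (auto simp: power_mult)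
  also have "\<dots> \<le> 1 / m"
  proof -
    have "nat (m * cost cls F) < 2 ^ ?L" using floorlog2_le_iff by blast
    then have "m * cost cls F < 2 ^ ?L" by (simp add: nat_less_iff split: if_splits)
    then have "real_of_int (m * cost cls F) < real_of_int (2 ^ ?L)" by (simp only: of_int_less_iff)
    then show ?thesis using m by (simp add: field_simps power_divide)
  qed
  finally show "of_int (cost cls (local_search p m facs cls F))
      \<le> ?B + 1 / of_int m"
    using iter[of "K * ?L"] unfolding ls b_def by linarith
qed

section \<open>Posterior values and adaptive policies\<close>

lemma expectation_mono_on:
  fixes f g :: "'b \<Rightarrow> real"
  assumes "finite (set_pmf p)" "\<And>x. x \<in> set_pmf p \<Longrightarrow> f x \<le> g x"
  shows "measure_pmf.expectation p f \<le> measure_pmf.expectation p g"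
  using assms by (intro integral_mono_AE) (auto simp: AE_measure_pmf_iff integrable_measure_pmf_finite)

lemma expectation_ge_const:
  fixes f :: "'b \<Rightarrow> real"
  assumes "finite (set_pmf p)" "\<And>x. x \<in> set_pmf p \<Longrightarrow> c \<le> f x"
  shows "c \<le> measure_pmf.expectation p f"
  using expectation_mono_on[OF assms(1), of "\<lambda>_. c" f] assms(2) by simp

lemma expectation_cong_on:
  fixes f g :: "'b \<Rightarrow> real"
  assumes "\<And>x. x \<in> set_pmf p \<Longrightarrow> f x = g x"
  shows "measure_pmf.expectation p f = measure_pmf.expectation p g"
  using assms by (intro integral_cong_AE) (auto simp: AE_measure_pmf_iff)

lemma expectation_add:
  fixes f g :: "'b \<Rightarrow> real"
  assumes "finite (set_pmf p)"
  shows "measure_pmf.expectation p (\<lambda>x. f x + g x)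
    = measure_pmf.expectation p f + measure_pmf.expectation p g"
  using assms by (intro Bochner_Integration.integral_add integrable_measure_pmf_finite)

lemma expectation_sum:
  fixes f :: "'i \<Rightarrow> 'b \<Rightarrow> real"
  assumes "finite (set_pmf p)"
  shows "measure_pmf.expectation p (\<lambda>x. \<Sum>i\<in>A. f i x) = (\<Sum>i\<in>A. measure_pmf.expectation p (f i))"
  using assms by (intro Bochner_Integration.integral_sum integrable_measure_pmf_finite)

lemma expectation_pair:
  fixes f :: "'b \<times> 'c \<Rightarrow> real"
  assumes "finite (set_pmf p)" "finite (set_pmf q)"
  shows "measure_pmf.expectation (pair_pmf p q) f
    = measure_pmf.expectation p (\<lambda>x. measure_pmf.expectation q (\<lambda>y. f (x, y)))"
proof -
  have "measure_pmf.expectation (pair_pmf p q) f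
    = (\<Sum>z\<in>set_pmf p \<times> set_pmf q. f z * pmf (pair_pmf p q) z)"
    using assms by (intro integral_measure_pmf_real) auto
  also have "\<dots> = (\<Sum>x\<in>set_pmf p. \<Sum>y\<in>set_pmf q. f (x, y) * (pmf p x * pmf q y))"
    unfolding sum.cartesian_product by (intro sum.cong) (auto simp: pmf_pair)
  also have "\<dots> = (\<Sum>x\<in>set_pmf p. measure_pmf.expectation q (\<lambda>y. f (x, y)) * pmf p x)"
  proof (rule sum.cong[OF refl])
    fix x
    have "measure_pmf.expectation q (\<lambda>y. f (x, y)) = (\<Sum>y\<in>set_pmf q. f (x, y) * pmf q y)"
      using assms by (intro integral_measure_pmf_real) auto
    then show "(\<Sum>y\<in>set_pmf q. f (x, y) * (pmf p x * pmf q y))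
      = measure_pmf.expectation q (\<lambda>y. f (x, y)) * pmf p x"
      by (simp add: sum_distrib_left mult_ac)
  qed
  also have "\<dots> = measure_pmf.expectation p (\<lambda>x. measure_pmf.expectation q (\<lambda>y. f (x, y)))"
    using assms by (intro integral_measure_pmf_real[symmetric]) auto
  finally show ?thesis .
qed

section \<open>Posterior costs, property (P2) and the outlier objective\<close>

definition expected_dist :: "'a kmedian \<Rightarrow> nat \<Rightarrow> 'a \<Rightarrow> real" where
  "expected_dist I i w = measure_pmf.expectation (law I i) (\<lambda>x. dist_of I x w)"

definition node_dist :: "'a kmedian \<Rightarrow> nat set \<Rightarrow> (nat \<Rightarrow> 'a) \<Rightarrow> nat \<Rightarrow> 'a \<Rightarrow> real" where
  "node_dist I S v i w = (if i \<in> S then dist_of I (v i) w else expected_dist I i w)"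

definition full_information :: "'a kmedian \<Rightarrow> nat set \<Rightarrow> (nat \<Rightarrow> 'a) \<Rightarrow> real" where
  "full_information I S v = measure_pmf.expectation (joint I (nodes I - S))
     (\<lambda>u. Min ((\<lambda>s. h I (nodes I) s (override_on u v S)) ` solutions I (nodes I)))"

definition center_choices :: "'a kmedian \<Rightarrow> 'a set set" where
  "center_choices I = {F. F \<subseteq> allowed_centers I \<and> card F = num_centers I}"

locale kmedian_instance =
  fixes I :: "'a kmedian"
  assumes valid: "valid_instance I"
begin

lemma finite_points: "finite (points I)"
  and centers_subset: "allowed_centers I \<subseteq> points I"
  and centers_pos: "0 < num_centers I"
  and centers_enough: "num_centers I \<le> card (allowed_centers I)"
  and law_subset: "i \<in> nodes I \<Longrightarrow> set_pmf (law I i) \<subseteq> points I"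
  and cost_nonneg: "i \<in> nodes I \<Longrightarrow> 0 \<le> probe_cost I i"
  and cost_le: "i \<in> nodes I \<Longrightarrow> probe_cost I i \<le> budget I"
  and nodes_pos: "0 < num_nodes I"
  using valid by (auto simp: valid_instance_def)

sublocale Metric_space "points I" "dist_of I"
  using valid by (simp add: valid_instance_def)

lemma budget_nonneg: "0 \<le> budget I"
  using cost_nonneg[of 0] cost_le[of 0] nodes_pos by simp

lemma finite_centers: "finite (allowed_centers I)"
  using centers_subset finite_points finite_subset by blast

lemma finite_law: "i \<in> nodes I \<Longrightarrow> finite (set_pmf (law I i))"
  using law_subset finite_points finite_subset by blast

lemma finite_sub: "A \<subseteq> nodes I \<Longrightarrow> finite A"
  using finite_subset by blast

lemma set_joint:
  assumes "A \<subseteq> nodes I"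
  shows "set_pmf (joint I A) = PiE_dflt A undefined (set_pmf \<circ> law I)"
  unfolding joint_def using assms finite_sub by (intro set_Pi_pmf) auto

lemma joint_in_points:
  "A \<subseteq> nodes I \<Longrightarrow> u \<in> set_pmf (joint I A) \<Longrightarrow> i \<in> A \<Longrightarrow> u i \<in> points I"
  using law_subset by (auto simp: set_joint PiE_dflt_def subset_iff)

lemma finite_joint: "A \<subseteq> nodes I \<Longrightarrow> finite (set_pmf (joint I A))"
  using finite_law finite_sub by (auto simp: set_joint intro!: finite_PiE_dflt)

lemma expectation_component:
  fixes f :: "'a \<Rightarrow> real"
  assumes "A \<subseteq> nodes I" "i \<in> A"
  shows "measure_pmf.expectation (joint I A) (\<lambda>u. f (u i)) = measure_pmf.expectation (law I i) f"
proof -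
  have "law I i = map_pmf (\<lambda>u. u i) (joint I A)"
    using Pi_pmf_component[of A i undefined "law I"] assms finite_sub by (simp add: joint_def)
  then show ?thesis by simp
qed

lemma expected_dist_nonneg: "0 \<le> expected_dist I i w"
  unfolding expected_dist_def by (intro Bochner_Integration.integral_nonneg) simp

text \<open>An unprobed node is not a point of the metric space. Averaging the triangle inequality
  over its location gives this and the opposite inequality, which is all that local search asks of a
  client.\<close>

lemma expected_dist_triangle:
  assumes "i \<in> nodes I" "w \<in> points I" "x \<in> points I"
  shows "expected_dist I i w \<le> expected_dist I i x + dist_of I x w"
proof -
  have "expected_dist I i w
    \<le> measure_pmf.expectation (law I i) (\<lambda>y. dist_of I y x + dist_of I x w)"
    unfolding expected_dist_def using assms law_subset finite_law triangle
    by (intro expectation_mono_on) (auto simp: subset_iff)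
  also have "\<dots> = expected_dist I i x + dist_of I x w"
    unfolding expected_dist_def using finite_law[OF assms(1)] by (subst expectation_add) auto
  finally show ?thesis .
qed

lemma expected_dist_opposite:
  assumes "i \<in> nodes I" "w \<in> points I" "x \<in> points I"
  shows "dist_of I x w \<le> expected_dist I i x + expected_dist I i w"
proof -
  have "dist_of I x w
    \<le> measure_pmf.expectation (law I i) (\<lambda>y. dist_of I y x + dist_of I y w)"
  proof (rule expectation_ge_const[OF finite_law[OF assms(1)]])
    fix y assume "y \<in> set_pmf (law I i)"
    then show "dist_of I x w \<le> dist_of I y x + dist_of I y w"
      using triangle[of x y w] law_subset assms commute[of x y] by auto
  qed
  also have "\<dots> = expected_dist I i x + expected_dist I i w"
    unfolding expected_dist_def by (rule expectation_add[OF finite_law[OF assms(1)]])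
  finally show ?thesis .
qed

lemma node_dist_nonneg: "0 \<le> node_dist I S v i w"
  by (simp add: node_dist_def expected_dist_nonneg)

lemma node_dist_triangle:
  assumes "i \<in> nodes I" "\<And>i. i \<in> S \<Longrightarrow> v i \<in> points I" "w \<in> points I" "x \<in> points I"
  shows "node_dist I S v i w \<le> node_dist I S v i x + dist_of I x w"
  using assms triangle[of "v i" x w] expected_dist_triangle by (auto simp: node_dist_def)

lemma node_dist_opposite:
  assumes "i \<in> nodes I" "\<And>i. i \<in> S \<Longrightarrow> v i \<in> points I" "w \<in> points I" "x \<in> points I"
  shows "dist_of I x w \<le> node_dist I S v i x + node_dist I S v i w"
  using assms triangle[of x "v i" w] commute[of x "v i"] expected_dist_opposite
  by (auto simp: node_dist_def)

lemma finite_solutions: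
  assumes "A \<subseteq> nodes I"
  shows "finite (solutions I A)"
proof (rule finite_subset)
  show "solutions I A \<subseteq> Pow (allowed_centers I) \<times> (A \<rightarrow>\<^sub>E allowed_centers I)"
    by (auto simp: solutions_def PiE_def)
qed (use assms finite_sub finite_centers in \<open>auto intro!: finite_PiE\<close>)

lemma finite_center_choices: "finite (center_choices I)"
  using finite_centers by (simp add: center_choices_def)

lemma center_choicesD:
  assumes "F \<in> center_choices I"
  shows "finite F" "F \<noteq> {}" "F \<subseteq> points I" "F \<subseteq> allowed_centers I" "card F = num_centers I"
  using assms finite_centers centers_pos centers_subset finite_subset
  by (auto simp: center_choices_def)

lemma center_choices_nonempty: "center_choices I \<noteq> {}"
proof -
  obtain F where "F \<subseteq> allowed_centers I" "card F = num_centers I"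
    using obtain_subset_with_card_n[OF centers_enough] by metis
  then show ?thesis by (auto simp: center_choices_def)
qed

lemma solutions_iff: "(F, \<sigma>) \<in> solutions I A \<longleftrightarrow> F \<in> center_choices I \<and> \<sigma> \<in> A \<rightarrow>\<^sub>E F"
  by (simp add: solutions_def center_choices_def)

lemma solutions_nonempty: "solutions I A \<noteq> {}"
proof -
  obtain F where F: "F \<in> center_choices I" using center_choices_nonempty by blast
  then have "A \<rightarrow>\<^sub>E F \<noteq> {}" using center_choicesD by (simp add: PiE_eq_empty_iff)
  then show ?thesis using F solutions_iff by blast
qed

lemma solution_point: "s \<in> solutions I A \<Longrightarrow> i \<in> A \<Longrightarrow> snd s i \<in> points I"
  using center_choicesD(3) by (cases s) (auto simp: solutions_iff PiE_def Pi_def)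

lemma Min_solutions_le:
  "A \<subseteq> nodes I \<Longrightarrow> s \<in> solutions I A \<Longrightarrow> Min (f ` solutions I A) \<le> f s"
  by (simp add: finite_solutions)

lemma Min_solutions_obtain:
  assumes "A \<subseteq> nodes I"
  obtains s where "s \<in> solutions I A" "Min (f ` solutions I A) = f s"
  using Min_in[of "f ` solutions I A"] finite_solutions[OF assms] solutions_nonempty by fastforce

lemma expectation_h:
  assumes "A \<subseteq> nodes I"
  shows "measure_pmf.expectation (joint I A) (h I A s) = (\<Sum>i\<in>A. expected_dist I i (snd s i))"
  unfolding h_def expectation_sum[OF finite_joint[OF assms]] expected_dist_def
  by (intro sum.cong[OF refl] expectation_component[OF assms])

lemma posterior_cost_eq:
  assumes "S \<subseteq> nodes I"
  shows "posterior_cost I S v s = (\<Sum>i\<in>nodes I. node_dist I S v i (snd s i))"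
proof -
  have B: "nodes I - S \<subseteq> nodes I" by blast
  have "measure_pmf.expectation (joint I (nodes I - S)) (\<lambda>u. dist_of I (override_on u v S i) (snd s i))
    = node_dist I S v i (snd s i)" if "i \<in> nodes I" for i
    using that expectation_component[OF B, of i "\<lambda>x. dist_of I x (snd s i)"]
    by (cases "i \<in> S") (simp_all add: node_dist_def expected_dist_def)
  then show ?thesis
    unfolding posterior_cost_def h_def expectation_sum[OF finite_joint[OF B]]
    by (intro sum.cong) auto
qed

lemma posterior_value_le:
  "s \<in> solutions I (nodes I) \<Longrightarrow> posterior_value I S v \<le> posterior_cost I S v s"
  unfolding posterior_value_def by (intro Min_solutions_le) auto

lemma h_nonneg: "0 \<le> h I A s v"
  by (simp add: h_def sum_nonneg)

text \<open>
  Every node outside \<open>A\<close> has a representative \<open>r\<close>: its center in an optimal solution for these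
  nodes. Using the assignment that is optimal for a random completion \<open>u\<close>, the triangle inequality
  along \<open>X\<^sub>i, r\<^sub>i, u\<^sub>i\<close> bounds the posterior value.
\<close>

lemma posterior_value_bound:
  assumes A: "A \<subseteq> nodes I" and v: "\<And>i. i \<in> A \<Longrightarrow> v i \<in> points I"
  shows "posterior_value I A v
    \<le> 2 * Min ((\<lambda>s. measure_pmf.expectation (joint I (nodes I - A)) (h I (nodes I - A) s))
            ` solutions I (nodes I - A)) + full_information I A v"
proof -
  let ?B = "nodes I - A"
  have B: "?B \<subseteq> nodes I" by blast
  obtain r where r: "r \<in> solutions I ?B"
    "Min ((\<lambda>s. measure_pmf.expectation (joint I ?B) (h I ?B s)) ` solutions I ?B)
      = (\<Sum>i\<in>?B. expected_dist I i (snd r i))"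
    unfolding expectation_h[OF B] by (rule Min_solutions_obtain[OF B, of "\<lambda>s. \<Sum>i\<in>?B. expected_dist I i (snd s i)"])
  let ?e = "\<lambda>u i. expected_dist I i (snd r i) + dist_of I (u i) (snd r i)"
  let ?b = "\<Sum>i\<in>?B. expected_dist I i (snd r i)"
  let ?m = "\<lambda>u. Min ((\<lambda>s. h I (nodes I) s (override_on u v A)) ` solutions I (nodes I))"
  have "posterior_value I A v \<le> ?b + h I ?B r u + ?m u" if u: "u \<in> set_pmf (joint I ?B)" for u
  proof -
    obtain s where s: "s \<in> solutions I (nodes I)" "?m u = h I (nodes I) s (override_on u v A)"
      using Min_solutions_obtain[of "nodes I"] by blast
    have "posterior_value I A v \<le> (\<Sum>i\<in>nodes I. node_dist I A v i (snd s i))"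
      using posterior_value_le[OF s(1), of A v] posterior_cost_eq[OF A, of v s] by simp
    also have "\<dots> \<le> (\<Sum>i\<in>nodes I.
        (if i \<in> A then 0 else ?e u i)
        + dist_of I (override_on u v A i) (snd s i))"
    proof (rule sum_mono)
      fix i assume i: "i \<in> nodes I"
      show "node_dist I A v i (snd s i)
        \<le> (if i \<in> A then 0 else ?e u i)
        + dist_of I (override_on u v A i) (snd s i)"
      proof (cases "i \<in> A")
        case False
        have pts: "snd r i \<in> points I" "snd s i \<in> points I" "u i \<in> points I"
          using solution_point[OF r(1)] solution_point[OF s(1)] joint_in_points[OF B u] i False by auto
        have "expected_dist I i (snd s i) \<le> expected_dist I i (snd r i) + dist_of I (snd r i) (snd s i)"
          using expected_dist_triangle i pts by blast
        also have "dist_of I (snd r i) (snd s i) \<le> dist_of I (u i) (snd r i) + dist_of I (u i) (snd s i)"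
          using triangle[of "snd r i" "u i" "snd s i"] pts commute[of "u i" "snd r i"] by simp
        finally show ?thesis using False by (simp add: node_dist_def)
      qed (simp add: node_dist_def)
    qed
    also have "\<dots> = (\<Sum>i\<in>nodes I. if i \<in> A then 0 else ?e u i) + ?m u"
      unfolding s(2) sum.distrib by (simp add: h_def)
    also have "(\<Sum>i\<in>nodes I. if i \<in> A then 0 else ?e u i)
        = (\<Sum>i\<in>?B. ?e u i)"
      by (intro sum.mono_neutral_cong_right) auto
    finally show ?thesis by (simp add: h_def sum.distrib)
  qed
  then have "posterior_value I A v
      \<le> measure_pmf.expectation (joint I ?B) (\<lambda>u. ?b + h I ?B r u + ?m u)"
    by (intro expectation_ge_const finite_joint B)
  also have "\<dots> = ?b + measure_pmf.expectation (joint I ?B) (h I ?B r) + full_information I A v"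
    unfolding full_information_def
    by (subst expectation_add[OF finite_joint[OF B]])+ simp
  finally show ?thesis unfolding r(2) using expectation_h[OF B, of r] by simp
qed

lemma P2_5: "P2 5 I"
  unfolding P2_def full_information_def[symmetric]
proof (intro allI impI, elim conjE)
  fix A v assume A: "A \<subseteq> nodes I" and v: "\<forall>i\<in>A. v i \<in> points I"
  let ?B = "nodes I - A"
  let ?b = "Min ((\<lambda>s. measure_pmf.expectation (joint I ?B) (h I ?B s)) ` solutions I ?B)"
  let ?a = "Min ((\<lambda>s. h I A s v) ` solutions I A)"
  have "0 \<le> ?a" "0 \<le> ?b"
    using finite_solutions[OF A] finite_solutions[of ?B] solutions_nonempty h_nonneg
    by (auto intro!: Bochner_Integration.integral_nonneg)
  moreover have "0 \<le> full_information I A v"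
    unfolding full_information_def using finite_solutions[of "nodes I"] solutions_nonempty h_nonneg
    by (intro Bochner_Integration.integral_nonneg) auto
  ultimately show "posterior_value I A v \<le> 5 * (?a + ?b + full_information I A v)"
    using posterior_value_bound[OF A, of v] v by auto
qed

lemma outlier_objective_le:
  assumes T: "T \<subseteq> nodes I" and s: "s \<in> solutions I (nodes I - T)"
  shows "outlier_objective I T \<le> (\<Sum>i\<in>nodes I - T. expected_dist I i (snd s i))"
proof -
  obtain F \<sigma> where s_eq: "s = (F, \<sigma>)" by (cases s)
  then have F: "F \<in> center_choices I" and \<sigma>: "\<sigma> \<in> (nodes I - T) \<rightarrow>\<^sub>E F"
    using s solutions_iff by auto
  have "outlier_objective I T \<le> (\<Sum>i\<in>nodes I - T. Min (expected_dist I i ` F))"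
    unfolding outlier_objective_def expected_dist_def center_choices_def[symmetric]
    using F finite_center_choices by (intro Min_le) (auto simp: image_iff)
  also have "\<dots> \<le> (\<Sum>i\<in>nodes I - T. expected_dist I i (\<sigma> i))"
    using \<sigma> center_choicesD(1)[OF F] by (intro sum_mono Min_le) (auto simp: PiE_def Pi_def)
  finally show ?thesis by (simp add: s_eq)
qed

lemma outlier_objective_obtain:
  assumes T: "T \<subseteq> nodes I"
  obtains s where "s \<in> solutions I (nodes I - T)"
    "outlier_objective I T = (\<Sum>i\<in>nodes I - T. expected_dist I i (snd s i))"
proof -
  have "outlier_objective I T \<in> (\<lambda>F. \<Sum>i\<in>nodes I - T. Min (expected_dist I i ` F)) ` center_choices I"
    unfolding outlier_objective_def expected_dist_def center_choices_def[symmetric]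
    using finite_center_choices center_choices_nonempty by (intro Min_in) auto
  then obtain F where F: "F \<in> center_choices I"
    "outlier_objective I T = (\<Sum>i\<in>nodes I - T. Min (expected_dist I i ` F))" by blast
  have "\<exists>w. w \<in> F \<and> expected_dist I i w = Min (expected_dist I i ` F)" for i
    using Min_in[of "expected_dist I i ` F"] center_choicesD(1,2)[OF F(1)]
    by (metis finite_imageI image_is_empty imageE)
  then obtain w where w: "\<And>i. w i \<in> F" "\<And>i. expected_dist I i (w i) = Min (expected_dist I i ` F)"
    by metis
  let ?\<sigma> = "restrict w (nodes I - T)"
  show thesis
    using w F by (intro that[of "(F, ?\<sigma>)"]) (auto simp: solutions_iff)
qed

lemma outlier_opt_le:
  "T \<subseteq> nodes I \<Longrightarrow> total_cost I T \<le> budget I \<Longrightarrow> outlier_opt I \<le> outlier_objective I T"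
  unfolding outlier_opt_def by (intro Min_le) auto

lemma outlier_opt_obtain:
  obtains T where "T \<subseteq> nodes I" "total_cost I T \<le> budget I" "outlier_opt I = outlier_objective I T"
proof -
  have "outlier_opt I \<in> outlier_objective I ` {T. T \<subseteq> nodes I \<and> total_cost I T \<le> budget I}"
    unfolding outlier_opt_def
    using budget_nonneg by (intro Min_in) (auto simp: total_cost_def intro!: exI[of _ "{}"])
  then show thesis using that by blast
qed

section \<open>Lower bounds for adaptive policies and the cost of the strategy\<close>

lemma restrict_solution: "s \<in> solutions I (nodes I) \<Longrightarrow> A \<subseteq> nodes I \<Longrightarrow>
    (fst s, restrict (snd s) A) \<in> solutions I A"
  by (cases s) (auto simp: solutions_iff PiE_def Pi_def)

lemma outlier_opt_le_posterior:
  assumes S: "S \<subseteq> nodes I" "total_cost I S \<le> budget I"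
  shows "outlier_opt I \<le> posterior_value I S v"
proof -
  obtain s where s: "s \<in> solutions I (nodes I)" "posterior_value I S v = posterior_cost I S v s"
    unfolding posterior_value_def using Min_solutions_obtain[of "nodes I"] by blast
  have "outlier_opt I \<le> (\<Sum>i\<in>nodes I - S. node_dist I S v i (snd s i))"
    using outlier_opt_le[OF S] outlier_objective_le[OF S(1) restrict_solution[OF s(1)]]
    by (simp add: node_dist_def)
  also have "\<dots> \<le> (\<Sum>i\<in>nodes I. node_dist I S v i (snd s i))"
    by (intro sum_mono2) (auto simp: node_dist_nonneg)
  finally show ?thesis using s(2) posterior_cost_eq[OF S(1)] by simp
qed

text \<open>The expectation of a minimum is at most the minimum of the expectations.\<close>

lemma full_information_le_posterior:
  assumes S: "S \<subseteq> nodes I"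
  shows "full_information I S v \<le> posterior_value I S v"
proof -
  obtain s where s: "s \<in> solutions I (nodes I)" "posterior_value I S v = posterior_cost I S v s"
    unfolding posterior_value_def using Min_solutions_obtain[of "nodes I"] by blast
  show ?thesis
    unfolding s(2) posterior_cost_def full_information_def
    using s(1) by (intro expectation_mono_on finite_joint Min_solutions_le) auto
qed

text \<open>Tower property: a probe reveals one more coordinate of the same product law and leaves
  the expected optimum under full information unchanged on average.\<close>

lemma full_information_probe:
  assumes S: "S \<subseteq> nodes I" "i \<in> nodes I" "i \<notin> S"
  shows "full_information I S v
    = measure_pmf.expectation (law I i) (\<lambda>x. full_information I (insert i S) (v(i := x)))"
proof -
  let ?B = "nodes I - insert i S"
  have eq: "nodes I - S = insert i ?B" using S by blast
  have "joint I (nodes I - S) = map_pmf (\<lambda>(y, f). f(i := y)) (pair_pmf (law I i) (joint I ?B))"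
    unfolding joint_def eq by (rule Pi_pmf_insert) auto
  moreover have "override_on (u(i := x)) v S = override_on u (v(i := x)) (insert i S)" for u x
    using S by (auto simp: override_on_def)
  ultimately show ?thesis
    unfolding full_information_def using finite_law[OF S(2)] finite_joint[of ?B]
    by (simp add: case_prod_beta' expectation_pair)
qed

text \<open>Stated for every node of the policy tree to allow induction. Along probes the first
  bound is a martingale and the second a constant; at a leaf, feasibility says that \<open>S\<close>
  respects the budget.\<close>

lemma policy_lower_bounds:
  assumes "feasible_from I \<pi> S" "S \<subseteq> nodes I"
  shows "full_information I S v \<le> policy_value_from I \<pi> S v
    \<and> outlier_opt I \<le> policy_value_from I \<pi> S v"
  using assms
proof (induction \<pi> arbitrary: S v)
  case Stop
  then show ?case using full_information_le_posterior outlier_opt_le_posterior by simp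
next
  case (Probe i nxt)
  then have i: "i \<in> nodes I" "i \<notin> S" by simp_all
  have IH: "full_information I (insert i S) (v(i := x)) \<le> policy_value_from I (nxt x) (insert i S) (v(i := x))
    \<and> outlier_opt I \<le> policy_value_from I (nxt x) (insert i S) (v(i := x))"
    if "x \<in> set_pmf (law I i)" for x
    using Probe that by auto
  show ?case
    unfolding full_information_probe[OF Probe.prems(2) i] policy_value_from.simps
    using IH finite_law[OF i(1)] by (intro conjI expectation_mono_on expectation_ge_const) auto
qed

lemma OPT_lower_bounds:
  "full_information I {} (\<lambda>_. undefined) \<le> OPT I" "outlier_opt I \<le> OPT I"
proof -
  have "feasible_from I Stop {}" using budget_nonneg by (simp add: total_cost_def)
  then have "{\<pi>. feasible_from I \<pi> {}} \<noteq> {}" by blast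
  then show "full_information I {} (\<lambda>_. undefined) \<le> OPT I" "outlier_opt I \<le> OPT I"
    unfolding OPT_def using policy_lower_bounds by (auto intro!: cINF_greatest)
qed

lemma joint_split:
  assumes "T \<subseteq> nodes I"
  shows "joint I (nodes I)
    = map_pmf (\<lambda>(f, g). override_on g f T) (pair_pmf (joint I T) (joint I (nodes I - T)))"
proof -
  have "Pi_pmf (T \<union> (nodes I - T)) undefined (law I) = map_pmf (\<lambda>(f, g) x. if x \<in> T then f x else g x)
     (pair_pmf (joint I T) (joint I (nodes I - T)))"
    unfolding joint_def using assms finite_sub by (intro Pi_pmf_union) auto
  moreover have "T \<union> (nodes I - T) = nodes I" using assms by blast
  ultimately show ?thesis by (simp add: joint_def override_on_def)
qed

text \<open>In (P2) for \<open>A = T\<close>, the first and the third term are bounded by the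
  full-information value and the second by the outlier objective. On average this gives
  \<open>2 + \<beta>\<close> times the optimum.\<close>

lemma strategy_cost_bound:
  assumes T: "T \<subseteq> nodes I" and \<alpha>: "0 \<le> \<alpha>"
    and sol: "\<And>v. (\<And>i. i \<in> T \<Longrightarrow> v i \<in> points I) \<Longrightarrow>
      posterior_cost I T v (sol v) \<le> \<alpha> * posterior_value I T v"
    and G: "outlier_objective I T \<le> \<beta> * outlier_opt I" and \<beta>: "0 \<le> \<beta>"
  shows "strategy_cost I T sol \<le> \<alpha> * (5 * (2 + \<beta>)) * OPT I"
proof -
  let ?B = "nodes I - T"
  let ?J = "joint I T"
  let ?a = "\<lambda>f. Min ((\<lambda>s. h I T s f) ` solutions I T)"
  let ?b = "Min ((\<lambda>s. measure_pmf.expectation (joint I ?B) (h I ?B s)) ` solutions I ?B)"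
  let ?c = "\<lambda>f. full_information I T f + outlier_objective I T + full_information I T f"
  have B: "?B \<subseteq> nodes I" by blast
  \<comment> \<open>Outcomes in the support of \<open>?J\<close> are \<open>undefined\<close>
    outside \<open>T\<close>, just like restricted vectors, so the strategy is given
    \<open>f\<close> itself.\<close>
  have restrict: "restrict f T = f" if "f \<in> set_pmf ?J" for f
    using that T by (auto simp: set_joint PiE_dflt_def restrict_def fun_eq_iff)
  have "strategy_cost I T sol = measure_pmf.expectation ?J (\<lambda>f.
      measure_pmf.expectation (joint I ?B) (\<lambda>g. h I (nodes I) (sol (restrict f T)) (override_on g f T)))"
    unfolding strategy_cost_def joint_split[OF T]
    using finite_joint[OF T] finite_joint[OF B]
    by (simp add: case_prod_beta' expectation_pair)
       (intro arg_cong[where f = "measure_pmf.expectation _"] ext, simp add: restrict_def override_on_def cong: if_cong)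
  also have "\<dots> = measure_pmf.expectation ?J (\<lambda>f. posterior_cost I T f (sol f))"
    unfolding posterior_cost_def by (intro expectation_cong_on) (simp add: restrict)
  also have "\<dots> \<le> measure_pmf.expectation ?J (\<lambda>f.
      \<alpha> * (5 * (?c f)))"
  proof (rule expectation_mono_on[OF finite_joint[OF T]])
    fix f assume f: "f \<in> set_pmf ?J"
    have pts: "f i \<in> points I" if "i \<in> T" for i using joint_in_points[OF T f that] .
    obtain s where s: "s \<in> solutions I ?B"
      "outlier_objective I T = (\<Sum>i\<in>?B. expected_dist I i (snd s i))"
      using outlier_objective_obtain[OF T] by blast
    have b: "?b
        \<le> outlier_objective I T"
      unfolding s(2) expectation_h[OF B] by (rule Min_solutions_le[OF B s(1)])
    have a: "?a f \<le> full_information I T f"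
      unfolding full_information_def
    proof (rule expectation_ge_const[OF finite_joint[OF B]])
      fix g
      obtain s where s: "s \<in> solutions I (nodes I)"
        "Min ((\<lambda>s. h I (nodes I) s (override_on g f T)) ` solutions I (nodes I))
          = h I (nodes I) s (override_on g f T)"
        using Min_solutions_obtain[of "nodes I"] by blast
      have "?a f \<le> h I T (fst s, restrict (snd s) T) f"
        by (rule Min_solutions_le[OF T restrict_solution[OF s(1) T]])
      also have "\<dots> = (\<Sum>i\<in>T. dist_of I (override_on g f T i) (snd s i))"
        by (simp add: h_def)
      also have "\<dots> \<le> h I (nodes I) s (override_on g f T)"
        unfolding h_def using T by (intro sum_mono2) auto
      finally show "?a f
        \<le> Min ((\<lambda>s. h I (nodes I) s (override_on g f T)) ` solutions I (nodes I))"
        using s(2) by simp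
    qed
    have "posterior_value I T f \<le> 5 * (?a f
      + ?b
      + full_information I T f)"
      using P2_5[unfolded P2_def full_information_def[symmetric], rule_format, of T f] T pts by blast
    also have "\<dots> \<le> 5 * (?c f)"
      using a b by (intro mult_left_mono add_mono) auto
    finally have "posterior_value I T f
      \<le> 5 * (?c f)" .
    then show "posterior_cost I T f (sol f)
      \<le> \<alpha> * (5 * (?c f))"
      using sol[of f] pts \<alpha> by (meson mult_left_mono order_trans)
  qed
  also have "\<dots> = \<alpha> * (5 * (2 * measure_pmf.expectation ?J (full_information I T) + outlier_objective I T))"
    using expectation_add[OF finite_joint[OF T]] by simp
  \<comment> \<open>The tower property for all nodes of \<open>T\<close> at once.\<close>
  also have "measure_pmf.expectation ?J (full_information I T) = full_information I {} (\<lambda>_. undefined)"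
    unfolding full_information_def using finite_joint[OF T] finite_joint[OF B]
    by (simp add: joint_split[OF T] case_prod_beta' expectation_pair)
  also have "\<alpha> * (5 * (2 * full_information I {} (\<lambda>_. undefined) + outlier_objective I T))
      \<le> \<alpha> * (5 * (2 * OPT I + \<beta> * OPT I))"
    using OPT_lower_bounds \<alpha> \<beta> G mult_left_mono[OF OPT_lower_bounds(2) \<beta>]
    by (intro mult_left_mono add_mono) auto
  finally show ?thesis by (simp add: algebra_simps)
qed

end

section \<open>The algorithms\<close>

type_synonym ratio = "int \<times> int"

text \<open>
  The last component is \<open>0\<close>, the end marker of the list that encodes an instance.
\<close>

type_synonym input = "nat \<times> ratio list list \<times> nat \<times> ratio list list \<times> ratio list \<times> ratio \<times> nat
  \<times> nat list \<times> nat"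

definition in_dists :: "input \<Rightarrow> ratio list list" where
  "in_dists t = fst (snd t)"

definition in_laws :: "input \<Rightarrow> ratio list list" where
  "in_laws t = fst (snd (snd (snd t)))"

definition in_costs :: "input \<Rightarrow> ratio list" where
  "in_costs t = fst (snd (snd (snd (snd t))))"

definition in_budget :: "input \<Rightarrow> ratio" where
  "in_budget t = fst (snd (snd (snd (snd (snd t)))))"

definition in_num_centers :: "input \<Rightarrow> nat" where
  "in_num_centers t = fst (snd (snd (snd (snd (snd (snd t))))))"

definition in_centers :: "input \<Rightarrow> nat list" where
  "in_centers t = fst (snd (snd (snd (snd (snd (snd (snd t)))))))"

text \<open>The product instead of the least common multiple: no gcd has to be computed, and the
  size of a product is at most the sum of the sizes.\<close>

definition denominator :: "ratio list \<Rightarrow> int" where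
  "denominator rs = prod_list (map snd rs)"

definition scale_ratio :: "int \<Rightarrow> ratio \<Rightarrow> int" where
  "scale_ratio D r = fst r * (D div snd r)"

definition int_dists :: "input \<Rightarrow> int list list" where
  "int_dists t = map (map (scale_ratio (denominator (concat (in_dists t))))) (in_dists t)"

definition int_laws :: "input \<Rightarrow> int list list" where
  "int_laws t = map (map (scale_ratio (denominator (concat (in_laws t))))) (in_laws t)"

definition cost_denominator :: "input \<Rightarrow> int" where
  "cost_denominator t = denominator (in_budget t # in_costs t)"

definition int_costs :: "input \<Rightarrow> int list" where
  "int_costs t = map (scale_ratio (cost_denominator t)) (in_costs t)"

definition int_budget :: "input \<Rightarrow> int" where
  "int_budget t = scale_ratio (cost_denominator t) (in_budget t)"

definition dot :: "int list \<Rightarrow> int list \<Rightarrow> int" where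
  "dot xs ys = sum_list (map (\<lambda>k. nth_default 0 xs k * nth_default 0 ys k) [0..<length ys])"

definition expected_rows :: "input \<Rightarrow> int list list" where
  "expected_rows t = map (\<lambda>l. map (dot l) (int_dists t)) (int_laws t)"

definition start :: "input \<Rightarrow> nat list" where
  "start t = take (in_num_centers t) (in_centers t)"

text \<open>The budget multiplies the distances instead of dividing the penalties, so that
  everything stays integral. If \<open>\<mu>\<close> is about twice the scaled optimum, penalties
  for the whole budget weigh about as much as the connection cost of the optimum.\<close>

definition outlier_clients :: "input \<Rightarrow> int \<Rightarrow> client list" where
  "outlier_clients t \<mu> = map (\<lambda>i. (\<mu> * nth_default 0 (int_costs t) i,
     map (\<lambda>e. 2 * int_budget t * e) (nth_default [] (expected_rows t) i)))
     [0..<length (expected_rows t)]"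

text \<open>With 20 swaps the factors are \<open>3 + 2 / 20 = 31 / 10\<close> and
  \<open>1 + 1 / 20 = 21 / 20\<close>; the 100 leaves an additive error of
  \<open>1 / 100\<close>.\<close>

definition outlier_centers :: "input \<Rightarrow> int \<Rightarrow> nat list" where
  "outlier_centers t \<mu> = local_search 20 100 (in_centers t) (outlier_clients t \<mu>) (start t)"

text \<open>Ties are outliers. This matters for budget 0, where every penalty is 0 and all nodes
  have to be taken.\<close>

definition outliers :: "client list \<Rightarrow> nat list \<Rightarrow> nat list" where
  "outliers cls F = filter (\<lambda>i. \<not> client_cost F (nth_default (0, []) cls i)
     < fst (nth_default (0, []) cls i)) [0..<length cls]"

definition int_total_cost :: "input \<Rightarrow> nat list \<Rightarrow> int" where
  "int_total_cost t T = sum_list (map (nth_default 0 (int_costs t)) T)"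

definition outlier_candidate :: "input \<Rightarrow> int \<Rightarrow> int \<times> nat list" where
  "outlier_candidate t \<mu> =
     (cost (outlier_clients t \<mu>) (outlier_centers t \<mu>)
        - \<mu> * int_total_cost t (outliers (outlier_clients t \<mu>) (outlier_centers t \<mu>)),
      outliers (outlier_clients t \<mu>) (outlier_centers t \<mu>))"

definition total_rows :: "input \<Rightarrow> int" where
  "total_rows t = sum_list (map sum_list (expected_rows t))"

text \<open>The powers of 2 up to the bit length of \<open>4 * total_rows t\<close>; the additional
  0 in front includes the last exponent. Writing \<open>k\<close> as the length of a list presents
  the exponent in unary.\<close>

definition penalty_factors :: "input \<Rightarrow> int list" where
  "penalty_factors t = map (\<lambda>k. 2 ^ length (take k (0 # bitlist (4 * total_rows t))))
     [0..<length (0 # bitlist (4 * total_rows t))]"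

text \<open>The right \<open>\<mu>\<close> is not recognized; the best candidate within five times
  the budget is at least as good as the one for the right \<open>\<mu>\<close>. The start value
  exceeds the value of every candidate of an instance, so it is never returned.\<close>

definition outlier_fun :: "input \<Rightarrow> nat list" where
  "outlier_fun t = snd (best fst
     (filter (\<lambda>y. int_total_cost t (snd y) \<le> 5 * int_budget t)
       (map (outlier_candidate t) (penalty_factors t)))
     (2 * int_budget t * total_rows t + 1, []))"

text \<open>The penalty is the sum of the row, hence at least every distance in it. Rows of probed
  nodes are multiplied by the denominator of the laws to bring them to the scale of the expected
  distances.\<close>

definition posterior_clients :: "input \<Rightarrow> nat option list \<Rightarrow> client list" where
  "posterior_clients t vs = map (\<lambda>row. (sum_list row, row))
     (map (\<lambda>i. case nth_default None vs i of
         None \<Rightarrow> nth_default [] (expected_rows t) i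
       | Some x \<Rightarrow> map (\<lambda>e. denominator (concat (in_laws t)) * e) (nth_default [] (int_dists t) x))
     [0..<length (expected_rows t)])"

definition posterior_centers :: "nat \<Rightarrow> int \<Rightarrow> input \<Rightarrow> nat option list \<Rightarrow> nat list" where
  "posterior_centers p m t vs
     = local_search p m (in_centers t) (posterior_clients t vs) (start t)"

definition posterior_fun :: "nat \<Rightarrow> int \<Rightarrow> input \<times> nat option list \<Rightarrow> nat list \<times> nat list" where
  "posterior_fun p m z = (posterior_centers p m (fst z) (snd z),
     map (\<lambda>cl. best (nth_default 0 (snd cl)) (posterior_centers p m (fst z) (snd z))
         (nth_default 0 (posterior_centers p m (fst z) (snd z)) 0))
       (posterior_clients (fst z) (snd z)))"

lemmas input_defs = in_dists_def in_laws_def in_costs_def in_budget_def in_num_centers_def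
  in_centers_def

section \<open>Running times of the two algorithms\<close>

lemma polytime_input:
  "polytime in_dists" "polytime in_laws" "polytime in_costs" "polytime in_budget"
  "polytime in_num_centers" "polytime in_centers"
  unfolding input_defs[abs_def] by (intro polytime_intros)+

lemmas polytime_input_comp = polytime_input[THEN polytime_comp]

lemma polytime_denominator: "polytime f \<Longrightarrow> polytime (\<lambda>x. denominator (f x))"
  unfolding denominator_def by (intro polytime_list_intros)

lemma polytime_scale_ratio: "polytime D \<Longrightarrow> polytime r \<Longrightarrow> polytime (\<lambda>x. scale_ratio (D x) (r x))"
  unfolding scale_ratio_def by (intro polytime_list_intros)

lemma polytime_int_rows: "polytime int_dists" "polytime int_laws"
  unfolding int_dists_def[abs_def] int_laws_def[abs_def]
  by (intro polytime_list_intros polytime_input_comp polytime_scale_ratio polytime_denominator)+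

lemma polytime_cost_denominator: "polytime cost_denominator"
  unfolding cost_denominator_def[abs_def]
  by (intro polytime_list_intros polytime_input_comp polytime_denominator)

lemma polytime_int_costs: "polytime int_costs" "polytime int_budget"
  unfolding int_costs_def[abs_def] int_budget_def[abs_def]
  by (intro polytime_list_intros polytime_input_comp polytime_scale_ratio
      polytime_comp[OF polytime_cost_denominator])+

lemma polytime_dot_pair: "polytime (\<lambda>z. dot (fst z) (snd z))"
  unfolding dot_def by (intro polytime_list_intros)

lemmas polytime_dot = polytime_comp2[of dot, OF polytime_dot_pair]

lemma polytime_expected_rows: "polytime expected_rows"
  unfolding expected_rows_def[abs_def]
  by (intro polytime_list_intros polytime_int_rows[THEN polytime_comp] polytime_dot)

lemmas polytime_rows = polytime_input_comp polytime_int_rows[THEN polytime_comp]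
  polytime_int_costs[THEN polytime_comp] polytime_expected_rows[THEN polytime_comp]

lemma polytime_start: "polytime f \<Longrightarrow> polytime (\<lambda>x. start (f x))"
  unfolding start_def by (intro polytime_list_intros polytime_rows)

lemma polytime_outlier_clients_pair: "polytime (\<lambda>z. outlier_clients (fst z) (snd z))"
  unfolding outlier_clients_def by (intro polytime_list_intros polytime_rows)

lemmas polytime_outlier_clients =
  polytime_comp2[of outlier_clients, OF polytime_outlier_clients_pair]

lemma polytime_outlier_centers:
  "polytime f \<Longrightarrow> polytime g \<Longrightarrow> polytime (\<lambda>x. outlier_centers (f x) (g x))"
  unfolding outlier_centers_def
  by (intro polytime_local_search polytime_outlier_clients polytime_start polytime_rows)

lemma polytime_outliers_pair: "polytime (\<lambda>z. outliers (fst z) (snd z))"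
  unfolding outliers_def by (intro polytime_list_intros polytime_client_cost)

lemmas polytime_outliers = polytime_comp2[of outliers, OF polytime_outliers_pair]

lemma polytime_int_total_cost_pair: "polytime (\<lambda>z. int_total_cost (fst z) (snd z))"
  unfolding int_total_cost_def by (intro polytime_list_intros polytime_rows)

lemmas polytime_int_total_cost =
  polytime_comp2[of int_total_cost, OF polytime_int_total_cost_pair]

lemma polytime_total_rows: "polytime total_rows"
  unfolding total_rows_def[abs_def] by (intro polytime_list_intros polytime_rows)

lemma polytime_penalty_factors: "polytime penalty_factors"
  unfolding penalty_factors_def[abs_def]
  by (intro polytime_list_intros polytime_comp[OF polytime_bitlist]
      polytime_comp[OF polytime_total_rows])

lemma polytime_outlier_fun: "polytime outlier_fun"
  unfolding outlier_fun_def[abs_def] outlier_candidate_def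
  by (intro polytime_list_intros polytime_rows polytime_best polytime_cost polytime_outlier_clients
      polytime_outlier_centers polytime_outliers polytime_int_total_cost
      polytime_comp[OF polytime_total_rows] polytime_comp[OF polytime_penalty_factors])

lemma polytime_posterior_clients_pair: "polytime (\<lambda>z. posterior_clients (fst z) (snd z))"
  unfolding posterior_clients_def
  by (intro polytime_list_intros polytime_case_option polytime_rows polytime_denominator)

lemmas polytime_posterior_clients =
  polytime_comp2[of posterior_clients, OF polytime_posterior_clients_pair]

lemma polytime_posterior_fun: "polytime (posterior_fun p m)"
  unfolding posterior_fun_def[abs_def] posterior_centers_def
  by (intro polytime_list_intros polytime_rows polytime_best polytime_posterior_clients
      polytime_start polytime_local_search)

section \<open>Encodings and programs\<close>

definition ratio_of :: "real \<Rightarrow> ratio" where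
  "ratio_of x = quotient_of (the_inv real_of_rat x)"

lemma ratio_of:
  assumes "x \<in> \<rat>"
  shows "0 < snd (ratio_of x)" "x = of_int (fst (ratio_of x)) / of_int (snd (ratio_of x))"
proof -
  obtain r where r: "x = of_rat r" using assms by (auto simp: Rats_def)
  have "inj real_of_rat" by (auto intro: injI)
  then have "the_inv real_of_rat x = r" unfolding r by (rule the_inv_f_f)
  then have q: "quotient_of r = (fst (ratio_of x), snd (ratio_of x))"
    by (simp add: ratio_of_def)
  show "0 < snd (ratio_of x)" using quotient_of_denom_pos[OF q] .
  show "x = of_int (fst (ratio_of x)) / of_int (snd (ratio_of x))"
    using arg_cong[OF quotient_of_div[OF q], of real_of_rat] r by (simp add: of_rat_divide)
qed

lemma enc_ratio_of: "enc (ratio_of x) = enc_rat x"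
  by (cases "quotient_of (the_inv real_of_rat x)") (simp add: enc_rat_def ratio_of_def)

definition input_of :: "nat kmedian \<Rightarrow> input" where
  "input_of I =
     (card (points I),
      map (\<lambda>x. map (\<lambda>y. ratio_of (dist_of I x y)) [0..<card (points I)]) [0..<card (points I)],
      num_nodes I,
      map (\<lambda>i. map (\<lambda>x. ratio_of (pmf (law I i) x)) [0..<card (points I)]) [0..<num_nodes I],
      map (\<lambda>i. ratio_of (probe_cost I i)) [0..<num_nodes I],
      ratio_of (budget I), num_centers I, sorted_list_of_set (allowed_centers I), 0)"

lemma enc_input_of: "enc (input_of I) = enc_instance I"
  by (simp add: input_of_def enc_instance_def enc_list_def enc_ratio_of o_def Let_def enc_nat_eq enc_nat_def)

definition locations :: "nat kmedian \<Rightarrow> nat set \<Rightarrow> (nat \<Rightarrow> nat) \<Rightarrow> nat option list" where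
  "locations I S v = map (\<lambda>i. if i \<in> S then Some (v i) else None) [0..<num_nodes I]"

lemma enc_locations: "enc (input_of I, locations I S v) = enc_posterior I S v"
  by (simp add: enc_input_of enc_posterior_def locations_def enc_list_def o_def if_distrib enc_nat_def
      cong: if_cong)

text \<open>\<open>computes_in\<close> starts at function 0, so the entry \<open>e\<close> is put
  there and the remaining code is relocated by \<open>n = 1\<close>.\<close>

lemma polytime_program:
  fixes f :: "'a :: enc \<Rightarrow> 'b :: enc"
  assumes "polytime f"
  shows "\<exists>P. (\<forall>x. result P (enc x) = enc (f x)) \<and> polynomial_time_on (range (enc :: 'a \<Rightarrow> val)) P"
proof -
  obtain Q e q where *: "\<And>P R x. length P = 1 \<Longrightarrow>
     ev (P @ Q @ R) [enc x] e (enc (f x)) (poly q (size_of x))"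
    using assms unfolding polytime_def by metis
  let ?P = "[e] @ Q @ []"
  let ?q = "q + q + [:4, 1:]"
  have "\<exists>t\<le>poly ?q (size_of x). computes_in ?P (enc x) (enc (f x)) t" for x
  proof -
    have e: "ev ?P [enc x] e (enc (f x)) (poly q (size_of x))" by (rule *) simp
    then have "ev ?P [enc x] (Call 0 [Var 0]) (enc (f x))
      (1 + bits (enc (f x)) + (1 + (1 + bits (enc x)) + 1) + poly q (size_of x))"
      by (intro ev_Call[OF evs_Cons[OF ev_Vars(1) evs_Nil]]) auto
    then have "ev ?P [enc x] (Call 0 [Var 0]) (enc (f x)) (poly ?q (size_of x))"
      by (rule ev_mono) (use ev_bits[OF e] in \<open>simp add: size_of_def\<close>)
    then show ?thesis unfolding ev_def computes_in_def by blast
  qed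
  then have c: "\<exists>t. computes_in ?P (enc x) (enc (f x)) t \<and> t \<le> poly ?q (bits (enc x))" for x
    unfolding size_of_def by blast
  then have "\<forall>x. result ?P (enc x) = enc (f x)" using result_eq by blast
  moreover have "polynomial_time_on (range (enc :: 'a \<Rightarrow> val)) ?P"
    unfolding polynomial_time_on_def using c by (intro exI[of _ ?q]) blast
  ultimately show ?thesis by blast
qed

section \<open>Scaled integer data of a rational instance\<close>

lemma denominator_pos: "(\<And>r. r \<in> set rs \<Longrightarrow> 0 < snd r) \<Longrightarrow> 0 < denominator rs"
  unfolding denominator_def by (induction rs) auto

lemma dvd_denominator: "r \<in> set rs \<Longrightarrow> snd r dvd denominator rs"
  unfolding denominator_def by (induction rs) auto

lemma scale_ratio_ratio_of:
  fixes x :: real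
  assumes "x \<in> \<rat>" "ratio_of x \<in> set rs"
  shows "real_of_int (scale_ratio (denominator rs) (ratio_of x)) = denominator rs * x"
proof -
  obtain k where k: "denominator rs = snd (ratio_of x) * k"
    using dvd_denominator[OF assms(2)] by (auto elim: dvdE)
  then have "scale_ratio (denominator rs) (ratio_of x) = fst (ratio_of x) * k"
    using ratio_of(1)[OF assms(1)] by (simp add: scale_ratio_def)
  then show ?thesis
    using ratio_of[OF assms(1)] k by (simp add: field_simps)
qed

lemma sum_list_map_upt: "sum_list (map f [0..<n]) = sum f {..<n}"
  by (simp add: interv_sum_list_conv_sum_set_nat atLeast0LessThan)

lemma set_penalty_factors:
  "set (penalty_factors t) = {2 ^ k | k. k \<le> floorlog 2 (nat (4 * total_rows t))}"
proof -
  define L where "L = floorlog 2 (nat (4 * total_rows t))"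
  have "penalty_factors t = map (\<lambda>k. 2 ^ k) [0..<Suc L]"
    unfolding penalty_factors_def bitlist_def L_def[symmetric] by (rule map_cong) auto
  then show ?thesis unfolding L_def[symmetric] by (auto simp: less_Suc_eq_le simp del: upt_Suc)
qed

locale rational_kmedian = kmedian_instance I for I :: "nat kmedian" +
  assumes rational: "rational_instance I"
begin

abbreviation "m \<equiv> card (points I)"
abbreviation "n \<equiv> num_nodes I"
abbreviation "t \<equiv> input_of I"

lemma points_eq: "points I = {..<m}"
  using rational by (auto simp: rational_instance_def)

lemma rats:
  "x \<in> points I \<Longrightarrow> y \<in> points I \<Longrightarrow> dist_of I x y \<in> \<rat>"
  "i < n \<Longrightarrow> x \<in> points I \<Longrightarrow> pmf (law I i) x \<in> \<rat>"
  "i < n \<Longrightarrow> probe_cost I i \<in> \<rat>"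
  "budget I \<in> \<rat>"
  using rational by (auto simp: rational_instance_def)

lemma point_iff: "x \<in> points I \<longleftrightarrow> x < m"
  using points_eq by auto

lemma in_simps:
  "in_dists t = map (\<lambda>x. map (\<lambda>y. ratio_of (dist_of I x y)) [0..<m]) [0..<m]"
  "in_laws t = map (\<lambda>i. map (\<lambda>x. ratio_of (pmf (law I i) x)) [0..<m]) [0..<n]"
  "in_costs t = map (\<lambda>i. ratio_of (probe_cost I i)) [0..<n]"
  "in_budget t = ratio_of (budget I)"
  "in_num_centers t = num_centers I"
  "in_centers t = sorted_list_of_set (allowed_centers I)"
  by (simp_all add: input_of_def input_defs)

definition dist_den :: int where "dist_den = denominator (concat (in_dists t))"
definition law_den :: int where "law_den = denominator (concat (in_laws t))"
definition cost_den :: int where "cost_den = cost_denominator t"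

lemma den_pos: "0 < dist_den" "0 < law_den" "0 < cost_den"
proof -
  have "0 < snd r" if "r \<in> set (concat (in_dists t))" for r
  proof -
    have "\<exists>x y. x \<in> points I \<and> y \<in> points I \<and> r = ratio_of (dist_of I x y)"
      using that by (auto simp: in_simps point_iff) blast
    then show ?thesis using ratio_of(1) rats(1) by blast
  qed
  then show "0 < dist_den" unfolding dist_den_def by (rule denominator_pos)
  have "0 < snd r" if "r \<in> set (concat (in_laws t))" for r
  proof -
    have "\<exists>i x. i < n \<and> x \<in> points I \<and> r = ratio_of (pmf (law I i) x)"
      using that by (auto simp: in_simps point_iff) blast
    then show ?thesis using ratio_of(1) rats(2) by blast
  qed
  then show "0 < law_den" unfolding law_den_def by (rule denominator_pos)
  have "0 < snd r" if "r \<in> set (in_budget t # in_costs t)" for r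
  proof -
    have "r = ratio_of (budget I) \<or> (\<exists>i<n. r = ratio_of (probe_cost I i))"
      using that by (auto simp: in_simps)
    then show ?thesis using ratio_of(1) rats(3,4) by blast
  qed
  then show "0 < cost_den" unfolding cost_den_def cost_denominator_def by (rule denominator_pos)
qed

lemma int_dists:
  "length (int_dists t) = m"
  "x < m \<Longrightarrow> length (int_dists t ! x) = m"
  "x < m \<Longrightarrow> y < m \<Longrightarrow> real_of_int (int_dists t ! x ! y) = dist_den * dist_of I x y"
proof -
  show "length (int_dists t) = m" "x < m \<Longrightarrow> length (int_dists t ! x) = m"
    by (simp_all add: int_dists_def in_simps)
  assume "x < m" "y < m"
  then show "real_of_int (int_dists t ! x ! y) = dist_den * dist_of I x y"
    unfolding dist_den_def
    by (subst scale_ratio_ratio_of[symmetric])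
       (auto simp: int_dists_def in_simps rats point_iff intro!: bexI[of _ x])
qed

lemma int_laws:
  "length (int_laws t) = n"
  "i < n \<Longrightarrow> length (int_laws t ! i) = m"
  "i < n \<Longrightarrow> x < m \<Longrightarrow> real_of_int (int_laws t ! i ! x) = law_den * pmf (law I i) x"
proof -
  show "length (int_laws t) = n" "i < n \<Longrightarrow> length (int_laws t ! i) = m"
    by (simp_all add: int_laws_def in_simps)
  assume "i < n" "x < m"
  then show "real_of_int (int_laws t ! i ! x) = law_den * pmf (law I i) x"
    unfolding law_den_def
    by (subst scale_ratio_ratio_of[symmetric])
       (auto simp: int_laws_def in_simps rats point_iff intro!: bexI[of _ i])
qed

lemma int_costs:
  "i < n \<Longrightarrow> real_of_int (nth_default 0 (int_costs t) i) = cost_den * probe_cost I i"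
  "real_of_int (int_budget t) = cost_den * budget I"
proof -
  assume i: "i < n"
  have "nth_default 0 (int_costs t) i = scale_ratio cost_den (ratio_of (probe_cost I i))"
    using i by (simp add: int_costs_def in_simps cost_den_def nth_default_def)
  also have "real_of_int \<dots> = cost_den * probe_cost I i"
    unfolding cost_den_def cost_denominator_def
    by (rule scale_ratio_ratio_of) (use i rats in \<open>auto simp: in_simps\<close>)
  finally show "real_of_int (nth_default 0 (int_costs t) i) = cost_den * probe_cost I i" .
next
  show "real_of_int (int_budget t) = cost_den * budget I"
    unfolding int_budget_def cost_den_def cost_denominator_def in_simps
    by (rule scale_ratio_ratio_of) (use rats in auto)
qed

lemma expected_dist_sum:
  assumes "i < n"
  shows "expected_dist I i w = (\<Sum>x<m. dist_of I x w * pmf (law I i) x)"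
  unfolding expected_dist_def
proof (rule integral_measure_pmf_real)
  show "a \<in> {..<m}" if "a \<in> set_pmf (law I i)" for a
    using law_subset[of i] assms that point_iff by auto
qed simp

lemma expected_rows:
  "length (expected_rows t) = n"
  "i < n \<Longrightarrow> length (expected_rows t ! i) = m"
  "i < n \<Longrightarrow> w < m \<Longrightarrow>
    real_of_int (expected_rows t ! i ! w) = law_den * dist_den * expected_dist I i w"
proof -
  show "length (expected_rows t) = n" "i < n \<Longrightarrow> length (expected_rows t ! i) = m"
    by (simp_all add: expected_rows_def int_laws int_dists)
  assume i: "i < n" and w: "w < m"
  have "expected_rows t ! i ! w = dot (int_laws t ! i) (int_dists t ! w)"
    using i w by (simp add: expected_rows_def int_laws int_dists)
  also have "\<dots> = (\<Sum>x<m. int_laws t ! i ! x * int_dists t ! w ! x)"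
    using i w by (simp add: dot_def sum_list_map_upt int_laws int_dists nth_default_def)
  \<comment> \<open>Symmetry enters here: the row of \<open>w\<close> contains distances from
    \<open>w\<close>, whereas \<open>expected_dist\<close> measures distances to
    \<open>w\<close>.\<close>
  also have "real_of_int \<dots> = (\<Sum>x<m. law_den * dist_den * (dist_of I x w * pmf (law I i) x))"
    using i w commute[of w] by (simp add: int_laws int_dists mult_ac)
  also have "\<dots> = law_den * dist_den * expected_dist I i w"
    using i by (simp add: expected_dist_sum sum_distrib_left)
  finally show "real_of_int (expected_rows t ! i ! w) = law_den * dist_den * expected_dist I i w" .
qed

lemma expected_rows_nonneg:
  assumes "i < n" "w < m"
  shows "0 \<le> expected_rows t ! i ! w"
proof -
  have "0 \<le> law_den * dist_den * expected_dist I i w"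
    using den_pos expected_dist_nonneg by (intro mult_nonneg_nonneg) auto
  then show ?thesis using expected_rows(3)[OF assms] by linarith
qed

lemma start_center_set: "center_set (in_centers t) (num_centers I) (start t)"
  using finite_centers centers_enough set_take_subset
  by (force simp: center_set_def start_def in_simps)

lemma center_set_choice:
  assumes "center_set (in_centers t) (num_centers I) F"
  shows "set F \<in> center_choices I"
  using assms finite_centers by (auto simp: center_set_def center_choices_def in_simps distinct_card)

lemma local_search_instance:
  assumes S: "S \<subseteq> nodes I" and v: "\<And>i. i \<in> S \<Longrightarrow> v i \<in> points I"
    and len: "length cls = n" and \<kappa>: "0 \<le> \<kappa>"
    and cd: "\<And>i w. i < n \<Longrightarrow> w \<in> points I \<Longrightarrow> center_dist cls i w = \<kappa> * node_dist I S v i w"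
    and pen: "\<And>i. i < n \<Longrightarrow> 0 \<le> penalty cls i"
    and T: "T \<subseteq> nodes I" and s: "s \<in> solutions I (nodes I - T)" and p: "0 < p" and M: "0 < M"
  shows "center_set (in_centers t) (num_centers I) (local_search p M (in_centers t) cls (start t))"
    and "of_int (cost cls (local_search p M (in_centers t) cls (start t)))
      \<le> (3 + 2 / real p) * (\<kappa> * (\<Sum>i\<in>nodes I - T. node_dist I S v i (snd s i)))
        + (1 + 1 / real p) * sum (penalty cls) T + 1 / of_int M" (is "_ \<le> ?B")
proof -
  obtain F \<sigma> where s_eq: "s = (F, \<sigma>)" by (cases s)
  then have F: "F \<in> center_choices I" and \<sigma>: "\<sigma> \<in> (nodes I - T) \<rightarrow>\<^sub>E F"
    using s solutions_iff by auto
  obtain f where f: "f \<in> F" using center_choicesD(2)[OF F] by blast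
  \<comment> \<open>\<open>s\<close> assigns no center to the nodes of \<open>T\<close>. Any center
    will do for them, since their connection cost does not occur in the bound.\<close>
  define \<tau> where "\<tau> j = (if j \<in> T then f else \<sigma> j)" for j
  have facs: "set (in_centers t) = allowed_centers I"
    using finite_centers by (simp add: in_simps)
  have pts: "w \<in> points I" if "w \<in> set (in_centers t)" for w
    using that facs centers_subset by blast
  note ls = local_search_guarantee[OF start_center_set centers_pos,
      where d = "\<lambda>x w. \<kappa> * dist_of I x w" and Z = F and \<tau> = \<tau> and T = T and cls = cls]
  have tri: "node_dist I S v j w \<le> node_dist I S v j x + dist_of I x w"
      "dist_of I x w \<le> node_dist I S v j x + node_dist I S v j w"
    if "j < n" "w \<in> set (in_centers t)" "x \<in> set (in_centers t)" for j x w
    using node_dist_triangle[of j S v w x] node_dist_opposite[of j S v w x] that pts v by auto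
  have c1: "center_dist cls j w \<le> center_dist cls j x + \<kappa> * dist_of I x w"
    if "j < length cls" "w \<in> set (in_centers t)" "x \<in> set (in_centers t)" for j x w
    using mult_left_mono[OF tri(1) \<kappa>, of j w x] that cd pts len by (simp add: distrib_left)
  have c2: "\<kappa> * dist_of I x w \<le> center_dist cls j x + center_dist cls j w"
    if "j < length cls" "w \<in> set (in_centers t)" "x \<in> set (in_centers t)" for j x w
    using mult_left_mono[OF tri(2) \<kappa>, of j w x] that cd pts len by (simp add: distrib_left)
  have c3: "0 \<le> center_dist cls j w" if "j < length cls" "w \<in> set (in_centers t)" for j w
    using that cd pts len \<kappa> node_dist_nonneg by simp
  have c4: "\<tau> j \<in> F" if "j < length cls" for j
    using that \<sigma> f len by (auto simp: \<tau>_def PiE_def Pi_def)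
  have c5: "F \<subseteq> set (in_centers t)" "card F = num_centers I"
    using center_choicesD[OF F] facs by auto
  have c6: "T \<subseteq> {..<length cls}" using T len by simp
  show "center_set (in_centers t) (num_centers I) (local_search p M (in_centers t) cls (start t))"
    by (rule ls(1)[OF c1 c2 c3 _ c5 c4 c6 p M]) (use pen len in auto)
  have "of_int (cost cls (local_search p M (in_centers t) cls (start t)))
      \<le> (3 + 2 / real p) * (\<Sum>j\<in>{..<length cls} - T. center_dist cls j (\<tau> j))
        + (1 + 1 / real p) * sum (penalty cls) T + 1 / of_int M"
    by (rule ls(2)[OF c1 c2 c3 _ c5 c4 c6 p M]) (use pen len in auto)
  also have "(\<Sum>j\<in>{..<length cls} - T. center_dist cls j (\<tau> j))
    = \<kappa> * (\<Sum>i\<in>nodes I - T. node_dist I S v i (snd s i))"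
    unfolding sum_distrib_left len
  proof (rule sum.cong[OF refl])
    fix i assume i: "i \<in> nodes I - T"
    then show "center_dist cls i (\<tau> i) = \<kappa> * node_dist I S v i (snd s i)"
      using cd[of i "\<sigma> i"] solution_point[OF s i] by (simp add: \<tau>_def s_eq)
  qed
  finally show "of_int (cost cls (local_search p M (in_centers t) cls (start t)))
      \<le> ?B" .
qed

section \<open>Correctness of the outlier algorithm\<close>

lemma outlier_clients:
  "length (outlier_clients t \<mu>) = n"
  "i < n \<Longrightarrow> penalty (outlier_clients t \<mu>) i = \<mu> * nth_default 0 (int_costs t) i"
  "i < n \<Longrightarrow> w < m \<Longrightarrow>
    center_dist (outlier_clients t \<mu>) i w = 2 * int_budget t * (expected_rows t ! i ! w)"
  by (simp_all add: outlier_clients_def expected_rows penalty_def center_dist_def nth_default_def)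

lemma int_costs_nonneg:
  assumes "i < n" shows "0 \<le> nth_default 0 (int_costs t) i"
proof -
  have "0 \<le> cost_den * probe_cost I i" using den_pos cost_nonneg assms by simp
  then show ?thesis using int_costs(1)[OF assms] by linarith
qed

lemma int_budget_nonneg: "0 \<le> int_budget t"
proof -
  have "0 \<le> cost_den * budget I" using den_pos budget_nonneg by simp
  then show ?thesis using int_costs(2) by linarith
qed

lemma int_total_cost:
  assumes "distinct T" "set T \<subseteq> nodes I"
  shows "real_of_int (int_total_cost t T) = cost_den * total_cost I (set T)"
proof -
  have "int_total_cost t T = (\<Sum>i\<in>set T. nth_default 0 (int_costs t) i)"
    unfolding int_total_cost_def using assms by (simp add: sum_list_distinct_conv_sum_set)
  also have "real_of_int \<dots> = (\<Sum>i\<in>set T. cost_den * probe_cost I i)"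
    unfolding of_int_sum using assms int_costs by (intro sum.cong) auto
  finally show ?thesis by (simp add: total_cost_def sum_distrib_left)
qed

text \<open>Outliers pay exactly their penalty, so the local search cost is the value of the
  candidate plus \<open>\<mu>\<close> times the cost of its outliers. A competitor \<open>Z\<close>
  within the budget pays penalties of at most \<open>\<mu> * int_budget t\<close>.\<close>

lemma outlier_candidate:
  assumes \<mu>: "0 \<le> \<mu>"
  defines "T \<equiv> snd (outlier_candidate t \<mu>)"
  shows "distinct T" "set T \<subseteq> nodes I" "int_budget t = 0 \<Longrightarrow> set T = nodes I"
    and "\<exists>s\<in>solutions I (nodes I - set T). fst (outlier_candidate t \<mu>)
      = 2 * int_budget t * (\<Sum>i\<in>nodes I - set T. expected_rows t ! i ! snd s i)"
    and "Z \<subseteq> nodes I \<Longrightarrow> total_cost I Z \<le> budget I \<Longrightarrow> s \<in> solutions I (nodes I - Z) \<Longrightarrow>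
      real_of_int (fst (outlier_candidate t \<mu>)) + \<mu> * int_total_cost t T
      \<le> 31 / 10 * (2 * int_budget t * (\<Sum>i\<in>nodes I - Z. expected_rows t ! i ! snd s i))
        + 21 / 20 * (\<mu> * int_budget t) + 1 / 100"
proof -
  let ?cls = "outlier_clients t \<mu>"
  let ?F = "outlier_centers t \<mu>"
  let ?C = "conn (penalty ?cls) (center_dist ?cls) (set ?F)"
  define \<kappa> where "\<kappa> = 2 * real_of_int (int_budget t) * (law_den * dist_den)"
  have \<kappa>: "0 \<le> \<kappa>" using int_budget_nonneg den_pos by (simp add: \<kappa>_def)
  have cd: "center_dist ?cls i w = \<kappa> * node_dist I {} undefined i w" if "i < n" "w \<in> points I" for i w
    using that by (simp add: outlier_clients expected_rows point_iff \<kappa>_def node_dist_def)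
  have pen: "0 \<le> penalty ?cls i" if "i < n" for i
    using that \<mu> int_costs_nonneg by (simp add: outlier_clients)
  have T_def': "T = outliers ?cls ?F" by (simp add: T_def outlier_candidate_def)
  have T_iff: "i \<in> set T \<longleftrightarrow> i < n \<and> \<not> ?C i < penalty ?cls i" for i
    using client_cost_conn[of ?F ?cls i]
    by (auto simp: T_def' outliers_def outlier_clients(1) nth_default_def penalty_def)
  show T: "distinct T" "set T \<subseteq> nodes I"
    by (simp add: T_def' outliers_def) (auto simp: T_iff)
  have ls: "center_set (in_centers t) (num_centers I) ?F
    \<and> of_int (cost ?cls ?F)
      \<le> (3 + 2 / real 20) * (\<kappa> * (\<Sum>i\<in>nodes I - Z. node_dist I {} undefined i (snd s i)))
        + (1 + 1 / real 20) * sum (penalty ?cls) Z + 1 / of_int 100"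
    if "Z \<subseteq> nodes I" "s \<in> solutions I (nodes I - Z)" for Z s
    unfolding outlier_centers_def
    using local_search_instance[of "{}" undefined ?cls \<kappa> Z s 20 100] that \<kappa> cd pen outlier_clients(1)
    by simp
  obtain s0 where "s0 \<in> solutions I (nodes I - {})" using solutions_nonempty by blast
  then have F: "set ?F \<in> center_choices I" using ls[of "{}" s0] center_set_choice by simp
  have c0: "0 \<le> ?C i" if "i < n" for i
    using pen cd \<kappa> node_dist_nonneg that center_choicesD(3)[OF F]
    by (intro conn_nonneg) (auto simp: subset_iff)
  show "int_budget t = 0 \<Longrightarrow> set T = nodes I"
  proof -
    \<comment> \<open>No probe costs more than the budget, so all penalties vanish and every node
      ties.\<close>
    assume 0: "int_budget t = 0"
    have "penalty ?cls i = 0" if i: "i < n" for i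
    proof -
      have "cost_den * probe_cost I i \<le> cost_den * budget I"
        using cost_le i den_pos by simp
      then have "nth_default 0 (int_costs t) i \<le> 0"
        using int_costs(1)[OF i] int_costs(2) 0 by linarith
      then show ?thesis using int_costs_nonneg[OF i] i by (simp add: outlier_clients)
    qed
    then show "set T = nodes I" using T_iff c0 by fastforce
  qed
  have split: "sum ?C {..<n} = sum ?C (nodes I - set T) + \<mu> * int_total_cost t T"
  proof -
    have "sum ?C (set T) = (\<Sum>i\<in>set T. penalty ?cls i)"
    proof (rule sum.cong[OF refl])
      fix i assume "i \<in> set T"
      then show "?C i = penalty ?cls i"
        using T_iff conn_le_pen[of "set ?F" "penalty ?cls" "center_dist ?cls" i] by simp
    qed
    also have "\<dots> = (\<Sum>i\<in>set T. real_of_int (\<mu> * nth_default 0 (int_costs t) i))"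
      using T(2) by (intro sum.cong) (auto simp: outlier_clients)
    also have "\<dots> = \<mu> * int_total_cost t T"
      using T(1) by (simp add: int_total_cost_def sum_list_distinct_conv_sum_set sum_distrib_left)
    finally show ?thesis
      using sum.subset_diff[OF T(2), of ?C] by simp
  qed
  have fst_eq: "real_of_int (fst (outlier_candidate t \<mu>)) + \<mu> * int_total_cost t T = cost ?cls ?F"
    by (simp add: outlier_candidate_def T_def')
  have "cost ?cls ?F = sum ?C {..<n}" by (simp add: cost_conn outlier_clients(1))
  then have val: "real_of_int (fst (outlier_candidate t \<mu>)) = sum ?C (nodes I - set T)"
    using fst_eq split by linarith
  have "\<exists>w. w \<in> set ?F \<and> ?C i = center_dist ?cls i w" if "i \<in> nodes I - set T" for i
    using that T_iff[of i] conn_cases[of "set ?F" "penalty ?cls" "center_dist ?cls" i] by auto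
  then obtain \<sigma> where \<sigma>: "\<And>i. i \<in> nodes I - set T \<Longrightarrow> \<sigma> i \<in> set ?F \<and> ?C i = center_dist ?cls i (\<sigma> i)"
    by metis
  let ?s = "(set ?F, restrict \<sigma> (nodes I - set T))"
  have s: "?s \<in> solutions I (nodes I - set T)" using F \<sigma> by (simp add: solutions_iff)
  have "real_of_int (fst (outlier_candidate t \<mu>))
    = (\<Sum>i\<in>nodes I - set T. real_of_int (2 * int_budget t * (expected_rows t ! i ! snd ?s i)))"
    unfolding val
  proof (rule sum.cong[OF refl])
    fix i assume i: "i \<in> nodes I - set T"
    then have "\<sigma> i < m" using \<sigma> center_choicesD(3)[OF F] point_iff by blast
    then show "?C i = real_of_int (2 * int_budget t * (expected_rows t ! i ! snd ?s i))"
      using \<sigma>[OF i] i by (simp add: outlier_clients)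
  qed
  then have "real_of_int (fst (outlier_candidate t \<mu>))
    = real_of_int (2 * int_budget t * (\<Sum>i\<in>nodes I - set T. expected_rows t ! i ! snd ?s i))"
    by (simp add: sum_distrib_left)
  then have "fst (outlier_candidate t \<mu>)
    = 2 * int_budget t * (\<Sum>i\<in>nodes I - set T. expected_rows t ! i ! snd ?s i)"
    by (simp only: of_int_eq_iff)
  then show "\<exists>s\<in>solutions I (nodes I - set T). fst (outlier_candidate t \<mu>)
      = 2 * int_budget t * (\<Sum>i\<in>nodes I - set T. expected_rows t ! i ! snd s i)"
    using s by blast
  assume Z: "Z \<subseteq> nodes I" "total_cost I Z \<le> budget I" and sZ: "s \<in> solutions I (nodes I - Z)"
  have "sum (penalty ?cls) Z = (\<Sum>i\<in>Z. \<mu> * (cost_den * probe_cost I i))"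
    using Z(1) by (intro sum.cong) (auto simp: outlier_clients int_costs)
  also have "\<dots> = \<mu> * (cost_den * total_cost I Z)"
    by (simp add: total_cost_def sum_distrib_left)
  also have "\<dots> \<le> \<mu> * int_budget t"
    using Z(2) den_pos \<mu> by (simp add: int_costs mult_left_mono)
  finally have penZ: "sum (penalty ?cls) Z \<le> \<mu> * int_budget t" by simp
  have "\<kappa> * (\<Sum>i\<in>nodes I - Z. node_dist I {} undefined i (snd s i))
    = (\<Sum>i\<in>nodes I - Z. real_of_int (2 * int_budget t * (expected_rows t ! i ! snd s i)))"
    unfolding sum_distrib_left
  proof (rule sum.cong[OF refl])
    fix i assume i: "i \<in> nodes I - Z"
    then have "snd s i < m" using solution_point[OF sZ i] point_iff by blast
    then show "\<kappa> * node_dist I {} undefined i (snd s i)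
      = real_of_int (2 * int_budget t * (expected_rows t ! i ! snd s i))"
      using i by (simp add: expected_rows \<kappa>_def node_dist_def)
  qed
  then have "\<kappa> * (\<Sum>i\<in>nodes I - Z. node_dist I {} undefined i (snd s i))
    = 2 * int_budget t * (\<Sum>i\<in>nodes I - Z. expected_rows t ! i ! snd s i)"
    by (simp add: sum_distrib_left)
  then show "real_of_int (fst (outlier_candidate t \<mu>)) + \<mu> * int_total_cost t T
      \<le> 31 / 10 * (2 * int_budget t * (\<Sum>i\<in>nodes I - Z. expected_rows t ! i ! snd s i))
        + 21 / 20 * (\<mu> * int_budget t) + 1 / 100"
    using ls[OF Z(1) sZ] penZ unfolding fst_eq by simp
qed

end

lemma member_le_sum_list_int:
  "(\<And>y. y \<in> set xs \<Longrightarrow> 0 \<le> y) \<Longrightarrow> x \<in> set xs \<Longrightarrow> x \<le> sum_list xs" for x :: int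
proof (induction xs)
  case (Cons y xs)
  have "0 \<le> sum_list xs" using Cons.prems(1) by (intro sum_list_nonneg) simp
  moreover have "0 \<le> y" using Cons.prems(1) by simp
  moreover have "x = y \<or> x \<le> sum_list xs" using Cons by auto
  ultimately show ?case unfolding sum_list.Cons by linarith
qed simp

lemma dec_set_enc: "dec_set (enc xs) = set (xs :: nat list)"
  by (induction xs) (auto simp: dec_nat_def)

lemma cdr_enc: "i < length xs \<Longrightarrow> dec_nat (car ((cdr ^^ i) (enc (xs :: nat list)))) = xs ! i"
proof (induction xs arbitrary: i)
  case (Cons x xs)
  then show ?case by (cases i) (auto simp: dec_nat_def funpow_Suc_right simp del: funpow.simps(2))
qed simp

lemma power2_between:
  assumes "0 < (x :: int)"
  shows "\<exists>k. 2 ^ k \<le> x \<and> x < 2 ^ Suc k \<and> Suc k = floorlog 2 (nat x)"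
proof -
  have b: "2 ^ (floorlog 2 (nat x) - 1) \<le> nat x" "nat x < 2 ^ floorlog 2 (nat x)"
    using floorlog_bounds[of "nat x" 2] assms by auto
  have "floorlog 2 (nat x) = Suc (floorlog 2 (nat x) - 1)"
    using assms by (simp add: compute_floorlog[of 2 "nat x"])
  moreover have "2 ^ (floorlog 2 (nat x) - 1) \<le> x"
    using b(1) assms by (metis nat_le_iff of_nat_numeral of_nat_power le_nat_iff less_imp_le)
  moreover have "x < 2 ^ floorlog 2 (nat x)"
    using b(2) assms by (simp add: nat_less_iff)
  ultimately show ?thesis by metis
qed

context rational_kmedian
begin

lemma sum_rows:
  assumes "A \<subseteq> nodes I" "s \<in> solutions I A"
  shows "real_of_int (\<Sum>i\<in>A. expected_rows t ! i ! snd s i)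
    = law_den * dist_den * (\<Sum>i\<in>A. expected_dist I i (snd s i))"
  unfolding of_int_sum sum_distrib_left
proof (rule sum.cong[OF refl])
  fix i assume i: "i \<in> A"
  then have "snd s i < m" using solution_point[OF assms(2) i] point_iff by blast
  then show "real_of_int (expected_rows t ! i ! snd s i)
    = real_of_int (law_den * dist_den) * expected_dist I i (snd s i)"
    using i assms(1) by (auto simp: expected_rows)
qed

lemma sum_rows_nonneg:
  assumes "A \<subseteq> nodes I" "s \<in> solutions I A"
  shows "0 \<le> (\<Sum>i\<in>A. expected_rows t ! i ! snd s i)"
  using assms expected_rows_nonneg solution_point[OF assms(2)]
  by (intro sum_nonneg) (auto simp: point_iff)

text \<open>A crude bound on all objectives; it limits the range of \<open>\<mu>\<close> and
  justifies the start value of the selection.\<close>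

lemma sum_rows_le_total:
  assumes "A \<subseteq> nodes I" "s \<in> solutions I A"
  shows "(\<Sum>i\<in>A. expected_rows t ! i ! snd s i) \<le> total_rows t"
proof -
  have row: "0 \<le> y" if "i < n" "y \<in> set (expected_rows t ! i)" for i y
    using that expected_rows_nonneg expected_rows(2) by (auto simp: in_set_conv_nth)
  have "(\<Sum>i\<in>A. expected_rows t ! i ! snd s i) \<le> (\<Sum>i\<in>A. sum_list (expected_rows t ! i))"
  proof (rule sum_mono)
    fix i assume i: "i \<in> A"
    then have "snd s i < m" using solution_point[OF assms(2) i] point_iff by blast
    then show "expected_rows t ! i ! snd s i \<le> sum_list (expected_rows t ! i)"
      using row i assms(1) expected_rows(2) by (intro member_le_sum_list_int) auto
  qed
  also have "\<dots> \<le> (\<Sum>i\<in>nodes I. sum_list (expected_rows t ! i))"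
    using assms(1) row by (intro sum_mono2) (auto intro!: sum_list_nonneg)
  also have "\<dots> = total_rows t"
    by (simp add: total_rows_def sum_list_sum_nth expected_rows(1) atLeast0LessThan)
  finally show ?thesis .
qed

lemma int_total_cost_nonneg: "set T \<subseteq> nodes I \<Longrightarrow> 0 \<le> int_total_cost t T"
  unfolding int_total_cost_def using int_costs_nonneg by (intro sum_list_nonneg) auto

text \<open>
  The factor \<open>\<mu>\<close> in the penalties \<open>\<mu> c\<^sub>i\<close> must lie between about \<open>0.8 G\<close> and \<open>1.6 G\<close>, where \<open>G\<close>
  is the optimum. For \<open>G = 0\<close> the smallest factor works, because all values are even multiples
  of the budget.
\<close>

lemma good_penalty_factor:
  assumes Z: "Z \<subseteq> nodes I" "total_cost I Z \<le> budget I" and s: "s \<in> solutions I (nodes I - Z)"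
  shows "\<exists>\<mu>\<in>set (penalty_factors t).
    int_total_cost t (snd (outlier_candidate t \<mu>)) \<le> 5 * int_budget t \<and>
    fst (outlier_candidate t \<mu>)
      \<le> 5 * (int_budget t * (2 * (\<Sum>i\<in>nodes I - Z. expected_rows t ! i ! snd s i)))"
proof -
  define g where "g = 2 * (\<Sum>i\<in>nodes I - Z. expected_rows t ! i ! snd s i)"
  define b where "b = int_budget t"
  define y where "y \<mu> = fst (outlier_candidate t \<mu>)" for \<mu>
  define w where "w \<mu> = int_total_cost t (snd (outlier_candidate t \<mu>))" for \<mu>
  have b0: "0 \<le> b" unfolding b_def by (rule int_budget_nonneg)
  have g0: "0 \<le> g" "g \<le> 2 * total_rows t"
    unfolding g_def using sum_rows_nonneg[OF _ s] sum_rows_le_total[OF _ s] by auto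
  have w0: "0 \<le> w \<mu>" if "0 \<le> \<mu>" for \<mu>
    unfolding w_def by (rule int_total_cost_nonneg[OF outlier_candidate(2)[OF that]])
  have y: "\<exists>k\<ge>0. y \<mu> = 2 * b * k" if \<mu>: "0 \<le> \<mu>" for \<mu>
  proof -
    obtain s' where s': "s' \<in> solutions I (nodes I - set (snd (outlier_candidate t \<mu>)))"
      "fst (outlier_candidate t \<mu>) = 2 * int_budget t *
         (\<Sum>i\<in>nodes I - set (snd (outlier_candidate t \<mu>)). expected_rows t ! i ! snd s' i)"
      using outlier_candidate(4)[OF \<mu>] by blast
    show ?thesis unfolding y_def b_def
      using s'(2) sum_rows_nonneg[OF Diff_subset s'(1)] by blast
  qed
  have y0: "0 \<le> y \<mu>" if "0 \<le> \<mu>" for \<mu> using y[OF that] b0 by (auto intro: mult_nonneg_nonneg)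
  have ls: "real_of_int (y \<mu>) + \<mu> * w \<mu> \<le> 31 / 10 * (real_of_int b * g) + 21 / 20 * (real_of_int \<mu> * b) + 1 / 100"
    if "0 \<le> \<mu>" for \<mu>
    using outlier_candidate(5)[OF that Z s] unfolding y_def w_def g_def b_def by (simp add: mult_ac)
  have one: "1 \<in> set (penalty_factors t)"
    unfolding set_penalty_factors by (auto intro!: exI[of _ 0])
  have "\<exists>\<mu>\<in>set (penalty_factors t). w \<mu> \<le> 5 * b \<and> y \<mu> \<le> 5 * (b * g)"
  proof (cases "g = 0 \<or> b = 0")
    case True
    then have bg: "b * g = 0" by auto
    then have "real_of_int b * real_of_int g = 0" by (metis of_int_mult of_int_0)
    moreover have "real_of_int (y 1) + w 1 \<le> 31 / 10 * (real_of_int b * g) + 21 / 20 * b + 1 / 100"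
      using ls[of 1] by simp
    ultimately have sum: "real_of_int (y 1) + w 1 \<le> 21 / 20 * b + 1 / 100" by linarith
    then have "real_of_int (w 1) < real_of_int (5 * b + 1)" using y0[of 1] b0 by simp
    then have "w 1 \<le> 5 * b" by linarith
    moreover have "y 1 \<le> 0"
    proof -
      obtain k where k: "0 \<le> k" "y 1 = 2 * b * k" using y[of 1] by auto
      show ?thesis
      proof (cases "b = 0")
        case False
        then have "1 \<le> real_of_int b" "0 \<le> real_of_int (w 1)" using b0 w0[of 1] by simp_all
        \<comment> \<open>For \<open>b \<ge> 1\<close> the bound
          \<open>21 / 20 * b + 1 / 100\<close> is below \<open>2 * b\<close>, the smallest positive
          value that \<open>y 1\<close> could have.\<close>
        then have "real_of_int (y 1) < 2 * real_of_int b" using sum by linarith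
        then have "2 * b * k < 2 * b * 1" using k(2) by linarith
        then have "k < 1" using b0 by (simp only: mult_less_cancel_left)
        then show ?thesis using k by (cases "k = 0") auto
      qed (use k in simp)
    qed
    ultimately show ?thesis using one bg by auto
  next
    case False
    then have gb: "2 \<le> g" "1 \<le> b" using g0 b0 by (auto simp: g_def)
    obtain k where k: "2 ^ k \<le> 8 * g div 5" "8 * g div 5 < 2 ^ Suc k"
      "Suc k = floorlog 2 (nat (8 * g div 5))"
    proof -
      have "0 < 8 * g div 5" using gb(1) by simp
      then show thesis using power2_between[of "8 * g div 5"] that by blast
    qed
    define \<mu> :: int where "\<mu> = 2 ^ k"
    have \<mu>: "1 \<le> \<mu>" "5 * \<mu> \<le> 8 * g" "8 * g \<le> 10 * \<mu>"
      using k(1,2) by (simp_all add: \<mu>_def)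
    \<comment> \<open>As \<open>g \<le> 2 * total_rows t\<close>, the number
      \<open>8 * g div 5\<close> is at most \<open>16 / 5 * total_rows t\<close>, so
      \<open>\<mu>\<close> lies in the range of the search.\<close>
    have "Suc k \<le> floorlog 2 (nat (4 * total_rows t))"
      unfolding k(3) using g0 by (intro floorlog2_mono) auto
    then have mem: "\<mu> \<in> set (penalty_factors t)"
      unfolding set_penalty_factors \<mu>_def by auto
    have L: "real_of_int (y \<mu>) + \<mu> * w \<mu> \<le> 31 / 10 * (real_of_int b * g) + 21 / 20 * (real_of_int \<mu> * b) + 1 / 100"
      using ls \<mu>(1) by simp
    note cast = of_int_le_iff[where ?'a = real, THEN iffD2]
    have "5 * (\<mu> * b) \<le> 8 * (b * g)" "8 * (b * g) \<le> 10 * (\<mu> * b)"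
      using mult_right_mono[OF \<mu>(2), of b] mult_right_mono[OF \<mu>(3), of b] gb(2)
      by (simp_all add: mult_ac)
    then have 1: "5 * (real_of_int \<mu> * b) \<le> 8 * (real_of_int b * g)"
      and 2: "8 * (real_of_int b * g) \<le> 10 * (real_of_int \<mu> * b)"
      using cast[of "5 * (\<mu> * b)" "8 * (b * g)"] cast[of "8 * (b * g)" "10 * (\<mu> * b)"]
      by simp_all
    have "1 * 1 \<le> b * g" "1 * 1 \<le> \<mu> * b" using gb \<mu>(1) by (intro mult_mono; simp)+
    then have 3: "1 \<le> real_of_int b * g" and 4: "1 \<le> real_of_int \<mu> * b"
      using cast[of 1 "b * g"] cast[of 1 "\<mu> * b"] by simp_all
    have "0 \<le> real_of_int \<mu> * w \<mu>" "0 \<le> real_of_int (y \<mu>)" using w0 y0 \<mu>(1) by auto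
    \<comment> \<open>The coefficients are \<open>3.1 + 1.05 * 1.6 + 0.01 = 4.79\<close> for the
      value and \<open>3.1 * 1.25 + 1.05 + 0.01 = 4.935\<close> for the cost; \<open>b * g\<close>
      and \<open>\<mu> * b\<close> are at least 1 and absorb the additive error.\<close>
    then have "real_of_int (y \<mu>) \<le> 5 * (real_of_int b * g)"
      and w: "real_of_int \<mu> * w \<mu> \<le> 5 * (real_of_int \<mu> * b)"
      using L 1 2 3 4 by simp_all
    then have "real_of_int (y \<mu>) \<le> real_of_int (5 * (b * g))" by simp
    then have "y \<mu> \<le> 5 * (b * g)" by (simp only: of_int_le_iff)
    moreover have "real_of_int (\<mu> * w \<mu>) \<le> real_of_int (\<mu> * (5 * b))" using w by simp
    then have "\<mu> * w \<mu> \<le> \<mu> * (5 * b)" by (simp only: of_int_le_iff)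
    then have "w \<mu> \<le> 5 * b" using \<mu>(1) by simp
    ultimately show ?thesis using mem by blast
  qed
  then show ?thesis unfolding y_def w_def g_def b_def .
qed

lemma outlier_fun_correct:
  defines "T \<equiv> set (outlier_fun t)"
  shows "T \<subseteq> nodes I" "total_cost I T \<le> 5 * budget I"
    "outlier_objective I T \<le> 5 * outlier_opt I"
proof -
  let ?xs = "filter (\<lambda>y. int_total_cost t (snd y) \<le> 5 * int_budget t)
    (map (outlier_candidate t) (penalty_factors t))"
  let ?b = "(2 * int_budget t * total_rows t + 1, []) :: int \<times> nat list"
  let ?r = "best fst ?xs ?b"
  obtain Z where Z: "Z \<subseteq> nodes I" "total_cost I Z \<le> budget I" "outlier_opt I = outlier_objective I Z"
    using outlier_opt_obtain by blast
  obtain s where s: "s \<in> solutions I (nodes I - Z)"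
    "outlier_objective I Z = (\<Sum>i\<in>nodes I - Z. expected_dist I i (snd s i))"
    using outlier_objective_obtain[OF Z(1)] by blast
  have pos: "0 \<le> \<mu>" if "\<mu> \<in> set (penalty_factors t)" for \<mu>
    using that unfolding set_penalty_factors by auto
  obtain \<mu> where \<mu>: "\<mu> \<in> set (penalty_factors t)"
    "int_total_cost t (snd (outlier_candidate t \<mu>)) \<le> 5 * int_budget t"
    "fst (outlier_candidate t \<mu>)
      \<le> 5 * (int_budget t * (2 * (\<Sum>i\<in>nodes I - Z. expected_rows t ! i ! snd s i)))"
    using good_penalty_factor[OF Z(1,2) s(1)] by blast
  have r_le: "fst ?r \<le> fst (outlier_candidate t \<mu>)"
    using \<mu> by (intro best_le) auto
  have "fst (outlier_candidate t \<mu>) \<le> 2 * int_budget t * total_rows t"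
  proof -
    obtain s' where s': "s' \<in> solutions I (nodes I - set (snd (outlier_candidate t \<mu>)))"
      "fst (outlier_candidate t \<mu>) = 2 * int_budget t *
         (\<Sum>i\<in>nodes I - set (snd (outlier_candidate t \<mu>)). expected_rows t ! i ! snd s' i)"
      using outlier_candidate(4)[OF pos[OF \<mu>(1)]] by blast
    show ?thesis unfolding s'(2)
      using sum_rows_le_total[OF _ s'(1)] int_budget_nonneg by (intro mult_left_mono) auto
  qed
  then have "?r \<noteq> ?b" using r_le by auto
  then have "?r \<in> set ?xs" using best_in[of fst ?xs ?b] by blast
  then obtain \<nu> where \<nu>: "\<nu> \<in> set (penalty_factors t)" "?r = outlier_candidate t \<nu>"
    "int_total_cost t (snd (outlier_candidate t \<nu>)) \<le> 5 * int_budget t" by auto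
  note cand = outlier_candidate[OF pos[OF \<nu>(1)]]
  have T: "T = set (snd (outlier_candidate t \<nu>))"
    using \<nu>(2) by (simp add: T_def outlier_fun_def)
  show TI: "T \<subseteq> nodes I" unfolding T by (rule cand(2))
  have "cost_den * total_cost I T \<le> 5 * (cost_den * budget I)"
    using \<nu>(3) int_total_cost[OF cand(1,2)] int_costs(2) unfolding T by linarith
  then have "real_of_int cost_den * total_cost I T \<le> real_of_int cost_den * (5 * budget I)" by simp
  then show "total_cost I T \<le> 5 * budget I"
    using den_pos(3) by (simp only: mult_le_cancel_left_pos of_int_0_less_iff)
  have opt0: "0 \<le> outlier_opt I"
    unfolding Z(3) s(2) by (intro sum_nonneg expected_dist_nonneg)
  obtain s' where s': "s' \<in> solutions I (nodes I - T)"
    "fst (outlier_candidate t \<nu>)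
      = 2 * int_budget t * (\<Sum>i\<in>nodes I - T. expected_rows t ! i ! snd s' i)"
    using cand(4) unfolding T by blast
  have le: "outlier_objective I T \<le> (\<Sum>i\<in>nodes I - T. expected_dist I i (snd s' i))"
    by (rule outlier_objective_le[OF TI s'(1)])
  show "outlier_objective I T \<le> 5 * outlier_opt I"
  \<comment> \<open>For budget 0 all candidate values are 0 and say nothing about the objective, but
    then every node is an outlier and the objective is an empty sum.\<close>
  proof (cases "int_budget t = 0")
    case True
    then have "nodes I - T = {}" using cand(3) unfolding T by simp
    then show ?thesis using le opt0 by (simp only: sum.empty)
  next
    case False
    let ?X = "\<Sum>i\<in>nodes I - T. expected_rows t ! i ! snd s' i"
    let ?Y = "\<Sum>i\<in>nodes I - Z. expected_rows t ! i ! snd s i"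
    have "2 * int_budget t * ?X \<le> 2 * int_budget t * (5 * ?Y)"
      using r_le \<mu>(3) unfolding \<nu>(2) s'(2) by (simp add: mult_ac)
    then have "?X \<le> 5 * ?Y"
      using False int_budget_nonneg by (simp add: mult_le_cancel_left)
    then have "real_of_int ?X \<le> 5 * real_of_int ?Y" by linarith
    then have "(law_den * dist_den) * (\<Sum>i\<in>nodes I - T. expected_dist I i (snd s' i))
      \<le> (law_den * dist_den) * (5 * outlier_opt I)"
      unfolding Z(3) s(2) sum_rows[OF Diff_subset s'(1)] sum_rows[OF Diff_subset s(1)] by simp
    then have "(\<Sum>i\<in>nodes I - T. expected_dist I i (snd s' i)) \<le> 5 * outlier_opt I"
      using den_pos by (simp add: mult_le_cancel_left)
    then show ?thesis using le by linarith
  qed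
qed

section \<open>Correctness of the posterior algorithm\<close>

lemma posterior_clients:
  assumes "S \<subseteq> nodes I" "\<And>i. i \<in> S \<Longrightarrow> v i \<in> points I"
  defines "cls \<equiv> posterior_clients t (locations I S v)"
  shows "length cls = n"
    and "i < n \<Longrightarrow> length (snd (cls ! i)) = m"
    and "i < n \<Longrightarrow> fst (cls ! i) = sum_list (snd (cls ! i))"
    and "i < n \<Longrightarrow> w < m \<Longrightarrow>
      real_of_int (snd (cls ! i) ! w) = law_den * dist_den * node_dist I S v i w"
proof -
  let ?row = "\<lambda>i. if i \<in> S then map (\<lambda>e. law_den * e) (int_dists t ! v i) else expected_rows t ! i"
  have v: "i \<in> S \<Longrightarrow> v i < m" for i using assms(2) point_iff by blast
  have "cls = map (\<lambda>i. (sum_list (?row i), ?row i)) [0..<n]"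
    unfolding cls_def posterior_clients_def map_map o_def expected_rows(1)
    using v by (intro map_cong refl)
      (auto simp: locations_def nth_default_def expected_rows(1) int_dists(1) law_den_def)
  then have cls: "length cls = n" "i < n \<Longrightarrow> cls ! i = (sum_list (?row i), ?row i)" for i
    by simp_all
  show "length cls = n" by (rule cls(1))
  show "i < n \<Longrightarrow> length (snd (cls ! i)) = m"
    using v by (simp add: cls(2) expected_rows(2) int_dists(2))
  show "i < n \<Longrightarrow> fst (cls ! i) = sum_list (snd (cls ! i))" by (simp add: cls(2))
  show "i < n \<Longrightarrow> w < m \<Longrightarrow>
      real_of_int (snd (cls ! i) ! w) = law_den * dist_den * node_dist I S v i w"
    using v by (simp add: cls(2) expected_rows(3) int_dists node_dist_def)
qed

text \<open>The summand \<open>3 + 2 / p\<close> is the local search ratio, and \<open>1 / M\<close>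
  absorbs the additive error. Penalties are at least as large as all distances, so the cost with
  penalties is the plain connection cost.\<close>

lemma posterior_fun_correct:
  assumes S: "S \<subseteq> nodes I" and v: "\<And>i. i \<in> S \<Longrightarrow> v i \<in> points I"
    and p: "0 < p" and M: "1 < M" and \<alpha>: "3 + 2 / real p + 1 / of_int M \<le> \<alpha>"
  defines "sol \<equiv> dec_solution I (enc (posterior_fun p M (t, locations I S v)))"
  shows "sol \<in> solutions I (nodes I)"
    and "posterior_cost I S v sol \<le> \<alpha> * posterior_value I S v"
proof -
  let ?vs = "locations I S v"
  let ?cls = "posterior_clients t ?vs"
  let ?F = "posterior_centers p M t ?vs"
  let ?C = "conn (penalty ?cls) (center_dist ?cls) (set ?F)"
  let ?a = "\<lambda>i. best (nth_default 0 (snd (?cls ! i))) ?F (nth_default 0 ?F 0)"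
  have cls: "length ?cls = n" "\<And>i. i < n \<Longrightarrow> length (snd (?cls ! i)) = m"
    "\<And>i. i < n \<Longrightarrow> fst (?cls ! i) = sum_list (snd (?cls ! i))"
    "\<And>i w. i < n \<Longrightarrow> w < m \<Longrightarrow>
      real_of_int (snd (?cls ! i) ! w) = law_den * dist_den * node_dist I S v i w"
    using posterior_clients[of S v] S v by auto
  define \<kappa> where "\<kappa> = real_of_int (law_den * dist_den)"
  have \<kappa>: "0 < \<kappa>" using den_pos by (simp add: \<kappa>_def)
  have cd_nth: "center_dist ?cls i w = real_of_int (snd (?cls ! i) ! w)" if "i < n" "w < m" for i w
    using that cls(2) by (simp add: center_dist_def nth_default_def)
  have cd: "center_dist ?cls i w = \<kappa> * node_dist I S v i w" if "i < n" "w \<in> points I" for i w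
    using that cls(4) by (simp add: cd_nth point_iff \<kappa>_def)
  have entry0: "0 \<le> y" if i: "i < n" and y: "y \<in> set (snd (?cls ! i))" for i y
  proof -
    obtain w where w: "w < m" "y = snd (?cls ! i) ! w" using y cls(2)[OF i] by (auto simp: in_set_conv_nth)
    have "0 \<le> center_dist ?cls i w" using cd[OF i] w(1) \<kappa> node_dist_nonneg by (simp add: point_iff)
    then show ?thesis using cd_nth[OF i w(1)] w(2) by simp
  qed
  have pen: "0 \<le> penalty ?cls i" if "i < n" for i
    using that entry0 cls(3) by (auto simp: penalty_def intro!: sum_list_nonneg)
  obtain s where s: "s \<in> solutions I (nodes I)" "posterior_value I S v = posterior_cost I S v s"
    unfolding posterior_value_def using Min_solutions_obtain[of "nodes I"] by blast
  have ls: "center_set (in_centers t) (num_centers I) ?F"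
    "of_int (cost ?cls ?F) \<le> (3 + 2 / real p) * (\<kappa> * posterior_value I S v) + 1 / of_int M"
    unfolding posterior_centers_def
    using local_search_instance[of S v ?cls \<kappa> "{}" s p M] cls(1) \<kappa> cd pen p M s S v
    by (simp_all add: posterior_cost_eq)
  have F: "set ?F \<in> center_choices I" using center_set_choice[OF ls(1)] .
  \<comment> \<open>The head of the list is the start value of \<open>best\<close>; thus the chosen
    center always belongs to \<open>?F\<close>.\<close>
  then have F0: "nth_default 0 ?F 0 \<in> set ?F" using center_choicesD(2)[OF F] by (simp add: nth_default_def)
  then have a: "?a i \<in> set ?F" for i using best_in[of _ ?F "nth_default 0 ?F 0"] by (metis insert_absorb)
  have sol: "sol = (set ?F, \<lambda>i\<in>nodes I. ?a i)"
    unfolding sol_def dec_solution_def posterior_fun_def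
    by (auto simp: dec_set_enc cdr_enc cls(1) fun_eq_iff)
  show "sol \<in> solutions I (nodes I)"
    unfolding sol solutions_iff using F a by auto
  have pts: "?a i < m" for i using a center_choicesD(3)[OF F] point_iff by blast
  have conn: "\<kappa> * node_dist I S v i (?a i) \<le> ?C i" if i: "i < n" for i
  proof -
    have le: "center_dist ?cls i (?a i) \<le> center_dist ?cls i w" if "w \<in> set ?F" for w
      unfolding center_dist_def of_int_le_iff using that by (intro best_le) simp
    have "snd (?cls ! i) ! ?a i \<le> sum_list (snd (?cls ! i))"
      using entry0[OF i] cls(2)[OF i] pts by (intro member_le_sum_list_int) auto
    then have "center_dist ?cls i (?a i) \<le> penalty ?cls i"
      using cls(3)[OF i] by (simp add: cd_nth i pts penalty_def)
    then have "center_dist ?cls i (?a i) \<le> ?C i"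
      using conn_cases[of "set ?F" "penalty ?cls" "center_dist ?cls" i] le by auto
    then show ?thesis using cd[OF i] pts point_iff by simp
  qed
  have int: "\<kappa> * posterior_cost I S v s' = of_int (\<Sum>i\<in>nodes I. snd (?cls ! i) ! snd s' i)"
    if s': "s' \<in> solutions I (nodes I)" for s'
    unfolding posterior_cost_eq[OF S] sum_distrib_left of_int_sum
  proof (rule sum.cong[OF refl])
    fix i assume i: "i \<in> nodes I"
    then show "\<kappa> * node_dist I S v i (snd s' i) = real_of_int (snd (?cls ! i) ! snd s' i)"
      using cd[of i "snd s' i"] cd_nth[of i "snd s' i"] solution_point[OF s' i] point_iff by simp
  qed
  obtain x y where x: "\<kappa> * posterior_cost I S v sol = of_int x"
    and y: "\<kappa> * posterior_value I S v = of_int y"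
    using int[OF \<open>sol \<in> solutions I (nodes I)\<close>] int[OF s(1)] s(2) by metis
  have "of_int x = (\<Sum>i\<in>nodes I. \<kappa> * node_dist I S v i (?a i))"
    unfolding x[symmetric] posterior_cost_eq[OF S] sum_distrib_left sol by (intro sum.cong) auto
  also have "\<dots> \<le> sum ?C (nodes I)" using conn by (intro sum_mono) auto
  also have "\<dots> = of_int (cost ?cls ?F)" by (simp add: cost_conn cls(1))
  finally have xy: "real_of_int x \<le> (3 + 2 / real p) * of_int y + 1 / of_int M"
    using ls(2) y by simp
  have "0 \<le> \<kappa> * posterior_value I S v"
    unfolding s(2) posterior_cost_eq[OF S] using \<kappa> node_dist_nonneg
    by (intro mult_nonneg_nonneg sum_nonneg) auto
  then have y0: "0 \<le> y" unfolding y by simp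
  \<comment> \<open>Both numbers are integers: if \<open>y = 0\<close>, then \<open>x\<close> is
    below 1 and hence at most 0; otherwise \<open>1 / M\<close> is at most
    \<open>y / M\<close>.\<close>
  have "real_of_int x \<le> \<alpha> * of_int y"
  proof (cases "y = 0")
    case True
    have "1 / of_int M < (1 :: real)" using M by simp
    then have "real_of_int x < 1" using xy True by simp
    then show ?thesis using True by simp
  next
    case False
    then have "1 \<le> real_of_int y" using y0 by simp
    then have "1 / of_int M \<le> 1 / of_int M * real_of_int y" using M by (simp add: divide_right_mono)
    then have "real_of_int x \<le> (3 + 2 / real p + 1 / of_int M) * of_int y"
      using xy by (simp add: distrib_right)
    also have "\<dots> \<le> \<alpha> * of_int y" using \<alpha> y0 by (intro mult_right_mono) auto
    finally show ?thesis .
  qed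
  then have "\<kappa> * posterior_cost I S v sol \<le> \<kappa> * (\<alpha> * posterior_value I S v)"
    unfolding x mult.left_commute[of \<kappa>] y .
  then show "posterior_cost I S v sol \<le> \<alpha> * posterior_value I S v"
    using \<kappa> by (simp only: mult_le_cancel_left_pos)
qed

end

section \<open>Existence of the programs and the combined guarantee\<close>

lemma rational_kmedianI: "rational_instance I \<Longrightarrow> rational_kmedian I"
  by unfold_locales (simp_all add: rational_instance_def)

lemma polynomial_time_on_subset: "polynomial_time_on X P \<Longrightarrow> Y \<subseteq> X \<Longrightarrow> polynomial_time_on Y P"
  unfolding polynomial_time_on_def by blast

lemma outlier_algorithm_exists: "\<exists>P. outlier_algorithm 5 5 P"
proof -
  obtain P where P: "\<And>x. result P (enc x) = enc (outlier_fun x)"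
    "polynomial_time_on (range (enc :: input \<Rightarrow> val)) P"
    using polytime_program[OF polytime_outlier_fun] by blast
  have "output_set P I = set (outlier_fun (input_of I))" for I
    unfolding output_set_def enc_input_of[symmetric] P(1) by (rule dec_set_enc)
  moreover have "{enc_instance I | I. rational_instance I} \<subseteq> range (enc :: input \<Rightarrow> val)"
    by (auto simp flip: enc_input_of)
  ultimately have "outlier_algorithm 5 5 P"
    unfolding outlier_algorithm_def
    using polynomial_time_on_subset[OF P(2)] rational_kmedian.outlier_fun_correct[OF rational_kmedianI]
    by simp
  then show ?thesis ..
qed

lemma posterior_algorithm_exists:
  assumes "0 < \<epsilon>"
  shows "\<exists>Q. posterior_algorithm (3 + \<epsilon>) Q"
proof -
  obtain k where k: "0 < k" "1 / real k < \<epsilon> / 3"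
    using assms by (metis divide_pos_pos nat_approx_posE of_nat_Suc zero_less_Suc zero_less_numeral)
  \<comment> \<open>The same number serves as \<open>p\<close> and as \<open>M\<close>, so the
    excess over 3 is \<open>3 / p\<close>, which is below \<open>\<epsilon>\<close>; the successor
    makes it exceed 1.\<close>
  define p where "p = Suc k"
  have "1 / real p \<le> 1 / real k" using k(1) by (simp add: p_def frac_le)
  then have \<epsilon>: "3 + 2 / real p + 1 / of_int (int p) \<le> 3 + \<epsilon>" using k(2) by simp
  have p: "0 < p" "1 < int p" using k(1) by (auto simp: p_def)
  obtain Q where Q: "\<And>x. result Q (enc x) = enc (posterior_fun p (int p) x)"
    "polynomial_time_on (range (enc :: input \<times> nat option list \<Rightarrow> val)) Q"
    using polytime_program[OF polytime_posterior_fun] by blast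
  have "output_solution Q I S v
      = dec_solution I (enc (posterior_fun p (int p) (input_of I, locations I S v)))" for I S v
    unfolding output_solution_def enc_locations[symmetric] Q(1) ..
  moreover have "{enc_posterior I S v | I S v. posterior_instance I S v}
      \<subseteq> range (enc :: input \<times> nat option list \<Rightarrow> val)"
    unfolding enc_locations[symmetric] by blast
  ultimately have "posterior_algorithm (3 + \<epsilon>) Q"
    unfolding posterior_algorithm_def posterior_instance_def
    using polynomial_time_on_subset[OF Q(2)]
      rational_kmedian.posterior_fun_correct[OF rational_kmedianI _ _ p \<epsilon>]
    by simp
  then show ?thesis ..
qed

theorem theorem6:
  shows "(\<forall>I :: 'a kmedian. valid_instance I \<longrightarrow> P2 5 I)
    \<and> (\<exists>P. outlier_algorithm 5 5 P)
    \<and> (\<forall>\<epsilon>>0. \<exists>Q. posterior_algorithm (3 + \<epsilon>) Q)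
    \<and> (\<forall>\<epsilon>>0. \<exists>M. \<forall>P Q. outlier_algorithm 5 5 P \<and> posterior_algorithm (3 + \<epsilon>) Q \<longrightarrow>
         (\<forall>I. rational_instance I \<longrightarrow>
            total_cost I (output_set P I) \<le> 5 * budget I \<and>
            strategy_cost I (output_set P I) (output_solution Q I (output_set P I)) \<le> M * OPT I))"
proof (intro conjI allI impI)
  show "P2 5 I" if "valid_instance I" for I :: "'a kmedian"
    using kmedian_instance.P2_5 that by (simp add: kmedian_instance_def)
  show "\<exists>P. outlier_algorithm 5 5 P" by (rule outlier_algorithm_exists)
  show "\<exists>Q. posterior_algorithm (3 + \<epsilon>) Q" if "0 < \<epsilon>" for \<epsilon>
    using that by (rule posterior_algorithm_exists)
  fix \<epsilon> :: real
  assume \<epsilon>: "0 < \<epsilon>"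
  show "\<exists>M. \<forall>P Q. outlier_algorithm 5 5 P \<and> posterior_algorithm (3 + \<epsilon>) Q \<longrightarrow>
         (\<forall>I. rational_instance I \<longrightarrow>
            total_cost I (output_set P I) \<le> 5 * budget I \<and>
            strategy_cost I (output_set P I) (output_solution Q I (output_set P I)) \<le> M * OPT I)"
  proof (intro exI allI impI, elim conjE, intro conjI)
    fix P Q I
    assume P: "outlier_algorithm 5 5 P" and Q: "posterior_algorithm (3 + \<epsilon>) Q"
      and I: "rational_instance I"
    let ?T = "output_set P I"
    interpret rational_kmedian I by (rule rational_kmedianI[OF I])
    have T: "?T \<subseteq> nodes I" "total_cost I ?T \<le> 5 * budget I"
      "outlier_objective I ?T \<le> 5 * outlier_opt I"
      using P I unfolding outlier_algorithm_def by auto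
    show "total_cost I ?T \<le> 5 * budget I" by (rule T(2))
    \<comment> \<open>The constant is \<open>strategy_cost_bound\<close> for
      \<open>\<alpha> = 3 + \<epsilon>\<close> and \<open>\<beta> = 5\<close>; it depends on neither
      the programs nor the instance.\<close>
    show "strategy_cost I ?T (output_solution Q I ?T) \<le> (3 + \<epsilon>) * (5 * (2 + 5)) * OPT I"
    proof (rule strategy_cost_bound[OF T(1) _ _ T(3)])
      fix v assume "\<And>i. i \<in> ?T \<Longrightarrow> v i \<in> points I"
      then have "posterior_instance I ?T v" using I T(1) by (simp add: posterior_instance_def)
      then show "posterior_cost I ?T v (output_solution Q I ?T v) \<le> (3 + \<epsilon>) * posterior_value I ?T v"
        using Q unfolding posterior_algorithm_def by blast
    qed (use \<epsilon> in auto)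
  qed
qed

end
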